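(* Let $N\ge1$, let $\mathbb{T}^N=\mathbb{R}^N/\mathbb{Z}^N$, and let $\gamma'>1$. Let $\beta>1$ be such that $$\beta<\begin{cases}1+\gamma'/(N-\gamma') & \text{if }\gamma'<N,\\ \infty & \text{if }\gamma'\ge N.\end{cases}$$ Then there exist $C>0$ and $\delta>1$, depending on $\beta$, $N$ and $\gamma'$, such that for all $m\in W^{1,2}(\mathbb{T}^N)$ and $A\in L^\infty(\mathbb{T}^N;\mathbb{R}^N)$ solving weakly $$-\Delta m+\mathrm{div}(A\,m)=0\ \text{ in }\mathbb{T}^N,\qquad\int_{\mathbb{T}^N}m\,dx=1,$$ it holds that $$\|m\|_{L^\beta(\mathbb{T}^N)}^{\delta}\le C\left(\int_{\mathbb{T}^N}|A|^{\gamma'}m\,dx+1\right).$$ Moreover, if $1<\beta<1+\gamma'/N$, then (with $C>0$ and $\delta>1$ depending on $\beta,N,\gamma'$ suitably chosen) for all such $m,A$ it also holds that $$\|m\|_{L^\beta(\mathbb{T}^N)}^{\delta\beta}\le C\left(\int_{\mathbb{T}^N}|A|^{\gamma'}m\,dx+1\right).$$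
   Context: Weak solution means: $\int_{\mathbb{T}^N}\big(\nabla m\cdot\nabla\varphi-m\,A\cdot\nabla\varphi\big)\,dx=0$ for all $\varphi\in C^\infty(\mathbb{T}^N)$. *)

theory Defs
  imports "HOL-Analysis.Analysis"
begin

text \<open>
  The torus \<open>\<real>\<^sup>N / \<int>\<^sup>N\<close>, with \<open>N = CARD('n)\<close>: functions on it are \<open>\<int>\<^sup>N\<close>-periodic functions on
  \<open>real ^ 'n\<close>, and its measure is Lebesgue measure on the unit cube. The cube is taken closed, its
  boundary being a null set.
\<close>

definition periodic :: "(real ^ 'n \<Rightarrow> 'b) \<Rightarrow> bool" where
  "periodic u \<longleftrightarrow> (\<forall>x k. (\<forall>i. k $ i \<in> \<int>) \<longrightarrow> u (x + k) = u x)"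

definition torus_measure :: "(real ^ 'n) measure" where
  "torus_measure = lebesgue_on (cbox 0 1)"

definition in_Lp :: "real \<Rightarrow> (real ^ 'n \<Rightarrow> 'b::euclidean_space) \<Rightarrow> bool" where
  "in_Lp p u \<longleftrightarrow> periodic u \<and> u \<in> borel_measurable torus_measure \<and>
     integrable torus_measure (\<lambda>x. norm (u x) powr p)"

text \<open>Meaningful only together with \<^const>\<open>in_Lp\<close>: the Bochner integral of a non-integrable
  function is 0.\<close>

definition Lp_norm :: "real \<Rightarrow> (real ^ 'n \<Rightarrow> 'b::euclidean_space) \<Rightarrow> real" where
  "Lp_norm p u = (LINT x|torus_measure. norm (u x) powr p) powr (1 / p)"

definition in_Linf :: "(real ^ 'n \<Rightarrow> 'b::euclidean_space) \<Rightarrow> bool" where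
  "in_Linf u \<longleftrightarrow> periodic u \<and> u \<in> borel_measurable torus_measure \<and>
     (\<exists>K. AE x in torus_measure. norm (u x) \<le> K)"

definition partial :: "'n \<Rightarrow> (real ^ 'n \<Rightarrow> real) \<Rightarrow> real ^ 'n \<Rightarrow> real" where
  "partial i f x = frechet_derivative f (at x) (axis i 1)"

definition grad :: "(real ^ 'n \<Rightarrow> real) \<Rightarrow> real ^ 'n \<Rightarrow> real ^ 'n" where
  "grad f x = (\<chi> i. partial i f x)"

text \<open>\<open>C\<^sup>\<infinity>\<close>: every iterated partial derivative is (Frechet) differentiable everywhere; in particular
  partial derivatives of all orders exist and are continuous.\<close>

definition smooth :: "(real ^ 'n \<Rightarrow> real) \<Rightarrow> bool" where
  "smooth f \<longleftrightarrow> (\<forall>is. foldr partial is f differentiable_on UNIV)"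

definition test_function :: "(real ^ 'n \<Rightarrow> real) \<Rightarrow> bool" where
  "test_function \<phi> \<longleftrightarrow> periodic \<phi> \<and> smooth \<phi>"

text \<open>\<open>m\<close> belongs to \<open>W\<^bsup>1,2\<^esup>\<close> of the torus and \<open>g\<close> is (a representative of) its weak gradient.\<close>

definition has_W12_gradient :: "(real ^ 'n \<Rightarrow> real) \<Rightarrow> (real ^ 'n \<Rightarrow> real ^ 'n) \<Rightarrow> bool" where
  "has_W12_gradient m g \<longleftrightarrow> in_Lp 2 m \<and> in_Lp 2 g \<and>
     (\<forall>\<phi> i. test_function \<phi> \<longrightarrow>
        (LINT x|torus_measure. m x * partial i \<phi> x) = - (LINT x|torus_measure. g x $ i * \<phi> x))"

definition in_W12 :: "(real ^ 'n \<Rightarrow> real) \<Rightarrow> bool" where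
  "in_W12 m \<longleftrightarrow> (\<exists>g. has_W12_gradient m g)"

text \<open>Weak solutions \<open>m\<close> of \<open>- \<Delta> m + div (A m) = 0\<close> on the torus. The weak gradient \<open>g\<close> is
  determined by \<open>m\<close> up to a null set, so the choice of representative is immaterial.\<close>

definition weak_solution :: "(real ^ 'n \<Rightarrow> real ^ 'n) \<Rightarrow> (real ^ 'n \<Rightarrow> real) \<Rightarrow> bool" where
  "weak_solution A m \<longleftrightarrow> (\<exists>g. has_W12_gradient m g \<and>
     (\<forall>\<phi>. test_function \<phi> \<longrightarrow>
        (LINT x|torus_measure. g x \<bullet> grad \<phi> x - m x * (A x \<bullet> grad \<phi> x)) = 0))"

end

theory Submission
  imports Defs "HOL-Probability.Probability_Measure"
begin

text \<open>
  Let \<open>rho x\<close> be the sum of the \<open>(sin (pi x\<^sub>i))\<^sup>2\<close>, a smooth substitute for the squared distance to the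
  lattice. Testing the equation with a function of \<open>rho + eps\<close> that imitates the Green function of the
  Laplacian bounds a mollification of \<open>m\<close> by the convolution of \<open>(1 + |A|) |m|\<close> with
  \<open>(rho + eps)\<^bsup>(1 - N) / 2\<^esup>\<close>. This kernel is bounded in \<open>L\<^sup>r\<close> for \<open>r < N / (N - 1)\<close>, uniformly in \<open>eps\<close>,
  so Young's inequality and Fatou's lemma give, for \<open>1 / \<beta> = 1 / q - \<sigma>\<close> and \<open>\<sigma> < 1 / N\<close>,
  that the \<open>L\<^sup>\<beta>\<close> norm of \<open>m\<close> is at most a constant times the \<open>L\<^sup>q\<close> norm of \<open>(1 + |A|) |m|\<close>. Iterating from
  \<open>L\<^sup>1\<close>, \<open>m\<close> lies in every \<open>L\<^sup>p\<close>; no elliptic regularity theory is needed because the range of \<open>\<beta>\<close> is open.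

  Testing the mollified equation with bounded functions of \<open>m / e\<close> and letting \<open>e\<close> tend to 0 shows that
  \<open>sgn m\<close> has weak gradient zero. Hence \<open>m > 0\<close> almost everywhere, \<open>m\<close> is a probability density, and Hoelder's
  inequality bounds the \<open>L\<^sup>q\<close> norm above by the product of powers of the integrals of
  \<open>(1 + |A|)\<^bsup>\<gamma>'\<^esup> m\<close> and \<open>m\<^sup>\<beta>\<close>; the latter is absorbed.
\<close>

section \<open>Smooth functions\<close>

text \<open>The Green function of the torus has no convenient closed form, and the equation accepts
  only smooth periodic test functions. Powers of \<open>rho + eps\<close> answer both difficulties:
  the Laplacian of the regularised Green function is a negative multiple of the approximate identity
  \<open>bump\<close>, up to an error no larger than the kernel that bounds its gradient. So one
  test function yields a mollification of m on one side and a convolution with that kernel on the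
  other. The iteration to all \<open>L\<^sup>p\<close> is qualitative, with bounds that depend on
  the sup norm of A; it makes the integral of \<open>m\<^sup>\<beta>\<close> finite, without which
  it could not be absorbed. For positivity the decisive point is that the drift is linear in m:
  after testing it leaves \<open>e\<^sup>2 m\<^sup>2 / (e\<^sup>2 + m\<^sup>2)\<^sup>2\<close>,
  which is at most 1 and tends to 0 at every point. The parameter \<open>\<sigma>\<close> is the
  gain in reciprocal exponent of one convolution. For the first estimate it is taken strictly
  between \<open>(1 - 1 / \<beta>) / \<gamma>'\<close> and \<open>1 / N\<close>; the range of
  \<open>\<beta>\<close> is exactly what leaves this gap, and the strict lower bound is what makes
  \<open>\<delta>\<close> exceed 1.\<close>

lemma partial_eqI: "(f has_derivative f') (at x) \<Longrightarrow> partial i f x = f' (axis i 1)"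
  by (metis partial_def frechet_derivative_at)

lemma has_derivative_frechet:
  "f differentiable_on UNIV \<Longrightarrow> (f has_derivative frechet_derivative f (at x)) (at x)"
  by (metis UNIV_I differentiable_on_def frechet_derivative_works)

lemma frechet_derivative_eq_sum_partial:
  fixes f :: "real ^ 'n \<Rightarrow> real"
  assumes "f differentiable_on UNIV"
  shows "frechet_derivative f (at x) h = (\<Sum>i\<in>UNIV. h $ i * partial i f x)"
proof -
  have lin: "linear (frechet_derivative f (at x))"
    using has_derivative_frechet[OF assms] by (rule has_derivative_linear)
  have "frechet_derivative f (at x) h = frechet_derivative f (at x) (\<Sum>i\<in>UNIV. h $ i *\<^sub>R axis i 1)"
    by (simp add: basis_expansion flip: scalar_mult_eq_scaleR)
  also have "\<dots> = (\<Sum>i\<in>UNIV. h $ i * partial i f x)"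
    using lin by (simp add: linear_sum linear_cmul partial_def)
  finally show ?thesis .
qed

lemma has_derivative_sum_partial:
  fixes f :: "real ^ 'n \<Rightarrow> real"
  assumes "f differentiable_on UNIV"
  shows "(f has_derivative (\<lambda>h. \<Sum>i\<in>UNIV. h $ i * partial i f x)) (at x)"
  using has_derivative_frechet[OF assms] frechet_derivative_eq_sum_partial[OF assms]
  by (metis (no_types, lifting) ext)

text \<open>Smoothness graded by order, so that closure properties can be proved by induction: one
  differentiation turns the claim at order n + 1 into the claim at order n for other functions of
  the same shape.\<close>

primrec diff_upto :: "nat \<Rightarrow> (real ^ 'n \<Rightarrow> real) \<Rightarrow> bool" where
  "diff_upto 0 f \<longleftrightarrow> f differentiable_on UNIV"
| "diff_upto (Suc n) f \<longleftrightarrow> f differentiable_on UNIV \<and> (\<forall>i. diff_upto n (partial i f))"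

text \<open>In \<open>foldr partial is f\<close> the last index of the list is applied to f first,
  so the induction splits lists at their end.\<close>

lemma diff_upto_iff:
  "diff_upto n f \<longleftrightarrow> (\<forall>is. length is \<le> n \<longrightarrow> foldr partial is f differentiable_on UNIV)"
proof (induction n arbitrary: f)
  case (Suc n)
  show ?case
  proof
    assume *: "diff_upto (Suc n) f"
    show "\<forall>is. length is \<le> Suc n \<longrightarrow> foldr partial is f differentiable_on UNIV"
    proof (intro allI impI)
      fix "is" :: "'a list" assume "length is \<le> Suc n"
      with * Suc show "foldr partial is f differentiable_on UNIV"
        by (cases "is" rule: rev_cases) auto
    qed
  next
    assume *: "\<forall>is. length is \<le> Suc n \<longrightarrow> foldr partial is f differentiable_on UNIV"
    then have "f differentiable_on UNIV" by (metis foldr_Nil id_apply le0 list.size(3))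
    moreover have "foldr partial is (partial i f) differentiable_on UNIV" if "length is \<le> n" for "is" i
      using *[rule_format, of "is @ [i]"] that by simp
    ultimately show "diff_upto (Suc n) f" using Suc by simp
  qed
qed simp

lemma smooth_iff_diff_upto: "smooth f \<longleftrightarrow> (\<forall>n. diff_upto n f)"
  unfolding smooth_def diff_upto_iff by blast

lemma diff_upto_differentiable: "diff_upto n f \<Longrightarrow> f differentiable_on UNIV"
  by (cases n) auto

lemma diff_upto_mono: "diff_upto (Suc n) f \<Longrightarrow> diff_upto n f"
  unfolding diff_upto_iff by auto

lemma partial_const: "partial i (\<lambda>x. c) = (\<lambda>x. 0)"
  by (intro ext partial_eqI has_derivative_const)

lemma partial_add:
  assumes "f differentiable_on UNIV" "g differentiable_on UNIV"
  shows "partial i (\<lambda>x. f x + g x) = (\<lambda>x. partial i f x + partial i g x)"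
  unfolding partial_def
  using has_derivative_add[OF has_derivative_frechet[OF assms(1)] has_derivative_frechet[OF assms(2)]]
  by (metis (no_types, lifting) frechet_derivative_at)

lemma partial_mult:
  assumes "f differentiable_on UNIV" "g differentiable_on UNIV"
  shows "partial i (\<lambda>x. f x * g x) = (\<lambda>x. f x * partial i g x + partial i f x * g x)"
  unfolding partial_def
  using has_derivative_mult[OF has_derivative_frechet[OF assms(1)] has_derivative_frechet[OF assms(2)]]
  by (metis (no_types, lifting) frechet_derivative_at)

lemma partial_compose:
  assumes "f differentiable_on UNIV" and "\<And>x. (h has_real_derivative h' (f x)) (at (f x))"
  shows "partial i (\<lambda>x. h (f x)) = (\<lambda>x. h' (f x) * partial i f x)"
proof
  fix x
  have "((\<lambda>x. h (f x)) has_derivative (\<lambda>v. h' (f x) * frechet_derivative f (at x) v)) (at x)"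
    using has_derivative_compose[OF has_derivative_frechet[OF assms(1)]
      assms(2)[of x, THEN has_field_derivative_imp_has_derivative]] .
  then show "partial i (\<lambda>x. h (f x)) x = h' (f x) * partial i f x"
    by (simp add: partial_eqI) (simp add: partial_def)
qed

lemma differentiable_compose_real:
  fixes f :: "real ^ 'n \<Rightarrow> real"
  assumes "f differentiable_on UNIV" and "\<And>x. (h has_real_derivative h' (f x)) (at (f x))"
  shows "(\<lambda>x. h (f x)) differentiable_on UNIV"
  unfolding differentiable_on_def
  using has_derivative_compose[OF has_derivative_frechet[OF assms(1)]
      assms(2)[THEN has_field_derivative_imp_has_derivative]]
  by (auto simp: differentiable_def)

lemma has_derivative_reflect:
  fixes f :: "real ^ 'n \<Rightarrow> real"
  assumes "f differentiable_on UNIV"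
  shows "((\<lambda>y. f (a - y)) has_derivative (\<lambda>v. frechet_derivative f (at (a - y)) (- v))) (at y)"
  by (rule has_derivative_compose[OF _ has_derivative_frechet[OF assms], where f = "\<lambda>y. a - y" ])
     (auto intro!: derivative_eq_intros)

lemma partial_reflect:
  fixes f :: "real ^ 'n \<Rightarrow> real"
  assumes "f differentiable_on UNIV"
  shows "partial i (\<lambda>y. f (a - y)) = (\<lambda>y. - partial i f (a - y))"
proof
  fix y
  have "linear (frechet_derivative f (at (a - y)))"
    using has_derivative_frechet[OF assms] by (rule has_derivative_linear)
  then show "partial i (\<lambda>y. f (a - y)) y = - partial i f (a - y)"
    using partial_eqI[OF has_derivative_reflect[OF assms]] by (simp add: linear_neg partial_def)
qed

lemma differentiable_reflect:
  fixes f :: "real ^ 'n \<Rightarrow> real"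
  assumes "f differentiable_on UNIV"
  shows "(\<lambda>y. f (a - y)) differentiable_on UNIV"
  using has_derivative_reflect[OF assms] by (auto simp: differentiable_on_def differentiable_def)

lemma diff_upto_const: "diff_upto n (\<lambda>x. c)"
  by (induction n arbitrary: c) (auto simp: partial_const)

lemma diff_upto_add: "diff_upto n f \<Longrightarrow> diff_upto n g \<Longrightarrow> diff_upto n (\<lambda>x. f x + g x)"
  by (induction n arbitrary: f g) (auto simp: partial_add)

lemma diff_upto_mult: "diff_upto n f \<Longrightarrow> diff_upto n g \<Longrightarrow> diff_upto n (\<lambda>x. f x * g x)"
proof (induction n arbitrary: f g)
  case (Suc n)
  then have "diff_upto n f" "diff_upto n g" using diff_upto_mono by blast+
  with Suc show ?case
    by (auto simp: partial_mult intro!: diff_upto_add Suc.IH)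
qed auto

lemma diff_upto_reflect: "diff_upto n f \<Longrightarrow> diff_upto n (\<lambda>y. f (a - y))"
proof (induction n arbitrary: f)
  case (Suc n)
  have "diff_upto n (\<lambda>y. - 1 * partial i f (a - y))" for i
    using Suc by (intro diff_upto_mult diff_upto_const Suc.IH) auto
  with Suc.prems show ?case by (simp add: partial_reflect differentiable_reflect)
qed (simp add: differentiable_reflect)

text \<open>Differentiating lowers the exponent by one, so the exponent varies in the induction.
  Positivity of f keeps every power differentiable.\<close>

lemma diff_upto_powr:
  assumes "\<And>x. f x > 0"
  shows "diff_upto n f \<Longrightarrow> diff_upto n (\<lambda>x. f x powr a)"
proof (induction n arbitrary: a)
  have d: "((\<lambda>y. y powr a) has_real_derivative a * f x powr (a - 1)) (at (f x))" for x and a :: real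
    using has_real_derivative_powr[OF assms[of x]] .
  {
    case 0
    then show ?case using differentiable_compose_real[of f, OF _ d] by simp
  next
    case (Suc n)
    have "diff_upto n (\<lambda>x. a * f x powr (a - 1) * partial i f x)" for i
      using Suc diff_upto_mono[OF Suc.prems] by (intro diff_upto_mult diff_upto_const Suc.IH) auto
    with Suc.prems differentiable_compose_real[of f, OF _ d, of a] show ?case
      by (simp add: partial_compose[of f, OF _ d])
  }
qed

lemma smooth_differentiable: "smooth f \<Longrightarrow> f differentiable_on UNIV"
  unfolding smooth_iff_diff_upto using diff_upto_differentiable by blast

lemma smooth_partial: "smooth f \<Longrightarrow> smooth (partial i f)"
  by (simp add: smooth_iff_diff_upto) (meson diff_upto.simps(2))

lemma smoothI: "f differentiable_on UNIV \<Longrightarrow> (\<And>i. smooth (partial i f)) \<Longrightarrow> smooth f"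
  unfolding smooth_iff_diff_upto
proof
  fix n
  show "f differentiable_on UNIV \<Longrightarrow> (\<And>i. \<forall>n. diff_upto n (partial i f)) \<Longrightarrow> diff_upto n f"
    by (cases n) auto
qed

lemma smooth_const: "smooth (\<lambda>x. c)"
  by (simp add: smooth_iff_diff_upto diff_upto_const)

lemma smooth_add: "smooth f \<Longrightarrow> smooth g \<Longrightarrow> smooth (\<lambda>x. f x + g x)"
  by (simp add: smooth_iff_diff_upto diff_upto_add)

lemma smooth_mult: "smooth f \<Longrightarrow> smooth g \<Longrightarrow> smooth (\<lambda>x. f x * g x)"
  by (simp add: smooth_iff_diff_upto diff_upto_mult)

lemma smooth_diff: "smooth f \<Longrightarrow> smooth g \<Longrightarrow> smooth (\<lambda>x. f x - g x)"
  using smooth_add[OF _ smooth_mult[OF smooth_const[of "-1"]], of f g] by simp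

lemma smooth_sum: "(\<And>i. i \<in> I \<Longrightarrow> smooth (f i)) \<Longrightarrow> smooth (\<lambda>x. \<Sum>i\<in>I. f i x)"
  by (induction I rule: infinite_finite_induct) (auto intro: smooth_const smooth_add)

lemma smooth_reflect: "smooth f \<Longrightarrow> smooth (\<lambda>y. f (a - y))"
  by (simp add: smooth_iff_diff_upto diff_upto_reflect)

lemma smooth_powr: "smooth f \<Longrightarrow> (\<And>x. f x > 0) \<Longrightarrow> smooth (\<lambda>x. f x powr a)"
  by (simp add: smooth_iff_diff_upto diff_upto_powr)

text \<open>Smoothness of a composite with a logarithm, a power or an arctangent is reduced to
  smoothness of the composite with its derivative, which in each use is built from powers of
  positive functions.\<close>

lemma smooth_compose:
  assumes "smooth f" and "\<And>x. (h has_real_derivative h' (f x)) (at (f x))" and "smooth (\<lambda>x. h' (f x))"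
  shows "smooth (\<lambda>x. h (f x))"
proof (rule smoothI)
  show "(\<lambda>x. h (f x)) differentiable_on UNIV"
    using differentiable_compose_real[OF smooth_differentiable[OF assms(1)] assms(2)] .
  show "smooth (partial i (\<lambda>x. h (f x)))" for i
    unfolding partial_compose[of f h h', OF smooth_differentiable[OF assms(1)] assms(2)]
    by (intro smooth_mult smooth_partial assms)
qed

lemma smooth_continuous: "smooth f \<Longrightarrow> continuous_on UNIV f"
  using smooth_differentiable differentiable_imp_continuous_on by blast

lemma smooth_borel_measurable: "smooth f \<Longrightarrow> f \<in> borel_measurable borel"
  using smooth_continuous by (rule borel_measurable_continuous_onI)

lemma periodic_partial:
  fixes f :: "real ^ 'n \<Rightarrow> real"
  assumes "periodic f" "f differentiable_on UNIV"
  shows "periodic (partial i f)"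
  unfolding periodic_def
proof (intro allI impI)
  fix x k :: "real ^ 'n" assume k: "\<forall>i. k $ i \<in> \<int>"
  have "((\<lambda>y. f (y + k)) has_derivative (\<lambda>v. frechet_derivative f (at (x + k)) v)) (at x)"
    by (rule has_derivative_compose[OF _ has_derivative_frechet[OF assms(2)], where f = "\<lambda>y. y + k"])
       (auto intro!: derivative_eq_intros)
  moreover have "(\<lambda>y. f (y + k)) = f" using assms(1) k by (auto simp: periodic_def)
  ultimately have "partial i f x = frechet_derivative f (at (x + k)) (axis i 1)"
    by (simp add: partial_eqI)
  then show "partial i f (x + k) = partial i f x" by (simp add: partial_def)
qed

lemma periodic_reflect:
  fixes f :: "real ^ 'n \<Rightarrow> 'b"
  assumes "periodic f" shows "periodic (\<lambda>y. f (a - y))"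
  unfolding periodic_def
proof (intro allI impI)
  fix y k :: "real ^ 'n" assume k: "\<forall>i. k $ i \<in> \<int>"
  then have "f (a - y + (- k)) = f (a - y)"
    using assms unfolding periodic_def by (metis Ints_minus vector_uminus_component)
  then show "f (a - (y + k)) = f (a - y)" by (simp add: algebra_simps)
qed

lemma test_partial: "test_function f \<Longrightarrow> test_function (partial i f)"
  by (simp add: test_function_def smooth_partial periodic_partial smooth_differentiable)

lemma test_mult: "test_function f \<Longrightarrow> test_function g \<Longrightarrow> test_function (\<lambda>x. f x * g x)"
  by (auto simp: test_function_def smooth_mult periodic_def)

lemma test_diff: "test_function f \<Longrightarrow> test_function g \<Longrightarrow> test_function (\<lambda>x. f x - g x)"
  by (auto simp: test_function_def smooth_diff periodic_def)

lemma test_reflect: "test_function f \<Longrightarrow> test_function (\<lambda>y. f (a - y))"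
  by (simp add: test_function_def smooth_reflect periodic_reflect)

lemma test_cmult: "test_function f \<Longrightarrow> test_function (\<lambda>y. c * f y)"
  by (rule test_mult) (auto simp: test_function_def smooth_const periodic_def)

lemma test_compose:
  assumes "test_function f" and "\<And>x. (h has_real_derivative h' (f x)) (at (f x))" and "smooth (\<lambda>x. h' (f x))"
  shows "test_function (\<lambda>x. h (f x))"
  using assms smooth_compose[of f h h'] by (auto simp: test_function_def periodic_def)

lemma test_differentiable: "test_function f \<Longrightarrow> f differentiable_on UNIV"
  by (simp add: test_function_def smooth_differentiable)

lemma test_measurable [measurable_dest]: "test_function f \<Longrightarrow> f \<in> borel_measurable borel"
  by (simp add: test_function_def smooth_borel_measurable)

section \<open>Integration and convolution on the torus\<close>

text \<open>The Borel counterpart of \<open>torus_measure\<close>. Product measures, translations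
  and convolutions are treated over Borel sets; Lebesgue measurable data are replaced by Borel
  representatives when the final estimate is assembled.\<close>

definition unit_torus :: "(real ^ 'n) measure" (\<open>\<T>\<close>) where
  "\<T> = density lborel (indicator (cbox 0 1))"

abbreviation unit_torus_integral :: "(real ^ 'n \<Rightarrow> real) \<Rightarrow> real" (binder \<open>\<oint>\<close> 10) where
  "unit_torus_integral f \<equiv> integral\<^sup>L \<T> f"

lemma sets_unit_torus [measurable_cong, simp]: "sets \<T> = sets borel"
  by (simp add: unit_torus_def)

lemma space_unit_torus [simp]: "space \<T> = UNIV"
  by (simp add: unit_torus_def)

lemma nn_integral_unit_torus:
  "f \<in> borel_measurable borel \<Longrightarrow>
    (\<integral>\<^sup>+x. f x \<partial>\<T>) = (\<integral>\<^sup>+x. f x * indicator (cbox 0 1) x \<partial>lborel)"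
  unfolding unit_torus_def by (subst nn_integral_density) (auto simp: mult.commute)

lemma prob_space_unit_torus: "prob_space (\<T> :: (real ^ 'n) measure)"
proof
  have "emeasure \<T> (space (\<T> :: (real ^ 'n) measure)) = (\<integral>\<^sup>+x. 1 \<partial>(\<T> :: (real ^ 'n) measure))"
    by simp
  also have "\<dots> = emeasure lborel (cbox 0 (1 :: real ^ 'n))"
    by (subst nn_integral_unit_torus) auto
  also have "\<dots> = 1"
    by (subst emeasure_lborel_cbox) (auto simp: Basis_vec_def inner_axis intro!: prod.neutral)
  finally show "emeasure \<T> (space (\<T> :: (real ^ 'n) measure)) = 1" .
qed

interpretation unit_torus: prob_space "\<T> :: (real ^ 'n) measure"
  by (rule prob_space_unit_torus)

lemma emeasure_unit_torus_UNIV [simp]: "emeasure \<T> UNIV = 1"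
  using unit_torus.emeasure_space_1 by simp

lemma measure_unit_torus_UNIV [simp]: "measure \<T> UNIV = 1"
  using unit_torus.prob_space by simp

interpretation unit_torus_pair: pair_sigma_finite "\<T> :: (real ^ 'n) measure" "\<T> :: (real ^ 'n) measure"
  by unfold_locales

section \<open>The fundamental domain and translation invariance\<close>

definition half_open_cube :: "(real ^ 'n) set" where
  "half_open_cube = {x. \<forall>i. 0 \<le> x $ i \<and> x $ i < 1}"

definition integer_lattice :: "(real ^ 'n) set" where
  "integer_lattice = {k. \<forall>i. k $ i \<in> \<int>}"

definition wrap :: "real ^ 'n \<Rightarrow> real ^ 'n" where
  "wrap x = (\<chi> i. frac (x $ i))"

lemma periodic_lattice: "periodic f \<Longrightarrow> k \<in> integer_lattice \<Longrightarrow> f (x + k) = f x"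
  by (simp add: periodic_def integer_lattice_def)

lemma uminus_lattice: "k \<in> integer_lattice \<Longrightarrow> - k \<in> integer_lattice"
  by (simp add: integer_lattice_def)

lemma wrap_in_half_open_cube: "wrap x \<in> half_open_cube"
  by (simp add: wrap_def half_open_cube_def frac_lt_1)

lemma half_open_cube_subset: "half_open_cube \<subseteq> cbox 0 1"
  by (auto simp: half_open_cube_def mem_box_cart less_imp_le)

lemma wrap_minus_lattice: "wrap x - x \<in> integer_lattice"
  by (simp add: wrap_def integer_lattice_def frac_def)

lemma wrap_idem: "x \<in> half_open_cube \<Longrightarrow> wrap x = x"
  by (simp add: wrap_def half_open_cube_def frac_eq vec_eq_iff)

lemma periodic_wrap: "periodic f \<Longrightarrow> f (wrap x) = f x"
  using periodic_lattice[OF _ wrap_minus_lattice, of f x x] by simp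

lemma wrap_add_lattice: "k \<in> integer_lattice \<Longrightarrow> wrap (x + k) = wrap x"
  by (auto simp: wrap_def integer_lattice_def vec_eq_iff frac_def Ints_def)

lemma periodic_wrap_compose: "periodic (\<lambda>x. f (wrap x))"
  using wrap_add_lattice by (force simp: periodic_def integer_lattice_def)

lemma measurable_vec_lambda [measurable (raw)]:
  assumes "\<And>i. (\<lambda>x. f x i) \<in> borel_measurable M"
  shows "(\<lambda>x. (\<chi> i. f x i) :: real ^ 'n) \<in> borel_measurable M"
  using assms by (subst borel_measurable_euclidean_space) (auto simp: Basis_vec_def inner_axis)

lemma measurable_vec_nth' [measurable]: "(\<lambda>x :: real ^ 'n. x $ i) \<in> borel_measurable borel"
  by (intro borel_measurable_continuous_onI continuous_intros)

lemma measurable_wrap [measurable]: "(wrap :: real ^ 'n \<Rightarrow> _) \<in> borel_measurable borel"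
  unfolding wrap_def by (intro measurable_vec_lambda) (simp add: frac_def)

lemma half_open_cube_borel [measurable]: "(half_open_cube :: (real ^ 'n) set) \<in> sets borel"
  unfolding half_open_cube_def by measurable

lemma countable_integer_lattice: "countable (integer_lattice :: (real ^ 'n) set)"
proof -
  have "countable (PiE (UNIV :: 'n set) (\<lambda>_. UNIV :: int set))"
    by (intro countable_PiE) auto
  moreover have "integer_lattice \<subseteq> (\<lambda>g. \<chi> i. (of_int (g i) :: real)) ` PiE (UNIV :: 'n set) (\<lambda>_. UNIV :: int set)"
  proof
    fix k :: "real ^ 'n" assume "k \<in> integer_lattice"
    then have "k = (\<chi> i. of_int \<lfloor>k $ i\<rfloor>)" by (simp add: integer_lattice_def vec_eq_iff)
    then show "k \<in> (\<lambda>g. \<chi> i. (of_int (g i) :: real)) ` PiE (UNIV :: 'n set) (\<lambda>_. UNIV :: int set)"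
      by (intro image_eqI[where x = "\<lambda>i. \<lfloor>k $ i\<rfloor>"]) auto
  qed
  ultimately show ?thesis by (meson countable_image countable_subset)
qed

lemma AE_half_open_cube:
  "AE x in lborel. (x :: real ^ 'n) \<in> cbox 0 1 \<longleftrightarrow> x \<in> half_open_cube"
proof -
  have "AE x in lborel. x $ i \<noteq> (1 :: real)" for i :: 'n
  proof -
    have "negligible {x :: real ^ 'n. x $ i = 1}"
      using negligible_standard_hyperplane[of "axis i 1 :: real ^ 'n" 1]
      by (auto simp: inner_axis Basis_vec_def)
    then have "AE x in lebesgue. x \<notin> {x :: real ^ 'n. x $ i = 1}"
      by (intro AE_not_in) (simp add: negligible_iff_null_sets)
    then have "AE x in lborel. x \<notin> {x :: real ^ 'n. x $ i = 1}"
      by (simp add: AE_completion_iff)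
    then show ?thesis by simp
  qed
  then have "AE x :: real ^ 'n in lborel. \<forall>i. x $ i \<noteq> 1"
    by (simp add: AE_all_countable)
  then show ?thesis
    by eventually_elim (auto simp: half_open_cube_def mem_box_cart less_le)
qed

lemma AE_unit_torus_half_open_cube: "AE x in \<T>. x \<in> half_open_cube"
  unfolding unit_torus_def using AE_half_open_cube
  by (subst AE_density) (auto simp: indicator_def)

lemma nn_integral_unit_torus_half_open:
  "f \<in> borel_measurable borel \<Longrightarrow>
    (\<integral>\<^sup>+x. f x \<partial>\<T>) = (\<integral>\<^sup>+x. f x * indicator half_open_cube x \<partial>lborel)"
  unfolding nn_integral_unit_torus using AE_half_open_cube
  by (intro nn_integral_cong_AE) (auto simp: indicator_def elim!: eventually_mono)

text \<open>The only lattice shift that carries x into the half-open cube is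
  \<open>wrap x - x\<close>. The indicators of the lattice translates thus form a partition of
  unity; with the closed cube they would overlap.\<close>

lemma nn_integral_lattice_half_open_cube:
  fixes x :: "real ^ 'n"
  shows "(\<integral>\<^sup>+k. indicator half_open_cube (x + k) \<partial>count_space integer_lattice) = 1"
proof -
  have "(\<integral>\<^sup>+k. indicator half_open_cube (x + k) \<partial>count_space integer_lattice) =
    (\<integral>\<^sup>+k. indicator {wrap x - x} k \<partial>count_space integer_lattice)"
  proof (intro nn_integral_cong)
    fix k assume "k \<in> space (count_space (integer_lattice :: (real ^ 'n) set))"
    then have "k \<in> integer_lattice" by simp
    then have "x + k \<in> half_open_cube \<longleftrightarrow> k = wrap x - x"
      by (metis add_diff_cancel_left' diff_add_cancel add.commute wrap_add_lattice wrap_idem wrap_in_half_open_cube)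
    then show "(indicator half_open_cube (x + k) :: ennreal) = indicator {wrap x - x} k"
      by (simp add: indicator_def)
  qed
  also have "\<dots> = 1"
    using wrap_minus_lattice by (subst nn_integral_indicator) auto
  finally show ?thesis .
qed

text \<open>Unfolding: the partition of unity over the lattice cuts the shifted cube into pieces,
  each piece is moved by a lattice vector, under which f is invariant, and the pieces are
  reassembled to the original cube. Nonnegativity permits exchanging the sum with the
  integral.\<close>

lemma nn_integral_unit_torus_translate:
  fixes f :: "real ^ 'n \<Rightarrow> ennreal"
  assumes [measurable]: "f \<in> borel_measurable borel" and per: "periodic f"
  shows "(\<integral>\<^sup>+x. f (x + a) \<partial>\<T>) = (\<integral>\<^sup>+x. f x \<partial>\<T>)"
proof -
  let ?H = "half_open_cube :: (real ^ 'n) set" and ?L = "integer_lattice :: (real ^ 'n) set"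
  have shift: "(\<integral>\<^sup>+x. g (x + c) \<partial>lborel) = (\<integral>\<^sup>+x. g x \<partial>lborel)"
    if [measurable]: "g \<in> borel_measurable borel" for g :: "real ^ 'n \<Rightarrow> ennreal" and c
  proof -
    have "(\<integral>\<^sup>+x. g x \<partial>lborel) = (\<integral>\<^sup>+x. g x \<partial>distr lborel borel ((+) c))"
      by (simp add: lborel_distr_plus)
    also have "\<dots> = (\<integral>\<^sup>+x. g (x + c) \<partial>lborel)"
      by (subst nn_integral_distr) (auto simp: add.commute)
    finally show ?thesis by simp
  qed
  have "(\<integral>\<^sup>+x. f (x + a) \<partial>\<T>) = (\<integral>\<^sup>+x. f (x + a) * indicator ?H x \<partial>lborel)"
    by (subst nn_integral_unit_torus_half_open) auto
  also have "\<dots> = (\<integral>\<^sup>+x. f x * indicator ?H (x - a) \<partial>lborel)"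
    using shift[of "\<lambda>x. f x * indicator ?H (x - a)" a] by simp
  also have "\<dots> = (\<integral>\<^sup>+x. (\<integral>\<^sup>+k. f x * indicator ?H (x - a) * indicator ?H (x + k) \<partial>count_space ?L) \<partial>lborel)"
    by (simp add: nn_integral_cmult nn_integral_lattice_half_open_cube)
  also have "\<dots> = (\<integral>\<^sup>+k. (\<integral>\<^sup>+x. f x * indicator ?H (x - a) * indicator ?H (x + k) \<partial>lborel) \<partial>count_space ?L)"
    by (intro nn_integral_count_space_nn_integral countable_integer_lattice) simp
  \<comment> \<open>Substituting \<open>x - k\<close> for \<open>x\<close> exchanges the roles of
    the two cubes and leaves f unchanged by periodicity.\<close>
  also have "\<dots> = (\<integral>\<^sup>+k. (\<integral>\<^sup>+x. f x * indicator ?H x * indicator ?H (x - a + - k) \<partial>lborel) \<partial>count_space ?L)"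
  proof (rule nn_integral_cong)
    fix k assume "k \<in> space (count_space ?L)"
    then have k: "- k \<in> ?L" by (simp add: uminus_lattice)
    show "(\<integral>\<^sup>+x. f x * indicator ?H (x - a) * indicator ?H (x + k) \<partial>lborel) =
        (\<integral>\<^sup>+x. f x * indicator ?H x * indicator ?H (x - a + - k) \<partial>lborel)"
      using shift[of "\<lambda>x. f x * indicator ?H (x - a) * indicator ?H (x + k)" "- k"]
        periodic_lattice[OF per k] by (simp add: algebra_simps)
  qed
  also have "\<dots> = (\<integral>\<^sup>+x. (\<integral>\<^sup>+k. f x * indicator ?H x * indicator ?H (x - a + - k) \<partial>count_space ?L) \<partial>lborel)"
    by (intro nn_integral_count_space_nn_integral[symmetric] countable_integer_lattice) simp
  also have "\<dots> = (\<integral>\<^sup>+x. f x * indicator ?H x * (\<integral>\<^sup>+k. indicator ?H (x - a + - k) \<partial>count_space ?L) \<partial>lborel)"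
    by (simp add: nn_integral_cmult)
  also have "\<dots> = (\<integral>\<^sup>+x. f x * indicator ?H x \<partial>lborel)"
  proof (rule nn_integral_cong)
    fix x
    have "bij_betw uminus ?L ?L"
      by (rule bij_betwI[where g = uminus]) (auto simp: uminus_lattice)
    then have "(\<integral>\<^sup>+k. indicator ?H (x - a + - k) \<partial>count_space ?L) =
      (\<integral>\<^sup>+k. indicator ?H (x - a + k) \<partial>count_space ?L)"
      by (rule nn_integral_bij_count_space)
    then show "f x * indicator ?H x * (\<integral>\<^sup>+k. indicator ?H (x - a + - k) \<partial>count_space ?L) = f x * indicator ?H x"
      by (simp add: nn_integral_lattice_half_open_cube)
  qed
  also have "\<dots> = (\<integral>\<^sup>+x. f x \<partial>\<T>)"
    by (subst nn_integral_unit_torus_half_open) auto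
  finally show ?thesis .
qed

text \<open>Invariance stated for the measure itself, so that integrals of signed functions and
  integrability can be transported as well.\<close>

lemma distr_unit_torus_wrap_translate: "distr \<T> borel (\<lambda>x. wrap (x + a)) = \<T>"
proof (rule measure_eqI)
  fix A :: "(real ^ 'a) set" assume "A \<in> sets (distr \<T> borel (\<lambda>x. wrap (x + a)))"
  then have [measurable]: "A \<in> sets borel" by simp
  have "emeasure (distr \<T> borel (\<lambda>x. wrap (x + a))) A = (\<integral>\<^sup>+x. indicator A (wrap (x + a)) \<partial>\<T>)"
    by (subst nn_integral_indicator[symmetric], simp, subst nn_integral_distr) auto
  also have "\<dots> = (\<integral>\<^sup>+x. indicator A (wrap x) \<partial>\<T>)"
    by (rule nn_integral_unit_torus_translate[where f = "\<lambda>x. indicator A (wrap x)"])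
       (auto simp: periodic_wrap_compose)
  also have "\<dots> = (\<integral>\<^sup>+x. indicator A x \<partial>\<T>)"
    using AE_unit_torus_half_open_cube
    by (intro nn_integral_cong_AE) (auto simp: wrap_idem elim!: eventually_mono)
  finally show "emeasure (distr \<T> borel (\<lambda>x. wrap (x + a))) A = emeasure \<T> A"
    by simp
qed simp

lemma
  fixes f :: "real ^ 'n \<Rightarrow> real"
  assumes [measurable]: "f \<in> borel_measurable borel" and per: "periodic f"
  shows integral_unit_torus_translate: "(\<oint>x. f (x + a)) = (\<oint>x. f x)"
    and integrable_unit_torus_translate: "integrable \<T> (\<lambda>x. f (x + a)) \<longleftrightarrow> integrable \<T> f"
proof -
  have "(\<oint>x. f x) = (\<integral>x. f x \<partial>distr \<T> borel (\<lambda>x. wrap (x + a)))"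
    by (simp add: distr_unit_torus_wrap_translate)
  also have "\<dots> = (\<oint>x. f (x + a))"
    by (subst integral_distr) (auto simp: periodic_wrap[OF per])
  finally show "(\<oint>x. f (x + a)) = (\<oint>x. f x)" by simp
  have "integrable \<T> f = integrable (distr \<T> borel (\<lambda>x. wrap (x + a))) f"
    by (simp add: distr_unit_torus_wrap_translate)
  also have "\<dots> = integrable \<T> (\<lambda>x. f (x + a))"
    by (subst integrable_distr_eq) (auto simp: periodic_wrap[OF per])
  finally show "integrable \<T> (\<lambda>x. f (x + a)) \<longleftrightarrow> integrable \<T> f" by simp
qed

section \<open>Uniform bounds for test functions and integration by parts\<close>

lemma integrable_mult_bounded:
  fixes u g :: "'a \<Rightarrow> real"
  assumes "integrable M u" "g \<in> borel_measurable M" "\<And>x. \<bar>g x\<bar> \<le> C"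
  shows "integrable M (\<lambda>x. u x * g x)"
proof (rule Bochner_Integration.integrable_bound)
  show "integrable M (\<lambda>x. C * u x)" using assms by simp
  show "(\<lambda>x. u x * g x) \<in> borel_measurable M" using assms by measurable
  have "\<bar>u x * g x\<bar> \<le> \<bar>C * u x\<bar>" for x
    using assms(3)[of x] by (simp add: abs_mult mult.commute mult_right_mono)
  then show "AE x in M. norm (u x * g x) \<le> norm (C * u x)" by simp
qed

lemma test_bounded: "test_function f \<Longrightarrow> \<exists>C\<ge>0. \<forall>x. \<bar>f x\<bar> \<le> C"
proof -
  assume f: "test_function f"
  then have "continuous_on (cbox 0 1) f"
    using continuous_on_subset smooth_continuous unfolding test_function_def by blast
  then have "bounded (f ` cbox 0 1)"
    by (intro compact_imp_bounded compact_continuous_image) auto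
  then obtain C where C: "\<And>x. x \<in> cbox 0 1 \<Longrightarrow> \<bar>f x\<bar> \<le> C"
    by (auto simp: bounded_iff)
  have "\<bar>f x\<bar> \<le> max C 0" for x
    using C[of "wrap x"] wrap_in_half_open_cube half_open_cube_subset periodic_wrap[of f x] f
    by (fastforce simp: test_function_def)
  then show ?thesis by (intro exI[of _ "max C 0"]) auto
qed

lemma test_integrable: "test_function f \<Longrightarrow> integrable \<T> f"
proof -
  assume f: "test_function f"
  then have [measurable]: "f \<in> borel_measurable borel" by measurable
  obtain C where "\<forall>x. \<bar>f x\<bar> \<le> C" using test_bounded[OF f] by auto
  then show ?thesis
    by (intro unit_torus.integrable_const_bound[where B = C]) auto
qed

lemma integrable_mult_test_function:
  "integrable \<T> u \<Longrightarrow> test_function f \<Longrightarrow> integrable \<T> (\<lambda>x. u x * f x)"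
  using test_bounded[of f] by (auto intro!: integrable_mult_bounded)

lemma sum_component_bound:
  fixes v :: "real ^ 'n"
  assumes "\<And>i. \<bar>c i\<bar> \<le> B i"
  shows "\<bar>\<Sum>i\<in>UNIV. v $ i * c i\<bar> \<le> (\<Sum>i\<in>UNIV. B i) * norm v"
proof -
  have "\<bar>\<Sum>i\<in>UNIV. v $ i * c i\<bar> \<le> (\<Sum>i\<in>UNIV. \<bar>v $ i * c i\<bar>)" by (rule sum_abs)
  also have "\<dots> \<le> (\<Sum>i\<in>UNIV. B i * norm v)"
  proof (rule sum_mono)
    fix i
    have "\<bar>c i\<bar> * \<bar>v $ i\<bar> \<le> B i * norm v"
      using assms[of i] component_le_norm_cart[of v i]
      by (intro mult_mono) (auto intro: order_trans[OF abs_ge_zero])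
    then show "\<bar>v $ i * c i\<bar> \<le> B i * norm v" by (simp add: abs_mult mult.commute)
  qed
  also have "\<dots> = (\<Sum>i\<in>UNIV. B i) * norm v" by (simp add: sum_distrib_right)
  finally show ?thesis .
qed

lemma test_lipschitz:
  fixes f :: "real ^ 'n \<Rightarrow> real"
  assumes f: "test_function f"
  shows "\<exists>C\<ge>0. \<forall>x y. \<bar>f x - f y\<bar> \<le> C * norm (x - y)"
proof -
  have "\<forall>i. \<exists>C\<ge>0. \<forall>x. \<bar>partial i f x\<bar> \<le> C"
    using f test_bounded test_partial by blast
  then obtain C where C: "\<And>i. C i \<ge> 0" "\<And>i x. \<bar>partial i f x\<bar> \<le> C i" by metis
  have "norm (f x - f y) \<le> (\<Sum>i\<in>UNIV. C i) * norm (x - y)" for x y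
  proof (rule differentiable_bound[where S = UNIV])
    fix x :: "real ^ 'n"
    show "(f has_derivative (\<lambda>h. \<Sum>i\<in>UNIV. h $ i * partial i f x)) (at x within UNIV)"
      using has_derivative_sum_partial[OF test_differentiable[OF f]] by simp
    show "onorm (\<lambda>h. \<Sum>i\<in>UNIV. h $ i * partial i f x) \<le> (\<Sum>i\<in>UNIV. C i)"
      by (rule onorm_le) (auto intro: sum_component_bound C)
  qed auto
  with C(1) show ?thesis by (intro exI[of _ "\<Sum>i\<in>UNIV. C i"]) (auto intro: sum_nonneg)
qed

text \<open>The first partial derivatives are globally Lipschitz, being test functions themselves;
  comparing f with its linearisation at z over the ball of radius \<open>norm h\<close> yields a
  remainder uniform in z. This uniformity lets the remainder be integrated over the torus.\<close>

lemma test_taylor: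
  fixes f :: "real ^ 'n \<Rightarrow> real"
  assumes f: "test_function f"
  shows "\<exists>C\<ge>0. \<forall>z h. \<bar>f (z + h) - f z - (\<Sum>i\<in>UNIV. h $ i * partial i f z)\<bar> \<le> C * (norm h)\<^sup>2"
proof -
  have "\<forall>i. \<exists>C\<ge>0. \<forall>x y. \<bar>partial i f x - partial i f y\<bar> \<le> C * norm (x - y)"
    using f test_lipschitz test_partial by blast
  then obtain C where C: "\<And>i. C i \<ge> 0"
    "\<And>i x y. \<bar>partial i f x - partial i f y\<bar> \<le> C i * norm (x - y)" by metis
  have "norm (f (z + h) - f z - (\<Sum>i\<in>UNIV. (z + h - z) $ i * partial i f z)) \<le>
      norm (z + h - z) * ((\<Sum>i\<in>UNIV. C i) * norm h)" for z h
  proof (rule differentiable_bound_linearization[where S = "cball z (norm h)"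
        and f' = "\<lambda>x v. \<Sum>i\<in>UNIV. v $ i * partial i f x"])
    fix t :: real assume "t \<in> {0..1}"
    then show "z + t *\<^sub>R (z + h - z) \<in> cball z (norm h)"
      by (simp add: dist_norm mult_left_le_one_le)
  next
    fix x assume x: "x \<in> cball z (norm h)"
    show "(f has_derivative (\<lambda>v. \<Sum>i\<in>UNIV. v $ i * partial i f x)) (at x within cball z (norm h))"
      using has_derivative_sum_partial[OF test_differentiable[OF f]]
      by (rule has_derivative_at_withinI)
    show "onorm ((\<lambda>v. \<Sum>i\<in>UNIV. v $ i * partial i f x) - (\<lambda>v. \<Sum>i\<in>UNIV. v $ i * partial i f z))
        \<le> (\<Sum>i\<in>UNIV. C i) * norm h"
    proof (rule onorm_le)
      fix v :: "real ^ 'n"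
      have "\<bar>\<Sum>i\<in>UNIV. v $ i * (partial i f x - partial i f z)\<bar> \<le> (\<Sum>i\<in>UNIV. C i * norm h) * norm v"
      proof (rule sum_component_bound)
        fix i
        have "C i * norm (x - z) \<le> C i * norm h"
          using C(1) x by (intro mult_left_mono) (auto simp: dist_norm norm_minus_commute)
        then show "\<bar>partial i f x - partial i f z\<bar> \<le> C i * norm h"
          using C(2)[of i x z] by linarith
      qed
      then show "norm (((\<lambda>v. \<Sum>i\<in>UNIV. v $ i * partial i f x) - (\<lambda>v. \<Sum>i\<in>UNIV. v $ i * partial i f z)) v)
        \<le> (\<Sum>i\<in>UNIV. C i) * norm h * norm v"
        by (simp add: right_diff_distrib sum_subtractf sum_distrib_right)
    qed
  qed auto
  with C(1) show ?thesis
    by (intro exI[of _ "\<Sum>i\<in>UNIV. C i"]) (auto intro: sum_nonneg simp: power2_eq_square algebra_simps)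
qed

text \<open>Translation invariance makes the integral of every difference quotient vanish, and the
  uniform Taylor remainder shows that the quotient with step t differs from the derivative by at
  most a multiple of t.\<close>

lemma integral_partial_eq_0:
  fixes f :: "real ^ 'n \<Rightarrow> real"
  assumes f: "test_function f"
  shows "(\<oint>x. partial i f x) = 0"
proof -
  let ?I = "(\<oint>x. partial i f x)"
  obtain C where C: "C \<ge> 0"
    "\<And>z h. \<bar>f (z + h) - f z - (\<Sum>i\<in>UNIV. h $ i * partial i f z)\<bar> \<le> C * (norm h)\<^sup>2"
    using test_taylor[OF f] by blast
  have [measurable]: "f \<in> borel_measurable borel" and per: "periodic f"
    using f by (auto simp: test_function_def smooth_borel_measurable)
  have int: "integrable \<T> f" "integrable \<T> (partial i f)"
    using f by (auto intro: test_integrable test_partial)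
  have bound: "\<bar>?I\<bar> \<le> C * t" if t: "t > 0" for t
  proof -
    have int': "integrable \<T> (\<lambda>x. f (x + t *\<^sub>R axis i 1))"
      using int integrable_unit_torus_translate[OF _ per] by simp
    have "- (t * ?I) = (\<oint>x. f (x + t *\<^sub>R axis i 1) - f x - t * partial i f x)"
      using int int' integral_unit_torus_translate[OF _ per] by simp
    then have "\<bar>t * ?I\<bar> = \<bar>\<oint>x. f (x + t *\<^sub>R axis i 1) - f x - t * partial i f x\<bar>"
      by (metis abs_minus_cancel)
    also have "\<dots> \<le> (\<oint>x. \<bar>f (x + t *\<^sub>R axis i 1) - f x - t * partial i f x\<bar>)"
      by (rule integral_abs_bound)
    also have "\<dots> \<le> (\<oint>x :: real ^ 'n. C * t\<^sup>2)"
    proof (rule integral_mono)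
      fix x
      have "(\<Sum>j\<in>UNIV. (t *\<^sub>R axis i 1 :: real ^ 'n) $ j * partial j f x) = t * partial i f x"
        by (subst sum.remove[of _ i]) (auto simp: axis_def intro!: sum.neutral)
      then show "\<bar>f (x + t *\<^sub>R axis i 1) - f x - t * partial i f x\<bar> \<le> C * t\<^sup>2"
        using C(2)[of x "t *\<^sub>R axis i 1"] by simp
    qed (use int int' in auto)
    also have "\<dots> = C * t\<^sup>2" by simp
    finally show ?thesis using t by (simp add: abs_mult power2_eq_square)
  qed
  have "\<bar>?I\<bar> \<le> 0"
  proof (rule field_le_epsilon)
    fix e :: real assume e: "e > 0"
    \<comment> \<open>Dividing by \<open>C + 1\<close> rather than \<open>C\<close> covers the case
      \<open>C = 0\<close>.\<close>
    have "\<bar>?I\<bar> \<le> C * (e / (C + 1))" using bound[of "e / (C + 1)"] C(1) e by simp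
    also have "\<dots> \<le> 0 + e" using C(1) e by (simp add: field_simps)
    finally show "\<bar>?I\<bar> \<le> 0 + e" .
  qed
  then show ?thesis by simp
qed

lemma integral_by_parts:
  assumes f: "test_function f" and g: "test_function g"
  shows "(\<oint>x. f x * partial i g x) = - (\<oint>x. partial i f x * g x)"
proof -
  have "0 = (\<oint>x. f x * partial i g x + partial i f x * g x)"
    using integral_partial_eq_0[OF test_mult[OF f g], of i]
    by (simp add: partial_mult test_differentiable f g)
  also have "\<dots> = (\<oint>x. f x * partial i g x) + (\<oint>x. partial i f x * g x)"
    using f g by (intro Bochner_Integration.integral_add test_integrable test_mult test_partial)
  finally show ?thesis by simp
qed

section \<open>Convolution with test functions\<close>

definition convol :: "(real ^ 'n \<Rightarrow> real) \<Rightarrow> (real ^ 'n \<Rightarrow> real) \<Rightarrow> real ^ 'n \<Rightarrow> real" where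
  "convol u f x = (\<oint>y. u y * f (x - y))"

lemma integrable_convol:
  "integrable \<T> u \<Longrightarrow> test_function f \<Longrightarrow> integrable \<T> (\<lambda>y. u y * f (x - y))"
  by (intro integrable_mult_test_function test_reflect)

text \<open>All derivatives fall on f, so convolution with a test function smooths any integrable u.
  Integrating the uniform Taylor remainder of f against \<open>\<bar>u\<bar>\<close> leaves an error
  quadratic in h.\<close>

lemma convol_has_derivative:
  fixes u f :: "real ^ 'n \<Rightarrow> real"
  assumes u: "integrable \<T> u" and f: "test_function f"
  shows "(convol u f has_derivative (\<lambda>h. \<Sum>i\<in>UNIV. h $ i * convol u (partial i f) x)) (at x)"
proof -
  obtain C where C: "C \<ge> 0"
    "\<And>z h. \<bar>f (z + h) - f z - (\<Sum>i\<in>UNIV. h $ i * partial i f z)\<bar> \<le> C * (norm h)\<^sup>2"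
    using test_taylor[OF f] by blast
  define D where "D = C * (\<oint>y. \<bar>u y\<bar>)"
  have bound: "\<bar>convol u f (x + h) - convol u f x - (\<Sum>i\<in>UNIV. h $ i * convol u (partial i f) x)\<bar> \<le> D * (norm h)\<^sup>2" for h
  proof -
    note [simp] = integrable_convol[OF u f] integrable_convol[OF u test_partial[OF f]]
    have "u y * (\<Sum>i\<in>UNIV. h $ i * partial i f (x - y)) = (\<Sum>i\<in>UNIV. h $ i * (u y * partial i f (x - y)))" for y
      by (simp add: sum_distrib_left mult.left_commute)
    then have int: "integrable \<T> (\<lambda>y. u y * (\<Sum>i\<in>UNIV. h $ i * partial i f (x - y)))"
      and eq: "(\<oint>y. u y * (\<Sum>i\<in>UNIV. h $ i * partial i f (x - y))) = (\<Sum>i\<in>UNIV. h $ i * convol u (partial i f) x)"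
      by (simp_all add: convol_def)
    have "convol u f (x + h) - convol u f x - (\<Sum>i\<in>UNIV. h $ i * convol u (partial i f) x) =
      (\<oint>y. u y * f (x + h - y) - u y * f (x - y) - u y * (\<Sum>i\<in>UNIV. h $ i * partial i f (x - y)))"
      using int by (simp add: eq[symmetric]) (simp add: convol_def)
    then have "\<bar>convol u f (x + h) - convol u f x - (\<Sum>i\<in>UNIV. h $ i * convol u (partial i f) x)\<bar> =
      \<bar>\<oint>y. u y * f (x + h - y) - u y * f (x - y) - u y * (\<Sum>i\<in>UNIV. h $ i * partial i f (x - y))\<bar>"
      by (rule arg_cong)
    also have "\<dots> \<le> (\<oint>y. \<bar>u y * f (x + h - y) - u y * f (x - y) - u y * (\<Sum>i\<in>UNIV. h $ i * partial i f (x - y))\<bar>)"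
      by (rule integral_abs_bound)
    also have "\<dots> \<le> (\<oint>y. C * (norm h)\<^sup>2 * \<bar>u y\<bar>)"
    proof (rule integral_mono)
      fix y
      have "\<bar>u y\<bar> * \<bar>f (x - y + h) - f (x - y) - (\<Sum>i\<in>UNIV. h $ i * partial i f (x - y))\<bar> \<le> \<bar>u y\<bar> * (C * (norm h)\<^sup>2)"
        using C by (intro mult_left_mono) auto
      then show "\<bar>u y * f (x + h - y) - u y * f (x - y) - u y * (\<Sum>i\<in>UNIV. h $ i * partial i f (x - y))\<bar> \<le> C * (norm h)\<^sup>2 * \<bar>u y\<bar>"
        by (simp add: algebra_simps flip: abs_mult)
    qed (use u int in auto)
    also have "\<dots> = D * (norm h)\<^sup>2" by (simp add: D_def)
    finally show ?thesis .
  qed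
  have "((\<lambda>h. D * norm h) \<longlongrightarrow> 0) (at 0)" by (auto intro!: tendsto_eq_intros)
  then have "((\<lambda>h. norm (convol u f (x + h) - convol u f x - (\<Sum>i\<in>UNIV. h $ i * convol u (partial i f) x)) / norm h) \<longlongrightarrow> 0) (at 0)"
  proof (rule Lim_null_comparison[rotated], intro always_eventually allI)
    fix h :: "real ^ 'n"
    show "norm (norm (convol u f (x + h) - convol u f x - (\<Sum>i\<in>UNIV. h $ i * convol u (partial i f) x)) / norm h) \<le> D * norm h"
      using bound[of h] by (cases "h = 0") (auto simp: power2_eq_square field_simps)
  qed
  moreover have "bounded_linear (\<lambda>h. \<Sum>i\<in>UNIV. (h :: real ^ 'n) $ i * convol u (partial i f) x)"
    by (intro bounded_linear_sum bounded_linear_mult_const bounded_linear_vec_nth)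
  ultimately show ?thesis
    by (simp add: has_derivative_at)
qed

lemma partial_convol:
  assumes "integrable \<T> u" "test_function f"
  shows "partial i (convol u f) = convol u (partial i f)"
proof
  fix x
  have "partial i (convol u f) x = (\<Sum>j\<in>UNIV. axis i 1 $ j * convol u (partial j f) x)"
    by (rule partial_eqI[OF convol_has_derivative[OF assms]])
  also have "\<dots> = convol u (partial i f) x"
    by (subst sum.remove[of _ i]) (auto simp: axis_def intro!: sum.neutral)
  finally show "partial i (convol u f) x = convol u (partial i f) x" .
qed

lemma test_convol:
  assumes u: "integrable \<T> u" and f: "test_function f"
  shows "test_function (convol u f)"
proof -
  have "diff_upto n (convol u f)" for n
    using f
  proof (induction n arbitrary: f)
    case 0
    then show ?case using convol_has_derivative[OF u] by (auto simp: differentiable_on_def differentiable_def)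
  next
    case (Suc n)
    then have "diff_upto n (partial i (convol u f))" for i
      by (simp add: partial_convol[OF u] test_partial)
    with convol_has_derivative[OF u Suc.prems] show ?case
      by (auto simp: differentiable_on_def differentiable_def)
  qed
  moreover have "periodic (convol u f)"
    unfolding periodic_def
  proof (intro allI impI)
    fix x k :: "real ^ 'a" assume "\<forall>i. k $ i \<in> \<int>"
    then have "f (x + k - y) = f (x - y)" for y
      using f unfolding test_function_def periodic_def by (metis add_diff_eq add.commute diff_add_eq)
    then show "convol u f (x + k) = convol u f x" by (simp add: convol_def)
  qed
  ultimately show ?thesis by (simp add: test_function_def smooth_iff_diff_upto)
qed

section \<open>Mollification\<close>

definition rho :: "real ^ 'n \<Rightarrow> real" where
  "rho x = (\<Sum>i\<in>UNIV. (sin (pi * x $ i))\<^sup>2)"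

lemma partial_sin_coordinate:
  "((\<lambda>x :: real ^ 'n. sin (c * x $ j + d)) has_derivative (\<lambda>h. cos (c * x $ j + d) * (c * h $ j))) (at x)"
  by (auto intro!: derivative_eq_intros bounded_linear_imp_has_derivative bounded_linear_vec_nth)

text \<open>A derivative of a sine is a multiple of the sine with its phase advanced by a quarter
  period; hence the free phase d in the induction.\<close>

lemma smooth_sin_coordinate: "smooth (\<lambda>x :: real ^ 'n. sin (c * x $ j + d))"
proof -
  have "diff_upto n (\<lambda>x :: real ^ 'n. sin (c * x $ j + d))" for n
  proof (induction n arbitrary: d)
    case 0
    then show ?case using partial_sin_coordinate by (fastforce simp: differentiable_on_def differentiable_def)
  next
    case (Suc n)
    have "partial i (\<lambda>x :: real ^ 'n. sin (c * x $ j + d)) =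
      (\<lambda>x. (c * axis i 1 $ j) * sin (c * x $ j + (d + pi / 2)))" for i
      using sin_add[of _ "pi / 2"]
      by (auto simp: fun_eq_iff partial_eqI[OF partial_sin_coordinate] add.assoc[symmetric])
    with Suc show ?case
      using partial_sin_coordinate
      by (fastforce simp: differentiable_on_def differentiable_def intro: diff_upto_mult diff_upto_const)
  qed
  then show ?thesis by (simp add: smooth_iff_diff_upto)
qed

lemma periodic_rho: "periodic (rho :: real ^ 'n \<Rightarrow> real)"
  unfolding periodic_def
proof (intro allI impI)
  fix x k :: "real ^ 'n" assume k: "\<forall>i. k $ i \<in> \<int>"
  have "(sin (pi * (x + k) $ i))\<^sup>2 = (sin (pi * x $ i))\<^sup>2" for i
  proof -
    obtain m where m: "k $ i = of_int m" using k by (metis Ints_cases)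
    have "sin (pi * k $ i) = 0" unfolding sin_zero_iff_int2 m by (auto simp: mult.commute)
    moreover from this have "(cos (pi * k $ i))\<^sup>2 = 1" by (simp add: cos_squared_eq)
    ultimately show ?thesis by (simp add: distrib_left sin_add power_mult_distrib)
  qed
  then show "rho (x + k) = rho x" by (simp add: rho_def)
qed

lemma test_rho: "test_function rho"
proof -
  have "smooth (\<lambda>x. \<Sum>i\<in>UNIV. sin (pi * x $ i + 0) * sin (pi * x $ i + 0))"
    by (intro smooth_sum smooth_mult smooth_sin_coordinate)
  then show ?thesis
    by (simp add: test_function_def periodic_rho) (simp add: rho_def[abs_def] power2_eq_square)
qed

lemma rho_even: "rho (- x) = rho x"
  by (simp add: rho_def)

lemma rho_nonneg: "rho x \<ge> 0"
  by (simp add: rho_def sum_nonneg)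

lemma rho_le: "rho (x :: real ^ 'n) \<le> real CARD('n)"
  unfolding rho_def using sum_mono[of UNIV "\<lambda>i. (sin (pi * x $ i))\<^sup>2" "\<lambda>_. 1"]
  by (simp add: abs_square_le_1)

lemma sin_squared_le_rho: "(sin (pi * x $ i))\<^sup>2 \<le> rho x"
  unfolding rho_def by (intro member_le_sum) auto

text \<open>By the cubic Maclaurin bound, \<open>sin (pi * t)\<close> is at least
  \<open>pi * t\<close> times \<open>1 - (pi * t)\<^sup>2 / 6\<close>. As
  \<open>pi * t \<le> 8/5\<close>, the second factor is at least 1/2, and half of pi is at least
  1.\<close>

lemma sin_pi_lower:
  fixes t :: real
  assumes "0 \<le> t" "t \<le> 1/2"
  shows "t \<le> sin (pi * t)"
proof -
  have "pi * t \<le> pi * (1/2)" using assms by (intro mult_left_mono) auto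
  then have "pi * t \<le> 8/5" using pi_approx by (simp, linarith)
  with assms have t: "0 \<le> pi * t" "pi * t \<le> 8/5" by simp_all
  have "\<bar>sin (pi * t) - pi * t\<bar> \<le> inverse 6 * (pi * t) ^ 3"
    using Maclaurin_sin_bound[of "pi * t" 3] t by (simp add: eval_nat_numeral sin_coeff_def fact_numeral)
  then have "sin (pi * t) \<ge> pi * t - inverse 6 * (pi * t) ^ 3" by linarith
  then have 1: "sin (pi * t) \<ge> pi * t * (1 - (pi * t)\<^sup>2 / 6)"
    by (simp add: power3_eq_cube power2_eq_square algebra_simps)
  have "(pi * t)\<^sup>2 \<le> (8/5)\<^sup>2" using t by (intro power_mono) auto
  also have "\<dots> \<le> 3" by (simp add: power_divide)
  finally have "1 - (pi * t)\<^sup>2 / 6 \<ge> 1/2" by linarith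
  then have "pi * t * (1/2) \<le> pi * t * (1 - (pi * t)\<^sup>2 / 6)" using t by (intro mult_left_mono) auto
  moreover have "t \<le> pi * t * (1/2)" using assms pi_ge_two mult_right_mono[of 2 pi t] by simp
  ultimately show ?thesis using 1 by linarith
qed

lemma abs_le_abs_sin_pi:
  fixes t :: real
  assumes "\<bar>t\<bar> \<le> 1/2"
  shows "\<bar>t\<bar> \<le> \<bar>sin (pi * t)\<bar>"
proof (cases "t \<ge> 0")
  case True
  then show ?thesis using sin_pi_lower[of t] assms by simp
next
  case False
  have "- t \<le> - sin (pi * t)"
    using sin_pi_lower[of "- t"] assms False by (simp only: mult_minus_right sin_minus)
  then show ?thesis using False by simp
qed

text \<open>A small value of \<open>rho\<close> forces every coordinate close to its nearest
  integer. The threshold is the square of \<open>d / N\<close> because the norm is estimated by the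
  sum of the N coordinates.\<close>

lemma rho_small_near_lattice:
  assumes "d > 0"
  shows "\<exists>s>0. \<forall>z :: real ^ 'n. rho z < s \<longrightarrow> (\<exists>k\<in>integer_lattice. norm (z + k) < d)"
proof (intro exI conjI allI impI)
  define c where "c = d / real CARD('n)"
  have c: "c > 0" using assms by (simp add: c_def)
  then show "c\<^sup>2 > 0" by simp
  fix z :: "real ^ 'n" assume z: "rho z < c\<^sup>2"
  define k :: "real ^ 'n" where "k = (\<chi> i. - of_int (round (z $ i)))"
  have comp: "\<bar>(z + k) $ i\<bar> < c" for i
  proof -
    let ?t = "(z + k) $ i"
    have "\<bar>?t\<bar> \<le> 1/2" using of_int_round_abs_le[of "z $ i"] by (simp add: k_def abs_minus_commute)
    then have "\<bar>?t\<bar> \<le> \<bar>sin (pi * ?t)\<bar>"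
      by (rule abs_le_abs_sin_pi)
    then have "\<bar>?t\<bar>\<^sup>2 \<le> (sin (pi * ?t))\<^sup>2" by (metis abs_ge_zero power2_abs power_mono)
    also have "\<dots> \<le> rho (z + k)" by (rule sin_squared_le_rho)
    also have "\<dots> = rho z" by (rule periodic_lattice[OF periodic_rho]) (simp add: k_def integer_lattice_def)
    also have "\<dots> < c\<^sup>2" by (rule z)
    finally show ?thesis using c by (metis abs_le_square_iff abs_of_pos abs_abs not_less power2_abs)
  qed
  have "norm (z + k) \<le> (\<Sum>i\<in>UNIV. \<bar>(z + k) $ i\<bar>)" by (rule norm_le_l1_cart)
  also have "\<dots> < (\<Sum>i\<in>(UNIV :: 'n set). c)" using comp by (intro sum_strict_mono) auto
  also have "\<dots> = d" by (simp add: c_def)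
  finally have "norm (z + k) < d" .
  moreover have "k \<in> integer_lattice" by (simp add: k_def integer_lattice_def)
  ultimately show "\<exists>k\<in>integer_lattice. norm (z + k) < d" by blast
qed

section \<open>Continuity of translations in the mean\<close>

lemma nn_integral_unit_torus_shift_le:
  fixes f :: "real ^ 'n \<Rightarrow> ennreal"
  assumes [measurable]: "f \<in> borel_measurable borel" and z: "norm z \<le> 1"
  shows "(\<integral>\<^sup>+x. f (x + z) \<partial>\<T>) \<le> (\<integral>\<^sup>+x. f x * indicator (cbox (- 1) 2) x \<partial>lborel)"
proof -
  have "(\<integral>\<^sup>+x. f (x + z) \<partial>\<T>) = (\<integral>\<^sup>+x. f (x + z) * indicator (cbox 0 1) x \<partial>lborel)"
    by (subst nn_integral_unit_torus) auto
  also have "\<dots> \<le> (\<integral>\<^sup>+x. f (z + x) * indicator (cbox (- 1) 2) (z + x) \<partial>lborel)"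
  proof (rule nn_integral_mono)
    fix x :: "real ^ 'n"
    have "x + z \<in> cbox (- 1) 2" if x: "x \<in> cbox 0 1"
    proof -
      have "\<bar>z $ i\<bar> \<le> 1" for i using component_le_norm_cart[of z i] z by linarith
      moreover have "0 \<le> x $ i \<and> x $ i \<le> 1" for i using x by (auto simp: mem_box_cart)
      ultimately show ?thesis by (auto simp: mem_box_cart abs_le_iff) (smt (verit))+
    qed
    then show "f (x + z) * indicator (cbox 0 1) x \<le> f (z + x) * indicator (cbox (- 1) 2) (z + x)"
      by (auto simp: indicator_def add.commute)
  qed
  also have "\<dots> = (\<integral>\<^sup>+x. f x * indicator (cbox (- 1) 2) x \<partial>distr lborel borel ((+) z))"
    by (subst nn_integral_distr) auto
  finally show ?thesis by (simp add: lborel_distr_plus)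
qed

text \<open>Measurability supplies continuous functions converging to u off a null set. They need
  not be periodic, so the approximation is made on \<open>cbox (- 1) 2\<close>, which contains all
  shifts of the unit cube by vectors of norm at most 1; there uniform continuity controls the
  shift.\<close>

lemma translation_continuity_bounded:
  fixes u :: "real ^ 'n \<Rightarrow> real"
  assumes [measurable]: "u \<in> borel_measurable borel" and K: "\<And>x. \<bar>u x\<bar> \<le> K" and e: "e > 0"
  shows "\<exists>d>0. \<forall>z. norm z < d \<longrightarrow> (\<integral>\<^sup>+x. ennreal \<bar>u (x + z) - u x\<bar> \<partial>\<T>) < ennreal e"
proof -
  let ?W = "cbox (- 1) 2 :: (real ^ 'n) set"
  have "u measurable_on UNIV"
    by (intro lebesgue_measurable_imp_measurable_on) (auto intro: measurable_completion)
  then obtain N g where N: "negligible N" and g: "\<And>n. continuous_on UNIV (g n)"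
    and lim: "\<And>x. x \<notin> N \<Longrightarrow> (\<lambda>n. g n x) \<longlonglongrightarrow> u x"
    unfolding measurable_on_def by auto
  \<comment> \<open>Clipping at height K keeps continuity, does not affect the limit because
    \<open>\<bar>u x\<bar> \<le> K\<close>, and provides the dominating function.\<close>
  define v where "v n x = max (- K) (min K (g n x))" for n x
  have cont: "continuous_on UNIV (v n)" for n
    unfolding v_def[abs_def] by (intro continuous_intros g)
  then have [measurable]: "v n \<in> borel_measurable borel" for n
    by (rule borel_measurable_continuous_onI)
  have "K \<ge> 0" using K[of 0] by linarith
  then have vK: "\<bar>v n x\<bar> \<le> K" for n x by (auto simp: v_def)
  have "AE x in lebesgue. x \<notin> N" using N by (intro AE_not_in) (simp add: negligible_iff_null_sets)
  then have AE: "AE x in lborel. x \<notin> N" by (simp add: AE_completion_iff)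
  have "(\<lambda>n. \<integral>\<^sup>+x. ennreal \<bar>u x - v n x\<bar> * indicator ?W x \<partial>lborel) \<longlonglongrightarrow> (\<integral>\<^sup>+x. 0 \<partial>(lborel :: (real ^ 'n) measure))"
  proof (rule nn_integral_dominated_convergence[where w = "\<lambda>x. ennreal (2 * K) * indicator ?W x"])
    show "AE x in lborel. ennreal \<bar>u x - v n x\<bar> * indicator ?W x \<le> ennreal (2 * K) * indicator ?W x" for n
    proof (intro AE_I2 mult_right_mono ennreal_leI)
      fix x show "\<bar>u x - v n x\<bar> \<le> 2 * K" using K[of x] vK[of n x] by linarith
    qed auto
    show "(\<integral>\<^sup>+x. ennreal (2 * K) * indicator ?W x \<partial>lborel) < \<infinity>"
      using emeasure_lborel_cbox_finite[of "- 1" "2 :: real ^ 'n"]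
      by (simp add: nn_integral_cmult ennreal_mult_less_top)
    show "AE x in lborel. (\<lambda>n. ennreal \<bar>u x - v n x\<bar> * indicator ?W x) \<longlonglongrightarrow> 0"
      using AE
    proof eventually_elim
      case (elim x)
      have "(\<lambda>n. v n x) \<longlonglongrightarrow> max (- K) (min K (u x))"
        unfolding v_def by (intro tendsto_intros lim elim)
      also have "max (- K) (min K (u x)) = u x" using K[of x] by auto
      finally have "(\<lambda>n. \<bar>u x - v n x\<bar>) \<longlonglongrightarrow> \<bar>u x - u x\<bar>" by (intro tendsto_intros)
      then have "(\<lambda>n. ennreal \<bar>u x - v n x\<bar>) \<longlonglongrightarrow> ennreal 0" by (intro tendsto_ennrealI) simp
      then show ?case by (cases "x \<in> ?W") auto
    qed
  qed auto
  then have "\<forall>\<^sub>F n in sequentially. (\<integral>\<^sup>+x. ennreal \<bar>u x - v n x\<bar> * indicator ?W x \<partial>lborel) < ennreal (e / 4)"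
    using e by (intro order_tendstoD) auto
  then obtain n where n: "(\<integral>\<^sup>+x. ennreal \<bar>u x - v n x\<bar> * indicator ?W x \<partial>lborel) < ennreal (e / 4)"
    by (auto simp: eventually_sequentially)
  have "uniformly_continuous_on ?W (v n)"
    by (intro compact_uniformly_continuous continuous_on_subset[OF cont]) auto
  then obtain d where d: "d > 0" "\<And>x y. x \<in> ?W \<Longrightarrow> y \<in> ?W \<Longrightarrow> dist y x < d \<Longrightarrow> dist (v n y) (v n x) < e / 4"
    unfolding uniformly_continuous_on_def using e by (metis divide_pos_pos zero_less_numeral)
  show ?thesis
  proof (intro exI[of _ "min d 1"] conjI allI impI)
    show "min d 1 > 0" using d by simp
    fix z :: "real ^ 'n" assume z: "norm z < min d 1"
    have "(\<integral>\<^sup>+x. ennreal \<bar>u (x + z) - u x\<bar> \<partial>\<T>) \<le>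
      (\<integral>\<^sup>+x. ennreal \<bar>u (x + z) - v n (x + z)\<bar> + ennreal (e / 4) + ennreal \<bar>u (x + 0) - v n (x + 0)\<bar> \<partial>\<T>)"
    proof (rule nn_integral_mono_AE)
      show "AE x in \<T>. ennreal \<bar>u (x + z) - u x\<bar> \<le>
        ennreal \<bar>u (x + z) - v n (x + z)\<bar> + ennreal (e / 4) + ennreal \<bar>u (x + 0) - v n (x + 0)\<bar>"
        using AE_unit_torus_half_open_cube
      proof eventually_elim
        case (elim x)
        then have x: "0 \<le> x $ i \<and> x $ i < 1" for i by (simp add: half_open_cube_def)
        have z1: "\<bar>z $ i\<bar> \<le> 1" for i using component_le_norm_cart[of z i] z by linarith
        have "x \<in> ?W" using x by (auto simp: mem_box_cart) (smt (verit))+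
        moreover have "x + z \<in> ?W" using x z1 by (auto simp: mem_box_cart abs_le_iff) (smt (verit))+
        ultimately have "dist (v n (x + z)) (v n x) < e / 4" using d z by (simp add: dist_norm)
        then have "\<bar>u (x + z) - u x\<bar> \<le> \<bar>u (x + z) - v n (x + z)\<bar> + e / 4 + \<bar>u (x + 0) - v n (x + 0)\<bar>"
          by (simp only: dist_real_def add_0_right)
        then show ?case using e by (simp flip: ennreal_plus)
      qed
    qed
    also have "\<dots> = (\<integral>\<^sup>+x. ennreal \<bar>u (x + z) - v n (x + z)\<bar> \<partial>\<T>) + ennreal (e / 4)
        + (\<integral>\<^sup>+x. ennreal \<bar>u (x + 0) - v n (x + 0)\<bar> \<partial>\<T>)"
      by (simp add: nn_integral_add)
    also have "\<dots> \<le> ennreal (e / 4) + ennreal (e / 4) + ennreal (e / 4)"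
      using n z nn_integral_unit_torus_shift_le[of "\<lambda>x. ennreal \<bar>u x - v n x\<bar>" z]
        nn_integral_unit_torus_shift_le[of "\<lambda>x. ennreal \<bar>u x - v n x\<bar>" 0]
      by (intro add_mono) auto
    also have "\<dots> < ennreal e" using e by (simp add: ennreal_lessI flip: ennreal_plus)
    finally show "(\<integral>\<^sup>+x. ennreal \<bar>u (x + z) - u x\<bar> \<partial>\<T>) < ennreal e" .
  qed
qed

text \<open>Truncation at height n reduces the claim to bounded functions; since the truncation
  error is periodic, its integral is the same before and after the shift.\<close>

lemma translation_continuity:
  fixes u :: "real ^ 'n \<Rightarrow> real"
  assumes [measurable]: "u \<in> borel_measurable borel" and per: "periodic u"
    and int: "integrable \<T> u" and e: "e > 0"
  shows "\<exists>d>0. \<forall>z. norm z < d \<longrightarrow> (\<integral>\<^sup>+x. ennreal \<bar>u (x + z) - u x\<bar> \<partial>\<T>) < ennreal e"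
proof -
  define v where "v n x = max (- real n) (min (real n) (u x))" for n x
  have [measurable]: "v n \<in> borel_measurable borel" for n unfolding v_def[abs_def] by measurable
  have pv: "periodic (\<lambda>x. ennreal \<bar>u x - v n x\<bar>)" for n using per by (auto simp: periodic_def v_def)
  have "(\<lambda>n. \<integral>\<^sup>+x. ennreal \<bar>u x - v n x\<bar> \<partial>\<T>) \<longlonglongrightarrow> (\<integral>\<^sup>+x. 0 \<partial>(\<T> :: (real ^ 'n) measure))"
  proof (rule nn_integral_dominated_convergence[where w = "\<lambda>x. ennreal \<bar>u x\<bar>"])
    show "AE x in \<T>. ennreal \<bar>u x - v n x\<bar> \<le> ennreal \<bar>u x\<bar>" for n
      by (intro AE_I2 ennreal_leI) (auto simp: v_def)
    show "(\<integral>\<^sup>+x. ennreal \<bar>u x\<bar> \<partial>\<T>) < \<infinity>"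
      using int by (simp add: integrable_iff_bounded)
    show "AE x in \<T>. (\<lambda>n. ennreal \<bar>u x - v n x\<bar>) \<longlonglongrightarrow> 0"
    proof (intro AE_I2)
      fix x
      obtain n0 where n0: "\<bar>u x\<bar> \<le> real n0" using real_arch_simple by blast
      have "\<forall>\<^sub>F n in sequentially. ennreal \<bar>u x - v n x\<bar> = 0"
        unfolding eventually_sequentially
      proof (intro exI[of _ n0] allI impI)
        fix n assume "n \<ge> n0"
        then have "\<bar>u x\<bar> \<le> real n" using n0 by linarith
        then show "ennreal \<bar>u x - v n x\<bar> = 0" by (simp add: v_def)
      qed
      then show "(\<lambda>n. ennreal \<bar>u x - v n x\<bar>) \<longlonglongrightarrow> 0" by (simp add: tendsto_eventually)
    qed
  qed auto
  then have "\<forall>\<^sub>F n in sequentially. (\<integral>\<^sup>+x. ennreal \<bar>u x - v n x\<bar> \<partial>\<T>) < ennreal (e / 4)"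
    using e by (intro order_tendstoD) auto
  then obtain n where n: "(\<integral>\<^sup>+x. ennreal \<bar>u x - v n x\<bar> \<partial>\<T>) < ennreal (e / 4)"
    by (auto simp: eventually_sequentially)
  have "\<exists>d>0. \<forall>z. norm z < d \<longrightarrow> (\<integral>\<^sup>+x. ennreal \<bar>v n (x + z) - v n x\<bar> \<partial>\<T>) < ennreal (e / 4)"
    using e by (intro translation_continuity_bounded[where K = "real n"]) (auto simp: v_def)
  then obtain d where d: "d > 0"
    "\<And>z. norm z < d \<Longrightarrow> (\<integral>\<^sup>+x. ennreal \<bar>v n (x + z) - v n x\<bar> \<partial>\<T>) < ennreal (e / 4)"
    by auto
  show ?thesis
  proof (intro exI[of _ d] conjI allI impI)
    fix z :: "real ^ 'n" assume z: "norm z < d"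
    have "(\<integral>\<^sup>+x. ennreal \<bar>u (x + z) - u x\<bar> \<partial>\<T>) \<le>
      (\<integral>\<^sup>+x. ennreal \<bar>u (x + z) - v n (x + z)\<bar> + ennreal \<bar>v n (x + z) - v n x\<bar> + ennreal \<bar>u x - v n x\<bar> \<partial>\<T>)"
      by (intro nn_integral_mono) (simp flip: ennreal_plus)
    also have "\<dots> = (\<integral>\<^sup>+x. ennreal \<bar>u (x + z) - v n (x + z)\<bar> \<partial>\<T>)
        + (\<integral>\<^sup>+x. ennreal \<bar>v n (x + z) - v n x\<bar> \<partial>\<T>) + (\<integral>\<^sup>+x. ennreal \<bar>u x - v n x\<bar> \<partial>\<T>)"
      by (simp add: nn_integral_add)
    also have "\<dots> \<le> ennreal (e / 4) + ennreal (e / 4) + ennreal (e / 4)"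
      using n d(2)[OF z] nn_integral_unit_torus_translate[OF _ pv[of n], of z]
      by (intro add_mono) auto
    also have "\<dots> < ennreal e" using e by (simp add: ennreal_lessI flip: ennreal_plus)
    finally show "(\<integral>\<^sup>+x. ennreal \<bar>u (x + z) - u x\<bar> \<partial>\<T>) < ennreal e" .
  qed (use d in auto)
qed

text \<open>With \<open>eps\<close> the square of a length d and \<open>rho\<close> replaced by the
  squared distance r\<cdot>r, this is d\<cdot>d / (r\<cdot>r + d\<cdot>d) to the power N/2 + 1 up to
  a factor depending on d, the profile obtained from the Laplacian of the regularised fundamental
  solution. It concentrates at the lattice with mass bounded below.\<close>

definition bump :: "real \<Rightarrow> real ^ 'n \<Rightarrow> real" where
  "bump eps x = eps * (rho x + eps) powr (- real CARD('n) / 2 - 1)"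

lemma test_rho_powr: "eps > 0 \<Longrightarrow> test_function (\<lambda>x. (rho x + eps) powr a)"
  using test_rho rho_nonneg
  by (auto simp: test_function_def periodic_def intro!: smooth_powr smooth_add smooth_const add_nonneg_pos)

lemma test_bump: "eps > 0 \<Longrightarrow> test_function (bump eps)"
  unfolding bump_def[abs_def] by (intro test_cmult test_rho_powr)

lemma bump_pos: "eps > 0 \<Longrightarrow> bump eps x > 0"
  using add_nonneg_pos[OF rho_nonneg, of eps x] by (simp add: bump_def)

lemma bump_even: "bump eps (- x) = bump eps x"
  by (simp add: bump_def rho_even)

definition bump_mass_bound :: "'n itself \<Rightarrow> real" where
  "bump_mass_bound _ = 2 powr (- real CARD('n) / 2 - 1) * (1 / (pi * sqrt (real CARD('n)))) ^ CARD('n)"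

lemma bump_mass_bound_pos: "bump_mass_bound TYPE('n::finite) > 0"
  by (simp add: bump_mass_bound_def)

text \<open>On the corner cube of side s the bound
  \<open>\<bar>sin (pi * t)\<bar> \<le> pi * s\<close> gives \<open>rho \<le> eps\<close>, so the
  bump is at least \<open>eps * (2 * eps) powr (- N / 2 - 1)\<close> there. The powers of
  \<open>eps\<close> cancel against the volume of that cube, which leaves a bound uniform in
  \<open>eps\<close>.\<close>

lemma bump_mass_ge:
  assumes eps: "0 < eps" "eps \<le> 1"
  shows "bump_mass_bound TYPE('n::finite) \<le> (\<oint>x :: real ^ 'n. bump eps x)"
proof -
  let ?N = "real CARD('n)"
  define s where "s = sqrt eps / (pi * sqrt ?N)"
  have s0: "s > 0" using eps by (simp add: s_def)
  have N1: "1 \<le> sqrt ?N" by (simp add: Suc_leI)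
  have "1 * 1 \<le> pi * sqrt ?N" using N1 pi_ge_two by (intro mult_mono) auto
  moreover have "sqrt eps \<le> 1" using eps by simp
  ultimately have s1: "s \<le> 1" using eps unfolding s_def by (subst divide_le_eq_1_pos) (simp, linarith)
  define B where "B = cbox 0 (\<chi> i. s :: real ^ 'n)"
  have [measurable]: "B \<in> sets borel" by (simp add: B_def)
  have Bsub: "B \<subseteq> cbox 0 1" using s1 unfolding B_def subset_iff mem_box_cart
    by (metis (no_types, lifting) order_trans vec_lambda_beta one_index)
  let ?c = "2 powr (- ?N / 2 - 1) * eps powr (- ?N / 2)"
  have lower: "?c * indicator B x \<le> bump eps x" for x
  proof (cases "x \<in> B")
    case True
    then have x: "0 \<le> x $ i" "x $ i \<le> s" for i by (auto simp: B_def mem_box_cart)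
    have "(sin (pi * x $ i))\<^sup>2 \<le> (pi * s)\<^sup>2" for i
    proof -
      have "\<bar>sin (pi * x $ i)\<bar> \<le> \<bar>pi * s\<bar>"
        using abs_sin_x_le_abs_x[of "pi * x $ i"] x[of i] s0 by (auto simp: abs_mult intro: order_trans)
      then show ?thesis by (simp only: abs_le_square_iff)
    qed
    then have "rho x \<le> (\<Sum>i\<in>(UNIV :: 'n set). (pi * s)\<^sup>2)" unfolding rho_def by (intro sum_mono)
    also have "\<dots> = eps" using eps by (simp add: s_def power_divide power_mult_distrib)
    finally have "(2 * eps) powr (- ?N / 2 - 1) \<le> (rho x + eps) powr (- ?N / 2 - 1)"
      using eps rho_nonneg[of x] by (intro powr_mono2') auto
    then have "eps * (2 * eps) powr (- ?N / 2 - 1) \<le> bump eps x"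
      unfolding bump_def using eps by (intro mult_left_mono) auto
    moreover have "eps * (2 * eps) powr (- ?N / 2 - 1) = ?c"
      using eps powr_add[of eps 1 "- ?N / 2 - 1"] by (simp add: powr_mult)
    ultimately show ?thesis using True by simp
  qed (use bump_pos[OF eps(1), of x] in simp)
  have "emeasure \<T> B = emeasure lborel B"
    using Bsub unfolding unit_torus_def
    by (subst emeasure_density) (auto simp flip: nn_integral_indicator intro!: nn_integral_cong simp: indicator_def)
  also have "\<dots> = ennreal (s ^ CARD('n))"
  proof -
    have "emeasure lborel B = ennreal (\<Prod>b\<in>(Basis :: (real ^ 'n) set). (\<chi> i. s) \<bullet> b)"
      unfolding B_def using s0 by (subst emeasure_lborel_cbox) (auto simp: Basis_vec_def inner_axis)
    also have "(\<Prod>b\<in>(Basis :: (real ^ 'n) set). (\<chi> i. s) \<bullet> b) = (\<Prod>b\<in>(Basis :: (real ^ 'n) set). s)"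
      by (intro prod.cong) (auto simp: Basis_vec_def inner_axis)
    finally show ?thesis by simp
  qed
  finally have mB: "measure \<T> B = s ^ CARD('n)" using s0 by (simp add: measure_def)
  have "bump_mass_bound TYPE('n) = ?c * s ^ CARD('n)"
  proof -
    have "s ^ CARD('n) = sqrt eps ^ CARD('n) * (1 / (pi * sqrt ?N)) ^ CARD('n)"
      by (simp add: s_def power_divide)
    moreover have "sqrt eps ^ CARD('n) = eps powr (?N / 2)"
      using eps by (simp add: powr_half_sqrt[symmetric] powr_powr flip: powr_realpow)
    moreover have "eps powr (- ?N / 2) * eps powr (?N / 2) = 1"
      using eps by (simp flip: powr_add)
    ultimately show ?thesis by (simp add: bump_mass_bound_def)
  qed
  also have "\<dots> = (\<oint>x :: real ^ 'n. ?c * indicator B x)"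
    using mB by simp
  also have "\<dots> \<le> (\<oint>x :: real ^ 'n. bump eps x)"
  proof (rule integral_mono)
    show "integrable \<T> (\<lambda>x. ?c * indicator B x :: real)"
      by (intro integrable_mult_right unit_torus.integrable_const_bound[where B = 1]) auto
  qed (use lower test_integrable[OF test_bump[OF eps(1)]] in auto)
  finally show ?thesis .
qed

definition mollifier :: "real \<Rightarrow> real ^ 'n \<Rightarrow> real" where
  "mollifier eps x = bump eps x / (\<oint>x :: real ^ 'n. bump eps x)"

context
  fixes eps :: real
  assumes eps: "0 < eps" "eps \<le> 1"
begin

lemma bump_mass_pos: "(\<oint>x :: real ^ 'n. bump eps x) > 0"
  using bump_mass_ge[OF eps, where 'n = 'n] bump_mass_bound_pos[where 'n = 'n] by linarith

lemma test_mollifier: "test_function (mollifier eps :: real ^ 'n \<Rightarrow> real)"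
  using test_cmult[OF test_bump[OF eps(1)], of "1 / (\<oint>x :: real ^ 'n. bump eps x)"]
  by (simp add: mollifier_def[abs_def])

lemma mollifier_nonneg: "mollifier eps (x :: real ^ 'n) \<ge> 0"
  unfolding mollifier_def by (intro divide_nonneg_pos less_imp_le bump_pos[OF eps(1)] bump_mass_pos)

lemma mollifier_even: "mollifier eps (- x :: real ^ 'n) = mollifier eps x"
  by (simp add: mollifier_def bump_even)

lemma integral_mollifier: "(\<oint>x :: real ^ 'n. mollifier eps x) = 1"
  using bump_mass_pos[where 'n = 'n] by (simp add: mollifier_def)

lemma mollifier_le:
  assumes "s > 0" "rho x \<ge> s"
  shows "mollifier eps (x :: real ^ 'n) \<le> eps * s powr (- real CARD('n) / 2 - 1) / bump_mass_bound TYPE('n)"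
proof -
  have "(rho x + eps) powr (- real CARD('n) / 2 - 1) \<le> s powr (- real CARD('n) / 2 - 1)"
    using eps assms by (intro powr_mono2') auto
  then have "bump eps x \<le> eps * s powr (- real CARD('n) / 2 - 1)"
    unfolding bump_def using eps by (intro mult_left_mono) auto
  then show ?thesis unfolding mollifier_def
    using bump_mass_ge[OF eps, where 'n = 'n] bump_mass_bound_pos[where 'n = 'n] eps
    by (intro frac_le) auto
qed

end

text \<open>Substitution of \<open>x + z\<close> for \<open>y\<close>, with evenness of f, moves the
  shift onto u. In this form the mollification error is an average of translation
  differences.\<close>

lemma convol_translate:
  fixes u f :: "real ^ 'n \<Rightarrow> real"
  assumes [measurable]: "u \<in> borel_measurable borel" and per: "periodic u"
    and f: "test_function f" and even: "\<And>x. f (- x) = f x"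
  shows "convol u f x = (\<oint>z. f z * u (x + z))"
proof -
  have [measurable]: "f \<in> borel_measurable borel" using f by measurable
  have "f (x - y) = f (y - x)" for y using even[of "y - x"] by simp
  then have "convol u f x = (\<oint>y. u y * f (y - x))"
    by (simp add: convol_def)
  also have "\<dots> = (\<oint>y. u (y + x) * f (y + x - x))"
  proof (rule integral_unit_torus_translate[symmetric])
    have "f (y + k - x) = f (y - x)" if "\<forall>i. k $ i \<in> \<int>" for y k
    proof -
      have "y + k - x = (y - x) + k" by simp
      then show ?thesis using f that unfolding test_function_def periodic_def by metis
    qed
    then show "periodic (\<lambda>y. u y * f (y - x))"
      using per by (simp add: periodic_def)
  qed measurable
  finally show ?thesis by (simp add: mult.commute add.commute)
qed

text \<open>By Fubini the error is at most the average of the translation modulus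
  \<open>\<omega>\<close> against the mollifier. Near the lattice \<open>\<omega>\<close> is small;
  elsewhere \<open>\<omega>\<close> is at most twice the mean of \<open>\<bar>u\<bar>\<close> and
  the mollifier is of order \<open>eps\<close>.\<close>

lemma mollifier_L1_convergence:
  fixes u :: "real ^ 'n \<Rightarrow> real"
  assumes meas [measurable]: "u \<in> borel_measurable borel" and per: "periodic u" and int: "integrable \<T> u"
    and eps: "\<And>j. 0 < eps j" "\<And>j. eps j \<le> 1" "eps \<longlonglongrightarrow> 0"
  shows "(\<lambda>j. (\<oint>x. \<bar>convol u (mollifier (eps j)) x - u x\<bar>)) \<longlonglongrightarrow> 0"
proof -
  define \<omega> where "\<omega> z = (\<integral>\<^sup>+x. ennreal \<bar>u (x + z) - u x\<bar> \<partial>\<T>)" for z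
  define U where "U = (\<oint>x. \<bar>u x\<bar>)"
  let ?b = "bump_mass_bound TYPE('n)"
  have U0: "U \<ge> 0" by (simp add: U_def)
  have inttr: "integrable \<T> (\<lambda>x. u (x + z))" for z
    using int integrable_unit_torus_translate[OF meas per] by simp
  have [measurable]: "mollifier (eps j) \<in> borel_measurable (borel :: (real ^ 'n) measure)" for j
    using test_mollifier[OF eps(1,2)] by measurable
  have \<omega>U: "\<omega> z \<le> ennreal (2 * U)" for z
  proof -
    have "\<omega> z = ennreal (\<oint>x. \<bar>u (x + z) - u x\<bar>)"
      unfolding \<omega>_def using int inttr by (intro nn_integral_eq_integral) auto
    also have "(\<oint>x. \<bar>u (x + z) - u x\<bar>) \<le> (\<oint>x. \<bar>u (x + z)\<bar> + \<bar>u x\<bar>)"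
      using int inttr by (intro integral_mono) auto
    also have "\<dots> = 2 * U"
      using int inttr integral_unit_torus_translate[of "\<lambda>x. \<bar>u x\<bar>" z] per
      by (simp add: U_def periodic_def)
    finally show ?thesis by (simp add: ennreal_leI)
  qed
  have L1: "(\<integral>\<^sup>+x. ennreal \<bar>convol u (mollifier (eps j)) x - u x\<bar> \<partial>\<T>) \<le>
    (\<integral>\<^sup>+z. ennreal (mollifier (eps j) z) * \<omega> z \<partial>\<T>)" for j
  proof -
    let ?\<eta> = "mollifier (eps j) :: real ^ 'n \<Rightarrow> real"
    note \<eta> = test_mollifier[OF eps(1,2), of j, where 'n = 'n]
    note \<eta>0 = mollifier_nonneg[OF eps(1,2), of j, where 'n = 'n]
    have "ennreal \<bar>convol u ?\<eta> x - u x\<bar> \<le> (\<integral>\<^sup>+z. ennreal (?\<eta> z) * ennreal \<bar>u (x + z) - u x\<bar> \<partial>\<T>)" for x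
    proof -
      have i1: "integrable \<T> (\<lambda>z. ?\<eta> z * u (x + z))"
        using integrable_mult_test_function[OF inttr[of x] \<eta>] by (simp add: add.commute mult.commute)
      have i2: "integrable \<T> ?\<eta>" using \<eta> by (rule test_integrable)
      have "convol u ?\<eta> x - u x = (\<oint>z. ?\<eta> z * u (x + z)) - (\<oint>z. ?\<eta> z * u x)"
        using convol_translate[OF meas per \<eta> mollifier_even[OF eps(1,2)]] integral_mollifier[OF eps(1,2), of j, where 'n = 'n] by simp
      also have "\<dots> = (\<oint>z. ?\<eta> z * (u (x + z) - u x))"
        using i1 i2 by (simp add: right_diff_distrib)
      finally have "\<bar>convol u ?\<eta> x - u x\<bar> \<le> (\<oint>z. \<bar>?\<eta> z * (u (x + z) - u x)\<bar>)"
        by simp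
      then have "ennreal \<bar>convol u ?\<eta> x - u x\<bar> \<le> ennreal (\<oint>z. \<bar>?\<eta> z * (u (x + z) - u x)\<bar>)"
        by (rule ennreal_leI)
      also have "\<dots> = (\<integral>\<^sup>+z. ennreal \<bar>?\<eta> z * (u (x + z) - u x)\<bar> \<partial>\<T>)"
        using i1 i2 by (intro nn_integral_eq_integral[symmetric]) (auto simp: right_diff_distrib)
      finally show ?thesis using \<eta>0 by (simp add: abs_mult ennreal_mult)
    qed
    then have "(\<integral>\<^sup>+x. ennreal \<bar>convol u ?\<eta> x - u x\<bar> \<partial>\<T>) \<le>
      (\<integral>\<^sup>+x. (\<integral>\<^sup>+z. ennreal (?\<eta> z) * ennreal \<bar>u (x + z) - u x\<bar> \<partial>\<T>) \<partial>\<T>)"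
      by (intro nn_integral_mono)
    also have "\<dots> = (\<integral>\<^sup>+z. (\<integral>\<^sup>+x. ennreal (?\<eta> z) * ennreal \<bar>u (x + z) - u x\<bar> \<partial>\<T>) \<partial>\<T>)"
      by (rule unit_torus_pair.Fubini') measurable
    finally show ?thesis by (simp add: \<omega>_def nn_integral_cmult)
  qed
  have [measurable]: "\<omega> \<in> borel_measurable borel"
    unfolding \<omega>_def by measurable
  have "(\<lambda>j. (\<integral>\<^sup>+x. ennreal \<bar>convol u (mollifier (eps j)) x - u x\<bar> \<partial>\<T>)) \<longlonglongrightarrow> 0"
  proof (rule order_tendstoI)
    fix e :: ennreal assume "0 < e"
    then obtain e' where e': "0 < ennreal e'" "ennreal e' < e" 
    proof -
      obtain a where a: "0 < a" "a < e" using dense[OF \<open>0 < e\<close>] by blast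
      then obtain r where "a = ennreal r" by (cases a) auto
      with a show ?thesis using that by blast
    qed
    then have e'0: "e' > 0" by (simp add: ennreal_less_zero_iff)
    obtain d where d: "d > 0" "\<And>z. norm z < d \<Longrightarrow> \<omega> z < ennreal (e' / 2)"
      using translation_continuity[OF meas per int, of "e' / 2"] e'0 unfolding \<omega>_def by auto
    obtain s where s: "s > 0" "\<And>z :: real ^ 'n. rho z < s \<Longrightarrow> \<exists>k\<in>integer_lattice. norm (z + k) < d"
      using rho_small_near_lattice[OF d(1)] by blast
    \<comment> \<open>The modulus \<open>\<omega>\<close> inherits the periods of u, so its
      smallness at the origin spreads to a neighbourhood of the whole lattice.\<close>
    have \<omega>s: "\<omega> z \<le> ennreal (e' / 2)" if zs: "rho z < s" for z
    proof -
      obtain k where k: "k \<in> integer_lattice" "norm (z + k) < d" using s(2)[OF zs] by blast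
      have "u (x + (z + k)) = u (x + z)" for x
        using periodic_lattice[OF per k(1), of "x + z"] by (simp add: add.assoc)
      then have "\<omega> z = \<omega> (z + k)" by (simp add: \<omega>_def)
      then show ?thesis using d(2)[OF k(2)] by simp
    qed
    define D where "D = s powr (- real CARD('n) / 2 - 1) / ?b * (2 * U)"
    have D0: "D \<ge> 0" using U0 bump_mass_bound_pos[where 'n = 'n] by (simp add: D_def)
    have bound: "(\<integral>\<^sup>+z. ennreal (mollifier (eps j) z) * \<omega> z \<partial>\<T>) \<le> ennreal (e' / 2 + eps j * D)" for j
    proof -
      let ?\<eta> = "mollifier (eps j) :: real ^ 'n \<Rightarrow> real"
      note \<eta>0 = mollifier_nonneg[OF eps(1,2), of j, where 'n = 'n]
      have "(\<integral>\<^sup>+z. ennreal (?\<eta> z) * \<omega> z \<partial>\<T>) \<le> (\<integral>\<^sup>+z. ennreal (?\<eta> z) * ennreal (e' / 2) + ennreal (eps j * D) \<partial>\<T>)"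
      proof (rule nn_integral_mono)
        fix z :: "real ^ 'n"
        show "ennreal (?\<eta> z) * \<omega> z \<le> ennreal (?\<eta> z) * ennreal (e' / 2) + ennreal (eps j * D)"
        proof (cases "rho z < s")
          case True
          then have "ennreal (?\<eta> z) * \<omega> z \<le> ennreal (?\<eta> z) * ennreal (e' / 2)"
            by (intro mult_left_mono \<omega>s) auto
          then show ?thesis by (rule order_trans) simp
        next
          case False
          then have "?\<eta> z \<le> eps j * s powr (- real CARD('n) / 2 - 1) / ?b"
            by (intro mollifier_le[OF eps(1,2) s(1)]) simp
          then have "ennreal (?\<eta> z) * \<omega> z \<le> ennreal (eps j * s powr (- real CARD('n) / 2 - 1) / ?b) * ennreal (2 * U)"
            by (intro mult_mono ennreal_leI \<omega>U) auto
          also have "\<dots> = ennreal (eps j * D)"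
            using U0 eps(1)[of j] bump_mass_bound_pos[where 'n = 'n]
            by (subst ennreal_mult[symmetric]) (auto simp: D_def less_imp_le)
          finally show ?thesis by (rule order_trans) simp
        qed
      qed
      also have "\<dots> = (\<integral>\<^sup>+z. ennreal (?\<eta> z) \<partial>\<T>) * ennreal (e' / 2) + ennreal (eps j * D)"
        by (simp add: nn_integral_add nn_integral_multc)
      also have "(\<integral>\<^sup>+z. ennreal (?\<eta> z) \<partial>\<T>) = 1"
        using nn_integral_eq_integral[OF test_integrable[OF test_mollifier[OF eps(1,2), of j, where 'n = 'n]]]
          \<eta>0 integral_mollifier[OF eps(1,2), of j, where 'n = 'n] by simp
      also have "1 * ennreal (e' / 2) + ennreal (eps j * D) = ennreal (e' / 2 + eps j * D)"
        using e'0 D0 eps(1)[of j] by (simp add: less_imp_le)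
      finally show ?thesis .
    qed
    have "(\<lambda>j. e' / 2 + eps j * D) \<longlonglongrightarrow> e' / 2 + 0 * D" by (intro tendsto_intros eps)
    then have "\<forall>\<^sub>F j in sequentially. e' / 2 + eps j * D < e'"
      by (rule order_tendstoD) (use e'0 in simp)
    then show "\<forall>\<^sub>F j in sequentially. (\<integral>\<^sup>+x. ennreal \<bar>convol u (mollifier (eps j)) x - u x\<bar> \<partial>\<T>) < e"
    proof eventually_elim
      case (elim j)
      then have "ennreal (e' / 2 + eps j * D) \<le> ennreal e'" by (intro ennreal_leI) simp
      then show ?case using L1[of j] bound[of j] e'(2) by (meson order_le_less_trans order_trans)
    qed
  qed auto
  moreover have "(\<integral>\<^sup>+x. ennreal \<bar>convol u (mollifier (eps j)) x - u x\<bar> \<partial>\<T>) =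
    ennreal (\<oint>x. \<bar>convol u (mollifier (eps j)) x - u x\<bar>)" for j
    using int test_integrable[OF test_convol[OF int test_mollifier[OF eps(1,2), of j]]]
    by (intro nn_integral_eq_integral) auto
  ultimately have "(\<lambda>j. ennreal (\<oint>x. \<bar>convol u (mollifier (eps j)) x - u x\<bar>)) \<longlonglongrightarrow> ennreal 0"
    by simp
  then show ?thesis by (subst (asm) tendsto_ennreal_iff) auto
qed

section \<open>A regularised Green function\<close>

text \<open>Comparable to the distance to the lattice raised to the power 1 - N, the size of the
  gradient of the fundamental solution, smoothed at scale \<open>sqrt eps\<close>.\<close>

definition riesz_kernel :: "real \<Rightarrow> real ^ 'n \<Rightarrow> real" where
  "riesz_kernel eps x = (rho x + eps) powr ((1 - real CARD('n)) / 2)"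

lemma test_riesz_kernel: "eps > 0 \<Longrightarrow> test_function (riesz_kernel eps)"
  unfolding riesz_kernel_def[abs_def] by (rule test_rho_powr)

lemma rho_add_pos: "eps > 0 \<Longrightarrow> rho x + eps > 0"
  by (rule add_nonneg_pos[OF rho_nonneg])

lemma riesz_kernel_pos: "eps > 0 \<Longrightarrow> riesz_kernel eps x > 0"
  using rho_add_pos[of eps x] by (simp add: riesz_kernel_def)

lemma has_derivative_coordinate_function:
  assumes "\<And>t. (h has_real_derivative h' t) (at t)"
  shows "((\<lambda>x :: real ^ 'n. h (x $ j)) has_derivative (\<lambda>v. h' (x $ j) * v $ j)) (at x)"
  by (rule has_derivative_compose[OF bounded_linear_imp_has_derivative[OF bounded_linear_vec_nth]
        has_field_derivative_imp_has_derivative[OF assms]])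

lemma partial_rho: "partial i rho x = 2 * pi * sin (pi * x $ i) * cos (pi * x $ i)"
proof -
  have "((\<lambda>t. (sin (pi * t))\<^sup>2) has_real_derivative 2 * pi * sin (pi * t) * cos (pi * t)) (at t)" for t
    by (auto intro!: derivative_eq_intros)
  from has_derivative_coordinate_function[OF this]
  have "(rho has_derivative (\<lambda>v. \<Sum>j\<in>UNIV. 2 * pi * sin (pi * x $ j) * cos (pi * x $ j) * v $ j)) (at x)"
    unfolding rho_def[abs_def] by (intro has_derivative_sum) 
  from partial_eqI[OF this] show ?thesis
    by (subst (asm) sum.remove[of _ i]) (auto simp: axis_def intro!: sum.neutral)
qed

lemma partial_partial_rho:
  "partial i (partial i rho) x = 2 * pi\<^sup>2 * (1 - 2 * (sin (pi * x $ i))\<^sup>2)"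
proof -
  have "((\<lambda>t. 2 * pi * sin (pi * t) * cos (pi * t)) has_real_derivative
      2 * pi\<^sup>2 * (1 - 2 * (sin (pi * t))\<^sup>2)) (at t)" for t
    by (auto intro!: derivative_eq_intros simp: cos_squared_eq[unfolded power2_eq_square] power2_eq_square algebra_simps)
  from partial_eqI[OF has_derivative_coordinate_function[OF this, of i x], of i]
  show ?thesis by (simp add: partial_rho[abs_def])
qed

lemma partial_rho_squared_le: "(partial i rho x)\<^sup>2 \<le> 4 * pi\<^sup>2 * rho x"
proof -
  have "(partial i rho x)\<^sup>2 = 4 * pi\<^sup>2 * ((sin (pi * x $ i))\<^sup>2 * (cos (pi * x $ i))\<^sup>2)"
    by (simp add: partial_rho power_mult_distrib)
  also have "\<dots> \<le> 4 * pi\<^sup>2 * (rho x * 1)"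
    by (intro mult_left_mono mult_mono sin_squared_le_rho) (auto simp: abs_square_le_1 rho_nonneg)
  finally show ?thesis by simp
qed

text \<open>\<open>G = h (rho + eps)\<close> with \<open>h' y = - y powr (- N / 2)\<close>: for this profile the leading terms of the
  Laplacian cancel away from the lattice, and what remains of them is \<^const>\<open>bump\<close>.\<close>

lemma regularised_green_function:
  fixes C :: real
  assumes eps: "0 < eps" "eps \<le> 1"
    and C: "C = 2 * pi\<^sup>2 * (real CARD('n::finite) + 2) * (real CARD('n) + 1)"
  shows "\<exists>G :: real ^ 'n \<Rightarrow> real. test_function G \<and> (\<forall>i x. \<bar>partial i G x\<bar> \<le> C * riesz_kernel eps x) \<and>
    (\<forall>x. \<bar>(\<Sum>i\<in>UNIV. partial i (partial i G) x) + 2 * pi\<^sup>2 * real CARD('n) * bump eps x\<bar> \<le> C * riesz_kernel eps x)"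
proof -
  let ?N = "real CARD('n)"
  have N1: "?N \<ge> 1" by (simp add: Suc_leI)
  \<comment> \<open>The primitive of \<open>- (y powr (- N / 2))\<close>; dimension two is the
    logarithmic case.\<close>
  define h where "h y = (if ?N = 2 then - ln y else - (y powr (1 - ?N / 2) / (1 - ?N / 2)))" for y
  define G where "G x = h (rho x + eps)" for x :: "real ^ 'n"
  have dh: "(h has_real_derivative - (y powr (- ?N / 2))) (at y)" if "y > 0" for y
  proof (cases "?N = 2")
    case True
    then show ?thesis using that unfolding h_def[abs_def]
      by (auto intro!: derivative_eq_intros simp: powr_minus field_simps)
  next
    case False
    have "((\<lambda>y. - (y powr (1 - ?N / 2) / (1 - ?N / 2))) has_real_derivative
        - ((1 - ?N / 2) * y powr (1 - ?N / 2 - 1) / (1 - ?N / 2))) (at y)"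
      by (intro DERIV_minus DERIV_cdivide has_real_derivative_powr that)
    then show ?thesis using False unfolding h_def[abs_def] by simp
  qed
  have tr: "test_function (\<lambda>x :: real ^ 'n. rho x + eps)"
    using test_rho by (auto simp: test_function_def periodic_def intro: smooth_add smooth_const)
  have G: "test_function G"
    unfolding G_def[abs_def]
  proof (rule test_compose[OF tr dh[OF rho_add_pos[OF eps(1)]]])
    show "smooth (\<lambda>x :: real ^ 'n. - ((rho x + eps) powr (- ?N / 2)))"
    proof -
      have "test_function (\<lambda>x :: real ^ 'n. (rho x + eps) powr (- ?N / 2))"
        by (rule test_rho_powr[OF eps(1)])
      from test_cmult[OF this, of "- 1"] show ?thesis by (simp add: test_function_def)
    qed
  qed
  have dtr: "partial i (\<lambda>x :: real ^ 'n. rho x + eps) = partial i rho" for i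
    using partial_add[of rho "\<lambda>x. eps" i] test_differentiable[OF test_rho]
    by (simp add: partial_const)
  have pG: "partial i G = (\<lambda>x. - ((rho x + eps) powr (- ?N / 2)) * partial i rho x)" for i
    unfolding G_def[abs_def] using partial_compose[OF test_differentiable[OF tr] dh[OF rho_add_pos[OF eps(1)]]]
    by (simp add: dtr)
  have dp: "((\<lambda>y. - (y powr (- ?N / 2))) has_real_derivative ?N / 2 * (y powr (- ?N / 2 - 1))) (at y)" if "y > 0" for y
    using that by (auto intro!: derivative_eq_intros simp: field_simps)
  have ppG: "partial i (partial i G) x = ?N / 2 * (rho x + eps) powr (- ?N / 2 - 1) * (partial i rho x)\<^sup>2
      - (rho x + eps) powr (- ?N / 2) * partial i (partial i rho) x" for i x
  proof -
    have d1: "(\<lambda>x :: real ^ 'n. - ((rho x + eps) powr (- ?N / 2))) differentiable_on UNIV"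
      using differentiable_compose_real[OF test_differentiable[OF tr] dp[OF rho_add_pos[OF eps(1)]]] .
    have d2: "partial i rho differentiable_on UNIV"
      by (intro test_differentiable test_partial test_rho)
    show ?thesis
      unfolding pG partial_mult[OF d1 d2]
        partial_compose[OF test_differentiable[OF tr] dp[OF rho_add_pos[OF eps(1)]]] dtr
      by (simp add: power2_eq_square)
  qed
  have C0: "C \<ge> 0" by (simp add: C)
  have grad: "\<bar>partial i G x\<bar> \<le> C * riesz_kernel eps x" for i x
  proof -
    let ?y = "rho x + eps"
    have y: "?y > 0" by (rule rho_add_pos[OF eps(1)])
    \<comment> \<open>The gradient of \<open>rho\<close> is at most of the order of the square root
      of \<open>rho\<close>, which raises the exponent from \<open>- N / 2\<close> to
      \<open>(1 - N) / 2\<close>.\<close>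
    have "\<bar>partial i rho x\<bar> \<le> sqrt (4 * pi\<^sup>2 * ?y)"
    proof (rule real_le_rsqrt)
      have "4 * pi\<^sup>2 * rho x \<le> 4 * pi\<^sup>2 * ?y" using eps by (intro mult_left_mono) auto
      then show "\<bar>partial i rho x\<bar>\<^sup>2 \<le> 4 * pi\<^sup>2 * ?y"
        using partial_rho_squared_le[of i x] by (simp only: power2_abs)
    qed
    also have "\<dots> = 2 * pi * ?y powr (1/2)" using y by (simp add: real_sqrt_mult powr_half_sqrt)
    finally have "\<bar>partial i G x\<bar> \<le> ?y powr (- ?N / 2) * (2 * pi * ?y powr (1/2))"
      unfolding pG by (simp add: abs_mult mult_left_mono)
    also have "\<dots> = 2 * pi * riesz_kernel eps x"
      using y by (simp add: riesz_kernel_def diff_divide_distrib mult.left_commute flip: powr_add)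
    also have "\<dots> \<le> C * riesz_kernel eps x"
    proof (rule mult_right_mono)
      have "2 * pi * 1 \<le> 2 * pi * (pi * ((?N + 2) * (?N + 1)))"
      proof (intro mult_left_mono)
        have "1 * (1 * 1) \<le> pi * ((?N + 2) * (?N + 1))" using pi_ge_two N1 by (intro mult_mono) auto
        then show "1 \<le> pi * ((?N + 2) * (?N + 1))" by simp
      qed auto
      then show "2 * pi \<le> C" unfolding C by (simp add: power2_eq_square algebra_simps)
    qed (use riesz_kernel_pos[OF eps(1), of x] in simp)
    finally show ?thesis .
  qed
  have lap: "\<bar>(\<Sum>i\<in>UNIV. partial i (partial i G) x) + 2 * pi\<^sup>2 * ?N * bump eps x\<bar> \<le> C * riesz_kernel eps x" for x
  proof -
    let ?y = "rho x + eps"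
    define Q where "Q = (\<Sum>i\<in>UNIV. (sin (pi * x $ i))\<^sup>2 * (sin (pi * x $ i))\<^sup>2)"
    define p where "p = ?y powr (- ?N / 2 - 1)"
    have y: "?y > 0" by (rule rho_add_pos[OF eps(1)])
    have p0: "p \<ge> 0" by (simp add: p_def)
    have yp: "?y powr (- ?N / 2) = p * ?y"
      using y powr_add[of ?y "- ?N / 2 - 1" 1] by (simp add: p_def)
    have Q: "0 \<le> Q" "Q \<le> rho x * rho x"
    proof -
      show "0 \<le> Q" by (simp add: Q_def sum_nonneg)
      have "Q \<le> (\<Sum>i\<in>UNIV. rho x * (sin (pi * x $ i))\<^sup>2)"
        unfolding Q_def by (intro sum_mono mult_right_mono sin_squared_le_rho) auto
      then show "Q \<le> rho x * rho x" by (simp add: rho_def sum_distrib_left)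
    qed
    have s1: "(\<Sum>i\<in>UNIV. (partial i rho x)\<^sup>2) = 4 * pi\<^sup>2 * (rho x - Q)"
    proof -
      have "(partial i rho x)\<^sup>2 = 4 * pi\<^sup>2 * ((sin (pi * x $ i))\<^sup>2 - (sin (pi * x $ i))\<^sup>2 * (sin (pi * x $ i))\<^sup>2)" for i
        by (simp add: partial_rho power_mult_distrib cos_squared_eq algebra_simps)
      then show ?thesis by (simp add: sum_distrib_left[symmetric] sum_subtractf Q_def rho_def)
    qed
    have s2: "(\<Sum>i\<in>UNIV. partial i (partial i rho) x) = 2 * pi\<^sup>2 * (?N - 2 * rho x)"
      unfolding partial_partial_rho by (simp add: sum_distrib_left[symmetric] sum_subtractf rho_def)
    have "(\<Sum>i\<in>UNIV. partial i (partial i G) x) =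
        ?N / 2 * p * (\<Sum>i\<in>UNIV. (partial i rho x)\<^sup>2) - p * ?y * (\<Sum>i\<in>UNIV. partial i (partial i rho) x)"
      unfolding ppG yp p_def[symmetric] by (simp add: sum_subtractf sum_distrib_left)
    \<comment> \<open>Inside the bracket, \<open>N * rho\<close> and
      \<open>- N * (rho + eps)\<close> combine to \<open>- N * eps\<close>, which is the bump. What
      is left is quadratic in \<open>rho + eps\<close>, because \<open>Q\<close> is at most the
      square of \<open>rho\<close>.\<close>
    also have "\<dots> = 2 * pi\<^sup>2 * p * (2 * rho x * ?y - ?N * Q) - 2 * pi\<^sup>2 * ?N * (eps * p)"
      unfolding s1 s2 by (simp add: algebra_simps)
    finally have "(\<Sum>i\<in>UNIV. partial i (partial i G) x) + 2 * pi\<^sup>2 * ?N * bump eps x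
        = 2 * pi\<^sup>2 * p * (2 * rho x * ?y - ?N * Q)"
      by (simp add: bump_def p_def)
    also have "\<bar>\<dots>\<bar> \<le> 2 * pi\<^sup>2 * p * ((?N + 2) * (?y * ?y))"
    proof -
      have "\<bar>2 * rho x * ?y - ?N * Q\<bar> \<le> 2 * rho x * ?y + ?N * Q"
        using Q(1) N1 rho_nonneg[of x] y by (simp add: abs_le_iff)
      also have "\<dots> \<le> 2 * (?y * ?y) + ?N * (?y * ?y)"
      proof (intro add_mono)
        show "2 * rho x * ?y \<le> 2 * (?y * ?y)"
          using rho_nonneg[of x] eps by (simp add: mult_right_mono)
        have "rho x * rho x \<le> ?y * ?y" using rho_nonneg[of x] eps by (intro mult_mono) auto
        with Q(2) show "?N * Q \<le> ?N * (?y * ?y)" by (intro mult_left_mono) auto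
      qed
      also have "\<dots> = (?N + 2) * (?y * ?y)" by (simp add: algebra_simps)
      finally show ?thesis using p0 by (simp add: abs_mult mult_left_mono)
    qed
    also have "\<dots> = 2 * pi\<^sup>2 * (?N + 2) * (?y powr (1/2) * riesz_kernel eps x)"
    proof -
      have "p * (?y * ?y) = ?y powr (1/2) * riesz_kernel eps x"
        using y powr_add[of ?y "- ?N / 2 - 1" 2] powr_add[of ?y "1/2" "(1 - ?N) / 2"]
        by (simp add: p_def riesz_kernel_def power2_eq_square diff_divide_distrib)
      then show ?thesis by (simp add: mult.assoc mult.left_commute)
    qed
    also have "\<dots> \<le> 2 * pi\<^sup>2 * (?N + 2) * ((?N + 1) * riesz_kernel eps x)"
    proof (intro mult_left_mono mult_right_mono)
      \<comment> \<open>The error is smaller than the kernel by a square root of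
        \<open>rho + eps\<close>; this surplus factor is bounded because \<open>rho \<le> N\<close>
        and \<open>eps \<le> 1\<close>.\<close>
      have "?y powr (1/2) \<le> (?N + 1) powr (1/2)"
        using eps y rho_le[of x] by (intro powr_mono2) auto
      also have "\<dots> \<le> (?N + 1) powr 1" using N1 by (intro powr_mono) auto
      finally show "?y powr (1/2) \<le> ?N + 1" using N1 by simp
    qed (use riesz_kernel_pos[OF eps(1), of x] in auto)
    finally show ?thesis by (simp add: C mult.assoc)
  qed
  show ?thesis using G grad lap by blast
qed

text \<open>The value \<^const>\<open>top\<close> at the end points replaces the junk value \<open>0 powr (- a) = 0\<close>, which would not
  dominate.\<close>

lemma powr_singularity_integrable:
  fixes a :: real
  assumes a: "0 \<le> a" "a < 1"
  shows "(\<integral>\<^sup>+t. (if t \<in> {0, 1} then top else ennreal (t powr (- a) + (1 - t) powr (- a))) * indicator {0..1} t \<partial>lborel) < top"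
proof -
  have 1: "(\<integral>\<^sup>+t. ennreal (indicator {0..1} t * t powr (- a)) \<partial>lborel) = ennreal (1 / (1 - a))"
  proof (rule nn_integral_has_integral_lborel)
    have "(\<lambda>t. indicator {0..1} t * t powr (- a)) = (\<lambda>t. if t \<in> {0..1} then t powr (- a) else 0)"
      by (auto simp: indicator_def)
    then show "((\<lambda>t. indicator {0..1} t * t powr (- a)) has_integral 1 / (1 - a)) UNIV"
      using has_integral_powr_from_0[of "- a" 1] a has_integral_restrict_UNIV[of "{0..1}" "\<lambda>t. t powr (- a)"] by simp
  qed auto
  have 2: "(\<integral>\<^sup>+t. ennreal (indicator {0..1} t * (1 - t) powr (- a)) \<partial>lborel) = ennreal (1 / (1 - a))"
  proof -
    have "ennreal (1 / (1 - a)) = (\<integral>\<^sup>+t. ennreal (indicator {0..1} (1 + (- 1) * t) * (1 + (- 1) * t) powr (- a)) \<partial>lborel)"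
      unfolding 1[symmetric] by (subst nn_integral_real_affine[of _ "- 1" 1]) auto
    also have "\<dots> = (\<integral>\<^sup>+t. ennreal (indicator {0..1} t * (1 - t) powr (- a)) \<partial>lborel)"
      by (intro nn_integral_cong) (auto simp: indicator_def)
    finally show ?thesis by simp
  qed
  have "(\<integral>\<^sup>+t. (if t \<in> {0, 1} then top else ennreal (t powr (- a) + (1 - t) powr (- a))) * indicator {0..1} t \<partial>lborel)
    = (\<integral>\<^sup>+t. ennreal (indicator {0..1} t * t powr (- a)) + ennreal (indicator {0..1} t * (1 - t) powr (- a)) \<partial>lborel)"
  proof (rule nn_integral_cong_AE)
    have "AE t in lborel. t \<noteq> 0 \<and> t \<noteq> (1 :: real)"
      using AE_lborel_singleton[of "0 :: real"] AE_lborel_singleton[of "1 :: real"] by auto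
    then show "AE t in lborel. (if t \<in> {0, 1} then top else ennreal (t powr (- a) + (1 - t) powr (- a))) * indicator {0..1} t
      = ennreal (indicator {0..1} t * t powr (- a)) + ennreal (indicator {0..1} t * (1 - t) powr (- a))"
      by eventually_elim (auto simp: indicator_def)
  qed
  also have "\<dots> = ennreal (1 / (1 - a)) + ennreal (1 / (1 - a))"
    by (subst nn_integral_add) (auto simp: 1 2)
  finally show ?thesis by simp
qed

text \<open>Since \<open>rho x\<close> dominates each \<open>(sin (pi x\<^sub>i))\<^sup>2\<close>, the power \<open>- c\<close> is at most a product over the coordinates of
  powers \<open>- 2 c / N > - 1\<close>.\<close>

lemma rho_powr_integral_bound:
  assumes c: "0 \<le> c" "2 * c < real CARD('n::finite)"
  shows "\<exists>K>0. \<forall>eps>0. (\<oint>x :: real ^ 'n. (rho x + eps) powr (- c)) \<le> K"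
proof -
  let ?N = "real CARD('n)"
  have N0: "?N > 0" by simp
  define a where "a = 2 * c / ?N"
  have a: "0 \<le> a" "a < 1" using c N0 by (auto simp: a_def divide_less_eq)
  define h :: "real \<Rightarrow> ennreal" where
    "h t = (if t \<in> {0, 1} then top else ennreal (t powr (- a) + (1 - t) powr (- a))) * indicator {0..1} t" for t
  have [measurable]: "h \<in> borel_measurable borel" unfolding h_def[abs_def] by measurable
  define H where "H = (\<Prod>b\<in>(Basis :: (real ^ 'n) set). \<integral>\<^sup>+t. h t \<partial>lborel)"
  have Hfin: "H < top"
    using powr_singularity_integrable[OF a] unfolding H_def h_def[abs_def]
    by (simp add: power_less_top_ennreal)
  have bound: "(\<oint>x :: real ^ 'n. (rho x + eps) powr (- c)) \<le> enn2real H" if eps: "eps > 0" for eps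
  proof -
    let ?f = "\<lambda>x :: real ^ 'n. (rho x + eps) powr (- c)"
    have tf: "test_function ?f" by (rule test_rho_powr[OF eps])
    then have [measurable]: "?f \<in> borel_measurable borel" by measurable
    have "ennreal (\<oint>x. ?f x) = (\<integral>\<^sup>+x. ennreal (?f x) \<partial>\<T>)"
      using test_integrable[OF tf] by (intro nn_integral_eq_integral[symmetric]) auto
    also have "\<dots> = (\<integral>\<^sup>+x. ennreal (?f x) * indicator (cbox 0 1) x \<partial>lborel)"
      by (rule nn_integral_unit_torus) measurable
    also have "\<dots> \<le> (\<integral>\<^sup>+x. (\<Prod>b\<in>Basis. h (x \<bullet> b)) \<partial>(lborel :: (real ^ 'n) measure))"
    proof (rule nn_integral_mono)
      fix x :: "real ^ 'n"
      let ?y = "rho x + eps"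
      have y: "?y > 0" by (rule rho_add_pos[OF eps])
      show "ennreal (?f x) * indicator (cbox 0 1) x \<le> (\<Prod>b\<in>Basis. h (x \<bullet> b))"
      proof (cases "x \<in> cbox 0 1")
        case True
        have "?f x = (\<Prod>b\<in>(Basis :: (real ^ 'n) set). ?y powr (- c / ?N))"
          using y N0 by (simp add: powr_power)
        then have "ennreal (?f x) = (\<Prod>b\<in>(Basis :: (real ^ 'n) set). ennreal (?y powr (- c / ?N)))"
          by (simp add: ennreal_power)
        also have "\<dots> \<le> (\<Prod>b\<in>Basis. h (x \<bullet> b))"
        proof (rule prod_mono_ennreal)
          fix b :: "real ^ 'n" assume "b \<in> Basis"
          then obtain i where b: "x \<bullet> b = x $ i" by (auto simp: Basis_vec_def inner_axis)
          let ?t = "x $ i"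
          have t: "0 \<le> ?t" "?t \<le> 1" using True by (auto simp: mem_box_cart)
          have "?y powr (- c / ?N) \<le> ?t powr (- a) + (1 - ?t) powr (- a)" if t01: "0 < ?t" "?t < 1"
          proof -
            \<comment> \<open>The distance of the coordinate to the nearest integer. The sine of
              \<open>pi * t\<close> is symmetric about \<open>t = 1/2\<close>, so its lower bound on
              the first half interval suffices.\<close>
            define s where "s = min ?t (1 - ?t)"
            have s: "0 < s" "s \<le> 1/2" using t01 by (auto simp: s_def min_def)
            have "s \<le> sin (pi * s)" using sin_pi_lower[of s] s by simp
            also have "sin (pi * s) = sin (pi * ?t)"
              by (auto simp: s_def min_def right_diff_distrib)
            finally have "s\<^sup>2 \<le> (sin (pi * ?t))\<^sup>2" using s by (intro power_mono) auto
            also have "\<dots> \<le> ?y" using sin_squared_le_rho[of x i] eps by simp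
            finally have "?y powr (- c / ?N) \<le> (s\<^sup>2) powr (- c / ?N)"
              using s c N0 by (intro powr_mono2') (auto simp: divide_nonpos_pos)
            also have "\<dots> = s powr (- a)"
              using s by (simp add: a_def powr_powr flip: powr_numeral)
            also have "\<dots> \<le> ?t powr (- a) + (1 - ?t) powr (- a)"
              by (auto simp: s_def min_def)
            finally show ?thesis .
          qed
          then show "ennreal (?y powr (- c / ?N)) \<le> h (x \<bullet> b)"
            using t by (auto simp: h_def b simp flip: ennreal_plus intro!: ennreal_leI)
        qed
        finally show ?thesis using True by simp
      qed simp
    qed
    also have "\<dots> = H"
      unfolding H_def by (rule nn_integral_lborel_prod) auto
    finally have "ennreal (\<oint>x. ?f x) \<le> H" .
    then have "ennreal (\<oint>x. ?f x) \<le> ennreal (enn2real H)"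
      using Hfin by simp
    then show ?thesis by (subst (asm) ennreal_le_iff) auto
  qed
  show ?thesis
  proof (intro exI[of _ "enn2real H + 1"] conjI allI impI)
    show "enn2real H + 1 > 0" by (rule add_nonneg_pos) auto
    fix eps :: real assume "eps > 0"
    then show "(\<oint>x :: real ^ 'n. (rho x + eps) powr (- c)) \<le> enn2real H + 1"
      using bound by (meson le_add_same_cancel1 order_trans zero_le_one)
  qed
qed

section \<open>The inequalities of Hoelder and Young\<close>

text \<open>The tangent line of the logarithm at the weighted mean S lies above its graph; averaging
  that inequality with the weights gives the claim. Zero weights are allowed, so that the two-factor
  inequality is a special case.\<close>

lemma weighted_am_gm3:
  fixes x y z :: real
  assumes abc: "a \<ge> 0" "b \<ge> 0" "c \<ge> 0" "a + b + c = 1" and xyz: "x > 0" "y > 0" "z > 0"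
  shows "x powr a * y powr b * z powr c \<le> a * x + b * y + c * z"
proof -
  define S where "S = a * x + b * y + c * z"
  have "0 \<le> a * x" "0 \<le> b * y" "0 \<le> c * z" using abc xyz by auto
  moreover have "0 < a * x \<or> 0 < b * y \<or> 0 < c * z"
    using abc xyz by (simp add: zero_less_mult_iff) linarith
  ultimately have S: "S > 0" unfolding S_def by linarith
  have ln_le: "ln t \<le> ln S + (t / S - 1)" if "t > 0" for t
    using ln_le_minus_one[of "t / S"] S that by (simp add: ln_div)
  have "a * ln x + b * ln y + c * ln z \<le> a * (ln S + (x / S - 1)) + b * (ln S + (y / S - 1)) + c * (ln S + (z / S - 1))"
    using abc xyz by (intro add_mono mult_left_mono ln_le) auto
  also have "\<dots> = (a + b + c) * (ln S - 1) + (a * x + b * y + c * z) / S"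
    by (simp add: algebra_simps add_divide_distrib)
  also have "\<dots> = ln S" using S abc by (simp add: S_def[symmetric])
  finally have "exp (a * ln x + b * ln y + c * ln z) \<le> exp (ln S)" by simp
  then show ?thesis using S xyz by (simp add: powr_def exp_add S_def)
qed

text \<open>Each function is divided by its integral, the weighted mean inequality is applied
  pointwise and integrated. If one integral is zero, the product vanishes almost everywhere.\<close>

lemma holder3:
  fixes u v w :: "'a \<Rightarrow> real"
  assumes abc: "a \<ge> 0" "b \<ge> 0" "c \<ge> 0" "a + b + c = 1"
    and int: "integrable M u" "integrable M v" "integrable M w"
    and nonneg: "\<And>x. u x \<ge> 0" "\<And>x. v x \<ge> 0" "\<And>x. w x \<ge> 0"
  shows "(\<integral>x. u x powr a * v x powr b * w x powr c \<partial>M) \<le>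
    (\<integral>x. u x \<partial>M) powr a * (\<integral>x. v x \<partial>M) powr b * (\<integral>x. w x \<partial>M) powr c"
proof -
  have [measurable]: "u \<in> borel_measurable M" "v \<in> borel_measurable M" "w \<in> borel_measurable M"
    using int by auto
  let ?f = "\<lambda>x. u x powr a * v x powr b * w x powr c"
  have pw: "?f x \<le> a * u x + b * v x + c * w x" for x
  proof (cases "u x > 0 \<and> v x > 0 \<and> w x > 0")
    case True
    then show ?thesis using weighted_am_gm3[OF abc] by blast
  next
    case False
    then have "?f x = 0" using nonneg[of x] by (auto simp: not_less order_antisym)
    moreover have "0 \<le> a * u x + b * v x + c * w x" using abc nonneg by simp
    ultimately show ?thesis by linarith
  qed
  have int_f: "integrable M ?f"
  proof (rule Bochner_Integration.integrable_bound)
    show "integrable M (\<lambda>x. a * u x + b * v x + c * w x)" using int by simp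
    show "AE x in M. norm (?f x) \<le> norm (a * u x + b * v x + c * w x)"
      using pw by (intro AE_I2) (auto simp: abs_of_nonneg intro: order_trans[OF _ abs_ge_self])
  qed measurable
  define U V W where "U = (\<integral>x. u x \<partial>M)" and "V = (\<integral>x. v x \<partial>M)" and "W = (\<integral>x. w x \<partial>M)"
  have UVW0: "U \<ge> 0" "V \<ge> 0" "W \<ge> 0" using nonneg by (auto simp: U_def V_def W_def)
  have "(\<integral>x. ?f x \<partial>M) \<le> U powr a * V powr b * W powr c"
  proof (cases "U > 0 \<and> V > 0 \<and> W > 0")
    case True
    let ?D = "U powr a * V powr b * W powr c"
    have "?f x \<le> ?D * (a * (u x / U) + b * (v x / V) + c * (w x / W))" for x
    proof -
      have "(u x / U) powr a * (v x / V) powr b * (w x / W) powr c \<le> a * (u x / U) + b * (v x / V) + c * (w x / W)"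
      proof (cases "u x > 0 \<and> v x > 0 \<and> w x > 0")
        case 1: True
        then show ?thesis using True by (intro weighted_am_gm3[OF abc]) auto
      next
        case False
        then have "(u x / U) powr a * (v x / V) powr b * (w x / W) powr c = 0"
          using nonneg[of x] by (auto simp: not_less order_antisym)
        moreover have "0 \<le> a * (u x / U) + b * (v x / V) + c * (w x / W)" using abc nonneg UVW0 by simp
        ultimately show ?thesis by linarith
      qed
      then have "?D * ((u x / U) powr a * (v x / V) powr b * (w x / W) powr c) \<le> ?D * (a * (u x / U) + b * (v x / V) + c * (w x / W))"
        by (intro mult_left_mono) auto
      moreover have "?D * ((u x / U) powr a * (v x / V) powr b * (w x / W) powr c) = ?f x"
        using True nonneg by (simp add: powr_divide)
      ultimately show ?thesis by simp
    qed
    then have "(\<integral>x. ?f x \<partial>M) \<le> (\<integral>x. ?D * (a * (u x / U) + b * (v x / V) + c * (w x / W)) \<partial>M)"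
      using int int_f by (intro integral_mono) auto
    also have "\<dots> = ?D * (a * (U / U) + b * (V / V) + c * (W / W))"
      using int by (simp add: U_def V_def W_def)
    also have "\<dots> = ?D" using True abc by simp
    finally show ?thesis .
  next
    case False
    \<comment> \<open>Since \<open>0 powr a = 0\<close> even for \<open>a = 0\<close>, a vanishing
      factor annihilates the integrand whatever its weight.\<close>
    then have "U = 0 \<or> V = 0 \<or> W = 0" using UVW0 by linarith
    then have "(AE x in M. u x = 0) \<or> (AE x in M. v x = 0) \<or> (AE x in M. w x = 0)"
      using int nonneg unfolding U_def V_def W_def by (auto simp: integral_nonneg_eq_0_iff_AE)
    then have "AE x in M. ?f x = 0" by (auto elim!: eventually_mono)
    then have "(\<integral>x. ?f x \<partial>M) = 0" by (rule integral_eq_zero_AE)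
    then show ?thesis by simp
  qed
  then show ?thesis by (simp add: U_def V_def W_def)
qed

lemma integral_convol:
  fixes u k :: "real ^ 'n \<Rightarrow> real"
  assumes int: "integrable \<T> u" and k: "test_function k" and k0: "\<And>x. k x \<ge> 0"
  shows "(\<oint>x. convol u k x) = (\<oint>x. u x) * (\<oint>x. k x)"
proof -
  have [measurable]: "u \<in> borel_measurable borel" using borel_measurable_integrable[OF int] by simp
  have [measurable]: "k \<in> borel_measurable borel" using k by measurable
  have per: "periodic k" using k by (simp add: test_function_def)
  have "integrable (\<T> \<Otimes>\<^sub>M \<T>) (\<lambda>(x, y). u y * k (x - y))"
  proof (rule unit_torus_pair.Fubini_integrable)
    show "(\<lambda>(x, y). u y * k (x - y)) \<in> borel_measurable (\<T> \<Otimes>\<^sub>M \<T>)" by measurable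
    have "(\<lambda>x. (\<oint>y. norm (case (x, y) of (x, y) \<Rightarrow> u y * k (x - y)))) = convol (\<lambda>y. \<bar>u y\<bar>) k"
      using k0 by (auto simp: convol_def abs_mult)
    then show "integrable \<T> (\<lambda>x. (\<oint>y. norm (case (x, y) of (x, y) \<Rightarrow> u y * k (x - y))))"
      using test_integrable[OF test_convol[OF integrable_abs[OF int] k]] by simp
    show "AE x in \<T>. integrable \<T> (\<lambda>y. case (x, y) of (x, y) \<Rightarrow> u y * k (x - y))"
      using integrable_convol[OF int k] by simp
  qed
  from unit_torus_pair.Fubini_integral[OF this]
  have "(\<oint>x. convol u k x) = (\<oint>y. (\<oint>x. u y * k (x + (- y))))"
    by (simp add: convol_def)
  also have "\<dots> = (\<oint>y. u y * (\<oint>x. k x))"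
    by (simp only: integral_mult_right_zero integral_unit_torus_translate[OF \<open>k \<in> borel_measurable borel\<close> per])
  finally show ?thesis by simp
qed

lemma integral_reflect_test_function:
  fixes k :: "real ^ 'n \<Rightarrow> real"
  assumes k: "test_function k" and even: "\<And>x. k (- x) = k x"
  shows "(\<oint>y. k (x - y)) = (\<oint>y. k y)"
  using convol_translate[of "\<lambda>_. 1" k x, OF _ _ k even] by (simp add: convol_def periodic_def)

lemma test_powr:
  assumes "test_function k" "\<And>x. k x > 0"
  shows "test_function (\<lambda>x. k x powr a)"
  using assms smooth_powr[of k a] by (auto simp: test_function_def periodic_def)

text \<open>The exponents obey \<open>1 + 1 / \<beta> = 1 / q + 1 / r\<close>. The product of f and
  k is split into the power \<open>1 / \<beta>\<close> of \<open>f powr q * k powr r\<close>, the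
  power \<open>1 - 1 / q\<close> of \<open>k powr r\<close> and the power \<open>\<sigma>\<close> of
  \<open>f powr q\<close>, and Hoelder's inequality is applied in y. After raising to
  \<open>\<beta>\<close>, only the first factor depends on x, and it is itself a
  convolution.\<close>

lemma young_convolution:
  fixes f k :: "real ^ 'n \<Rightarrow> real"
  assumes k: "test_function k" "\<And>x. k x > 0" "\<And>x. k (- x) = k x"
    and f: "integrable \<T> f" "integrable \<T> (\<lambda>x. f x powr q)" "\<And>x. f x \<ge> 0"
    and q: "q \<ge> 1" and \<sigma>: "0 < \<sigma>" "\<sigma> < 1 / q" and r: "r = 1 / (1 - \<sigma>)" and \<beta>: "\<beta> = 1 / (1 / q - \<sigma>)"
  shows "(\<oint>x. convol f k x powr \<beta>) \<le>
    (\<oint>x. k x powr r) powr (\<beta> / r) * (\<oint>x. f x powr q) powr (\<beta> / q)"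
proof -
  define a b where "a = 1 / \<beta>" and "b = 1 - 1 / q"
  have \<beta>0: "\<beta> > 0" using \<sigma> by (simp add: \<beta>)
  have q1: "1 / q \<le> 1" using q by simp
  have \<sigma>1: "\<sigma> < 1" using \<sigma> q1 by linarith
  have a: "a = 1 / q - \<sigma>" by (simp add: a_def \<beta>)
  have abc: "a \<ge> 0" "b \<ge> 0" "\<sigma> \<ge> 0" "a + b + \<sigma> = 1" using \<sigma> q1 by (auto simp: a b_def)
  have r0: "r > 0" using \<sigma>1 by (simp add: r)
  \<comment> \<open>This and the next identity say that the three factors carry total exponent 1 on
    k and on f.\<close>
  have rab: "r * (a + b) = 1" using \<sigma>1 by (simp add: a b_def r)
  have qac: "q * (a + \<sigma>) = 1" using q by (simp add: a)
  define Kr F where "Kr = (\<oint>x. k x powr r)" and "F = (\<oint>x. f x powr q)"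
  have Kr0: "Kr \<ge> 0" and F0: "F \<ge> 0" by (auto simp: Kr_def F_def)
  have kr: "test_function (\<lambda>x. k x powr r)" by (rule test_powr[OF k(1,2)])
  define P where "P x = convol (\<lambda>y. f y powr q) (\<lambda>y. k y powr r) x" for x
  have P0: "P x \<ge> 0" for x by (auto simp: P_def convol_def)
  have pw: "convol f k x \<le> P x powr a * Kr powr b * F powr \<sigma>" for x
  proof -
    have eq: "f y * k (x - y) = (f y powr q * k (x - y) powr r) powr a * (k (x - y) powr r) powr b * (f y powr q) powr \<sigma>" for y
    proof (cases "f y = 0")
      case False
      then have f0: "f y > 0" using f(3)[of y] by simp
      have k0: "k (x - y) > 0" by (rule k(2))
      have "(f y powr q * k (x - y) powr r) powr a * (k (x - y) powr r) powr b * (f y powr q) powr \<sigma>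
        = (f y powr (q * a) * f y powr (q * \<sigma>)) * (k (x - y) powr (r * a) * k (x - y) powr (r * b))"
        by (simp add: powr_mult powr_powr)
      also have "\<dots> = f y powr (q * (a + \<sigma>)) * k (x - y) powr (r * (a + b))"
        by (simp add: powr_add distrib_left)
      finally show ?thesis using f0 k0 by (simp add: rab qac)
    qed simp
    have "convol f k x = (\<oint>y. (f y powr q * k (x - y) powr r) powr a * (k (x - y) powr r) powr b * (f y powr q) powr \<sigma>)"
      unfolding convol_def by (intro Bochner_Integration.integral_cong refl eq)
    also have "\<dots> \<le> (\<oint>y. f y powr q * k (x - y) powr r) powr a
        * (\<oint>y. k (x - y) powr r) powr b * (\<oint>y. f y powr q) powr \<sigma>"
      using test_integrable[OF test_reflect[OF kr, of x]] integrable_convol[OF f(2) kr] f(2)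
      by (intro holder3 abc) auto
    also have "(\<oint>y. k (x - y) powr r) = Kr"
      using integral_reflect_test_function[OF kr, of x] k(3) by (simp add: Kr_def)
    finally show ?thesis by (simp add: P_def convol_def F_def)
  qed
  have conv0: "convol f k x \<ge> 0" for x
    using f(3) k(2) by (auto simp: convol_def less_imp_le intro!: integral_nonneg)
  have "(\<oint>x. convol f k x powr \<beta>) \<le> (\<oint>x. P x * (Kr powr (b * \<beta>) * F powr (\<sigma> * \<beta>)))"
  proof (rule integral_mono)
    show "integrable \<T> (\<lambda>x. P x * (Kr powr (b * \<beta>) * F powr (\<sigma> * \<beta>)))"
      unfolding P_def using test_integrable[OF test_convol[OF f(2) kr]] by simp
    have tc: "test_function (convol f k)" by (rule test_convol[OF f(1) k(1)])
    then obtain C where C: "C \<ge> 0" "\<And>x. \<bar>convol f k x\<bar> \<le> C" using test_bounded by blast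
    have [measurable]: "convol f k \<in> borel_measurable borel" using tc by measurable
    show "integrable \<T> (\<lambda>x. convol f k x powr \<beta>)"
    proof (rule unit_torus.integrable_const_bound[where B = "C powr \<beta>"])
      show "AE x in \<T>. norm (convol f k x powr \<beta>) \<le> C powr \<beta>"
        using C conv0 \<beta>0 by (intro AE_I2) (auto intro!: powr_mono2 simp: abs_of_nonneg)
    qed measurable
    fix x
    have "convol f k x powr \<beta> \<le> (P x powr a * Kr powr b * F powr \<sigma>) powr \<beta>"
      using pw conv0 \<beta>0 by (intro powr_mono2) auto
    also have "\<dots> = P x powr (a * \<beta>) * (Kr powr (b * \<beta>) * F powr (\<sigma> * \<beta>))"
      by (simp add: powr_mult powr_powr)
    also have "a * \<beta> = 1" using \<beta>0 by (simp add: a_def)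
    finally show "convol f k x powr \<beta> \<le> P x * (Kr powr (b * \<beta>) * F powr (\<sigma> * \<beta>))"
      using P0[of x] by simp
  qed
  also have "\<dots> = (F * Kr) * (Kr powr (b * \<beta>) * F powr (\<sigma> * \<beta>))"
    unfolding P_def using integral_convol[OF f(2) kr] by (simp add: F_def Kr_def)
  also have "\<dots> = (Kr * Kr powr (b * \<beta>)) * (F * F powr (\<sigma> * \<beta>))" by simp
  also have "Kr * Kr powr (b * \<beta>) = Kr powr (1 + b * \<beta>)" using Kr0 by (simp add: powr_mult_base)
  also have "F * F powr (\<sigma> * \<beta>) = F powr (1 + \<sigma> * \<beta>)" using F0 by (simp add: powr_mult_base)
  also have "1 + b * \<beta> = \<beta> / r"
    using \<beta>0 r0 rab by (simp add: a_def field_simps)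
  also have "1 + \<sigma> * \<beta> = \<beta> / q"
    using \<beta>0 q qac by (simp add: a_def field_simps)
  finally show ?thesis by (simp add: Kr_def F_def)
qed

section \<open>Gain of integrability\<close>

text \<open>The very weak form, with the Laplacian on the test function, so that only integrability
  of m enters. The bound K serves qualitative purposes: the constants of the estimates below are
  chosen before A, m and K.\<close>

locale bounded_drift_solution =
  fixes A :: "real ^ 'n \<Rightarrow> real ^ 'n" and m :: "real ^ 'n \<Rightarrow> real" and K :: real
  assumes measurable_m [measurable]: "m \<in> borel_measurable borel"
    and measurable_A [measurable]: "A \<in> borel_measurable borel"
    and periodic_m: "periodic m"
    and integrable_m: "integrable \<T> m"
    and norm_A_le: "\<And>x. norm (A x) \<le> K"
    and distributional_equation: "\<And>\<phi>. test_function \<phi> \<Longrightarrow>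
      (\<oint>x. m x * ((\<Sum>i\<in>UNIV. partial i (partial i \<phi>) x) + A x \<bullet> grad \<phi> x)) = 0"
begin

text \<open>In the test with the Green function, the summand 1 covers the error of its Laplacian and
  \<open>norm (A x)\<close> the drift. The absolute value is there because the sign of m is not yet
  known.\<close>

definition flux :: "real ^ 'n \<Rightarrow> real" where
  "flux x = (1 + norm (A x)) * \<bar>m x\<bar>"

lemma measurable_flux [measurable]: "flux \<in> borel_measurable borel"
  unfolding flux_def[abs_def] by measurable

lemma flux_nonneg: "flux x \<ge> 0"
  by (simp add: flux_def)

lemma K_nonneg: "K \<ge> 0"
  using norm_A_le[of 0] norm_ge_zero order_trans by blast

lemma flux_le: "flux x \<le> (1 + K) * \<bar>m x\<bar>"
  unfolding flux_def using norm_A_le by (intro mult_right_mono) auto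

lemma integrable_flux_powr:
  assumes "integrable \<T> (\<lambda>x. \<bar>m x\<bar> powr q)" "q \<ge> 0"
  shows "integrable \<T> (\<lambda>x. flux x powr q)"
proof (rule Bochner_Integration.integrable_bound)
  show "integrable \<T> (\<lambda>x. (1 + K) powr q * \<bar>m x\<bar> powr q)" using assms by simp
  have "flux x powr q \<le> (1 + K) powr q * \<bar>m x\<bar> powr q" for x
    using powr_mono2[OF assms(2) flux_nonneg flux_le[of x]] K_nonneg by (simp add: powr_mult)
  then show "AE x in \<T>. norm (flux x powr q) \<le> norm ((1 + K) powr q * \<bar>m x\<bar> powr q)"
    by simp
qed measurable

lemma integrable_flux: "integrable \<T> flux"
  using integrable_flux_powr[of 1] integrable_m flux_nonneg by simp

lemma integrable_drift_component: "integrable \<T> (\<lambda>x. m x * A x $ i)"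
  using component_le_norm_cart norm_A_le
  by (intro integrable_mult_bounded[OF integrable_m, where C = K]) (auto intro: order_trans)

lemma inner_grad: "A x \<bullet> grad \<phi> x = (\<Sum>i\<in>UNIV. A x $ i * partial i \<phi> x)"
  by (simp add: inner_vec_def grad_def)

lemma integrable_drift_grad:
  assumes "test_function \<phi>"
  shows "integrable \<T> (\<lambda>x. m x * (A x \<bullet> grad \<phi> x))"
proof -
  have "integrable \<T> (\<lambda>x. \<Sum>i\<in>UNIV. (m x * A x $ i) * partial i \<phi> x)"
    by (intro Bochner_Integration.integrable_sum integrable_mult_test_function integrable_drift_component
        test_partial assms)
  then show ?thesis by (simp add: inner_grad sum_distrib_left mult.assoc)
qed

end

lemma partial_partial_reflect:
  fixes f :: "real ^ 'n \<Rightarrow> real"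
  assumes "test_function f"
  shows "partial j (partial i (\<lambda>y. f (a - y))) = (\<lambda>y. partial j (partial i f) (a - y))"
proof -
  have d: "partial i f differentiable_on UNIV"
    by (intro test_differentiable test_partial assms)
  have "partial j (\<lambda>y. - 1 * partial i f (a - y)) = (\<lambda>y. partial j (partial i f) (a - y))"
    using partial_mult[of "\<lambda>y. - 1" "\<lambda>y. partial i f (a - y)" j]
    by (simp add: differentiable_reflect[OF d] partial_reflect[OF d] partial_const)
  then show ?thesis by (simp add: partial_reflect[OF test_differentiable[OF assms]])
qed

text \<open>The numerator is the constant of the Green function estimate times N, the number of
  components of the gradient; the denominator is the coefficient of the bump times the lower bound
  of its mass.\<close>

definition mollified_constant :: "'n itself \<Rightarrow> real" where
  "mollified_constant _ = 2 * pi\<^sup>2 * (real CARD('n) + 2) * (real CARD('n) + 1) * real CARD('n) /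
     (2 * pi\<^sup>2 * real CARD('n) * bump_mass_bound TYPE('n))"

lemma mollified_constant_pos: "mollified_constant TYPE('n::finite) > 0"
proof -
  have "real CARD('n) > 0" by simp
  then show ?thesis using bump_mass_bound_pos[where 'n = 'n] by (simp add: mollified_constant_def)
qed

context bounded_drift_solution
begin

text \<open>Testing the equation with the regularised Green function of pole \<open>x\<close>.\<close>

lemma mollified_le_convol_flux:
  assumes eps: "0 < eps" "eps \<le> 1"
  shows "\<bar>convol m (mollifier eps) x\<bar> \<le> mollified_constant TYPE('n) * convol flux (riesz_kernel eps) x"
proof -
  let ?N = "real CARD('n)" and ?k = "riesz_kernel eps :: real ^ 'n \<Rightarrow> real"
  let ?a = "2 * pi\<^sup>2 * ?N"
  define C where "C = 2 * pi\<^sup>2 * (?N + 2) * (?N + 1)"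
  have C0: "C \<ge> 0" by (simp add: C_def)
  have N1: "?N \<ge> 1" by (simp add: Suc_leI)
  obtain G :: "real ^ 'n \<Rightarrow> real" where G: "test_function G"
    and grad_G: "\<And>i z. \<bar>partial i G z\<bar> \<le> C * ?k z"
    and lap_G: "\<And>z. \<bar>(\<Sum>i\<in>UNIV. partial i (partial i G) z) + ?a * bump eps z\<bar> \<le> C * ?k z"
    using regularised_green_function[OF eps C_def] by blast
  define \<phi> where "\<phi> y = G (x - y)" for y
  have \<phi>: "test_function \<phi>" unfolding \<phi>_def[abs_def] by (rule test_reflect[OF G])
  have p\<phi>: "partial i \<phi> y = - partial i G (x - y)" for i y
    unfolding \<phi>_def[abs_def] by (simp add: partial_reflect[OF test_differentiable[OF G]])
  have pp\<phi>: "partial i (partial i \<phi>) y = partial i (partial i G) (x - y)" for i y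
    unfolding \<phi>_def[abs_def] by (simp add: partial_partial_reflect[OF G])
  \<comment> \<open>By the equation \<open>g2\<close> has integral zero. Adding it to
    \<open>g1\<close> turns the bump into the error of the Laplacian, which the kernel
    bounds.\<close>
  define g1 g2 where "g1 y = ?a * (m y * bump eps (x - y))"
    and "g2 y = m y * ((\<Sum>i\<in>UNIV. partial i (partial i \<phi>) y) + A y \<bullet> grad \<phi> y)" for y
  have i1: "integrable \<T> g1"
    unfolding g1_def by (intro integrable_mult_right integrable_convol integrable_m test_bump eps)
  have "integrable \<T> (\<lambda>y. m y * (\<Sum>i\<in>UNIV. partial i (partial i \<phi>) y))"
    unfolding sum_distrib_left
    by (intro Bochner_Integration.integrable_sum integrable_mult_test_function integrable_m test_partial \<phi>)
  then have i2: "integrable \<T> g2"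
    unfolding g2_def distrib_left by (intro Bochner_Integration.integrable_add integrable_drift_grad \<phi>)
  have ik: "integrable \<T> (\<lambda>y. flux y * ?k (x - y))"
    by (intro integrable_convol integrable_flux test_riesz_kernel eps)
  have pw: "\<bar>g1 y + g2 y\<bar> \<le> C * ?N * (flux y * ?k (x - y))" for y
  proof -
    have k0: "?k (x - y) \<ge> 0" using riesz_kernel_pos[OF eps(1), of "x - y"] by simp
    have "\<bar>A y \<bullet> grad \<phi> y\<bar> \<le> (\<Sum>i\<in>(UNIV :: 'n set). C * ?k (x - y)) * norm (A y)"
      using sum_component_bound[of "\<lambda>i. partial i \<phi> y" "\<lambda>i. C * ?k (x - y)" "A y"] grad_G
      by (simp add: p\<phi> inner_grad)
    then have 1: "\<bar>A y \<bullet> grad \<phi> y\<bar> \<le> C * ?k (x - y) * ?N * norm (A y)" by (simp add: mult_ac)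
    have "g1 y + g2 y = m y * (((\<Sum>i\<in>UNIV. partial i (partial i G) (x - y)) + ?a * bump eps (x - y)) + A y \<bullet> grad \<phi> y)"
      by (simp add: g1_def g2_def pp\<phi> algebra_simps)
    also have "\<bar>\<dots>\<bar> \<le> \<bar>m y\<bar> * (C * ?k (x - y) * ?N + C * ?k (x - y) * ?N * norm (A y))"
    proof -
      have "C * ?k (x - y) * 1 \<le> C * ?k (x - y) * ?N" using N1 C0 k0 by (intro mult_left_mono) auto
      then have "\<bar>((\<Sum>i\<in>UNIV. partial i (partial i G) (x - y)) + ?a * bump eps (x - y)) + A y \<bullet> grad \<phi> y\<bar>
          \<le> C * ?k (x - y) * ?N + C * ?k (x - y) * ?N * norm (A y)"
        using lap_G[of "x - y"] 1 by linarith
      then show ?thesis unfolding abs_mult by (intro mult_left_mono) auto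
    qed
    also have "\<dots> = C * ?N * (flux y * ?k (x - y))" by (simp add: flux_def algebra_simps)
    finally show ?thesis .
  qed
  have "\<bar>\<oint>y. g1 y\<bar> = \<bar>\<oint>y. g1 y + g2 y\<bar>"
  proof -
    have "(\<oint>y. g2 y) = 0" unfolding g2_def by (rule distributional_equation[OF \<phi>])
    then show ?thesis using i1 i2 by simp
  qed
  also have "\<dots> \<le> (\<oint>y. \<bar>g1 y + g2 y\<bar>)" by (rule integral_abs_bound)
  also have "\<dots> \<le> (\<oint>y. C * ?N * (flux y * ?k (x - y)))"
    using i1 i2 ik pw by (intro integral_mono) auto
  also have "\<dots> = C * ?N * convol flux ?k x" by (simp add: convol_def)
  finally have main: "?a * \<bar>\<oint>y. m y * bump eps (x - y)\<bar> \<le> C * ?N * convol flux ?k x"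
    by (simp add: g1_def abs_mult)
  let ?b = "bump_mass_bound TYPE('n)" and ?M = "(\<oint>x :: real ^ 'n. bump eps x)"
  have b: "0 < ?b" "?b \<le> ?M" using bump_mass_bound_pos bump_mass_ge[OF eps] by auto
  have a0: "?a > 0" using N1 by simp
  have "convol m (mollifier eps) x = (\<oint>y. m y * bump eps (x - y)) / ?M"
    by (simp add: convol_def mollifier_def)
  then have "\<bar>convol m (mollifier eps) x\<bar> = \<bar>\<oint>y. m y * bump eps (x - y)\<bar> / ?M"
    using b by simp
  \<comment> \<open>Replacing the mass of the bump by its uniform lower bound removes the dependence
    of the constant on \<open>eps\<close>.\<close>
  also have "\<dots> \<le> \<bar>\<oint>y. m y * bump eps (x - y)\<bar> / ?b"
    using b by (intro divide_left_mono) auto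
  also have "\<dots> \<le> (C * ?N * convol flux ?k x / ?a) / ?b"
    using main a0 b by (intro divide_right_mono) (simp_all add: pos_le_divide_eq mult.commute)
  also have "\<dots> = mollified_constant TYPE('n) * convol flux ?k x"
    by (simp add: mollified_constant_def C_def)
  finally show ?thesis .
qed

end

lemma mollified_AE_subseq:
  fixes u :: "real ^ 'n \<Rightarrow> real"
  assumes "u \<in> borel_measurable borel" "periodic u" and int: "integrable \<T> u"
    and eps: "\<And>j. 0 < eps j" "\<And>j. eps j \<le> 1" "eps \<longlonglongrightarrow> 0"
  shows "\<exists>s. strict_mono s \<and> (AE x in \<T>. (\<lambda>j. convol u (mollifier (eps (s j))) x) \<longlonglongrightarrow> u x)"
proof -
  have "\<exists>s. strict_mono s \<and> (AE x in \<T>. (\<lambda>j. convol u (mollifier (eps (s j))) x - u x) \<longlonglongrightarrow> 0)"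
    using mollifier_L1_convergence[OF assms]
      test_integrable[OF test_convol[OF int test_mollifier[OF eps(1,2)]]] int
    by (intro tendsto_L1_AE_subseq[of \<T> "\<lambda>j x. convol u (mollifier (eps j)) x - u x"]) auto
  then show ?thesis by (simp add: LIM_zero_iff)
qed

text \<open>Young's inequality bounds the mollifications of m uniformly in \<open>eps\<close>, and
  Fatou's lemma passes to m along an almost everywhere convergent subsequence. The constant depends
  only on the exponents and the dimension, which the order of the quantifiers records.\<close>

lemma integrability_gain:
  fixes q \<sigma> \<beta> :: real
  assumes q: "q \<ge> 1" and \<sigma>: "0 < \<sigma>" "\<sigma> < 1 / q" "\<sigma> < 1 / real CARD('n::finite)"
    and \<beta>: "\<beta> = 1 / (1 / q - \<sigma>)"
  shows "\<exists>C>0. \<forall>A (m :: real ^ 'n \<Rightarrow> real) K. bounded_drift_solution A m K \<longrightarrow>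
    integrable \<T> (\<lambda>x. \<bar>m x\<bar> powr q) \<longrightarrow>
    integrable \<T> (\<lambda>x. \<bar>m x\<bar> powr \<beta>) \<and>
    (\<oint>x. \<bar>m x\<bar> powr \<beta>) \<le> C * (\<oint>x. bounded_drift_solution.flux A m x powr q) powr (\<beta> / q)"
proof -
  let ?N = "real CARD('n)" and ?D = "mollified_constant TYPE('n)"
  have N1: "?N \<ge> 1" by (simp add: Suc_leI)
  have \<sigma>1: "\<sigma> < 1" using \<sigma>(2) q by (smt (verit) divide_le_eq_1)
  have \<beta>0: "\<beta> > 0" using \<sigma> by (simp add: \<beta>)
  define r where "r = 1 / (1 - \<sigma>)"
  have r0: "r > 0" using \<sigma>1 by (simp add: r_def)
  \<comment> \<open>The r-th power of the kernel is the power \<open>- c\<close> of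
    \<open>rho + eps\<close>; its integrals are bounded when \<open>2 * c < N\<close>, which is the
    condition \<open>\<sigma> * N < 1\<close>.\<close>
  define c where "c = r * (?N - 1) / 2"
  have c: "0 \<le> c" "2 * c < ?N"
  proof -
    show "0 \<le> c" using r0 N1 by (simp add: c_def)
    have "\<sigma> * ?N < 1" using \<sigma>(3) N1 by (simp add: field_simps)
    then have "?N - 1 < ?N * (1 - \<sigma>)" by (simp add: algebra_simps)
    then show "2 * c < ?N" using \<sigma>1 by (simp add: c_def r_def field_simps)
  qed
  obtain K0 where K0: "K0 > 0" "\<And>eps. eps > 0 \<Longrightarrow> (\<oint>x :: real ^ 'n. (rho x + eps) powr (- c)) \<le> K0"
    using rho_powr_integral_bound[OF c] by blast
  define C where "C = ?D powr \<beta> * K0 powr (\<beta> / r)"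
  have C0: "C > 0" using K0 mollified_constant_pos[where 'n = 'n] by (simp add: C_def)
  have main: "integrable \<T> (\<lambda>x. \<bar>m x\<bar> powr \<beta>) \<and>
    (\<oint>x. \<bar>m x\<bar> powr \<beta>) \<le> C * (\<oint>x. bounded_drift_solution.flux A m x powr q) powr (\<beta> / q)"
    if sol: "bounded_drift_solution A m K" and intq: "integrable \<T> (\<lambda>x. \<bar>m x\<bar> powr q)"
    for A and m :: "real ^ 'n \<Rightarrow> real" and K
  proof -
    interpret bounded_drift_solution A m K by (rule sol)
    define B where "B = C * (\<oint>x. flux x powr q) powr (\<beta> / q)"
    have B0: "B \<ge> 0" using C0 by (simp add: B_def)
    have intf: "integrable \<T> (\<lambda>x. flux x powr q)" using intq q by (intro integrable_flux_powr) auto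
    have bound: "(\<integral>\<^sup>+x. ennreal (\<bar>convol m (mollifier eps) x\<bar> powr \<beta>) \<partial>\<T>) \<le> ennreal B"
      if eps: "0 < eps" "eps \<le> 1" for eps
    proof -
      let ?k = "riesz_kernel eps :: real ^ 'n \<Rightarrow> real"
      have k: "test_function ?k" "\<And>x. ?k x > 0" "\<And>x. ?k (- x) = ?k x"
        using test_riesz_kernel[OF eps(1)] riesz_kernel_pos[OF eps(1)]
        by (auto simp: riesz_kernel_def rho_even)
      have tf: "test_function (convol flux ?k)" by (rule test_convol[OF integrable_flux k(1)])
      have conv0: "convol flux ?k x \<ge> 0" for x
        using flux_nonneg k(2) by (auto simp: convol_def less_imp_le intro!: integral_nonneg)
      obtain E where E: "E \<ge> 0" "\<And>x. \<bar>convol flux ?k x\<bar> \<le> E" using test_bounded[OF tf] by blast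
      have [measurable]: "convol flux ?k \<in> borel_measurable borel" using tf by measurable
      have int1: "integrable \<T> (\<lambda>x. convol flux ?k x powr \<beta>)"
      proof (rule unit_torus.integrable_const_bound[where B = "E powr \<beta>"])
        show "AE x in \<T>. norm (convol flux ?k x powr \<beta>) \<le> E powr \<beta>"
          using E conv0 \<beta>0 by (intro AE_I2) (auto intro!: powr_mono2 simp: abs_of_nonneg)
      qed measurable
      have "(\<integral>\<^sup>+x. ennreal (\<bar>convol m (mollifier eps) x\<bar> powr \<beta>) \<partial>\<T>) \<le>
        (\<integral>\<^sup>+x. ennreal (?D powr \<beta> * convol flux ?k x powr \<beta>) \<partial>\<T>)"
      proof (intro nn_integral_mono ennreal_leI)
        fix x
        have "\<bar>convol m (mollifier eps) x\<bar> powr \<beta> \<le> (?D * convol flux ?k x) powr \<beta>"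
          using mollified_le_convol_flux[OF eps] \<beta>0 by (intro powr_mono2) auto
        then show "\<bar>convol m (mollifier eps) x\<bar> powr \<beta> \<le> ?D powr \<beta> * convol flux ?k x powr \<beta>"
          by (simp add: powr_mult)
      qed
      also have "\<dots> = ennreal (?D powr \<beta> * (\<oint>x. convol flux ?k x powr \<beta>))"
        using int1 by (subst nn_integral_eq_integral) auto
      also have "\<dots> \<le> ennreal B"
      proof (rule ennreal_leI)
        have "?k x powr r = (rho x + eps) powr (- c)" for x
          by (simp add: riesz_kernel_def powr_powr c_def algebra_simps diff_divide_distrib)
        then have "(\<oint>x. ?k x powr r) \<le> K0" using K0(2)[OF eps(1)] by simp
        then have "(\<oint>x. ?k x powr r) powr (\<beta> / r) \<le> K0 powr (\<beta> / r)"
          using \<beta>0 r0 by (intro powr_mono2) auto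
        then have "(\<oint>x. ?k x powr r) powr (\<beta> / r) * (\<oint>x. flux x powr q) powr (\<beta> / q)
          \<le> K0 powr (\<beta> / r) * (\<oint>x. flux x powr q) powr (\<beta> / q)"
          by (intro mult_right_mono) auto
        with young_convolution[OF k integrable_flux intf flux_nonneg q \<sigma>(1,2) r_def \<beta>]
        have "(\<oint>x. convol flux ?k x powr \<beta>) \<le> K0 powr (\<beta> / r) * (\<oint>x. flux x powr q) powr (\<beta> / q)"
          by linarith
        then show "?D powr \<beta> * (\<oint>x. convol flux ?k x powr \<beta>) \<le> B"
          unfolding B_def C_def mult.assoc by (intro mult_left_mono) auto
      qed
      finally show ?thesis .
    qed
    define eps where "eps j = 1 / real (Suc j)" for j
    have eps: "\<And>j. 0 < eps j" "\<And>j. eps j \<le> 1" "eps \<longlonglongrightarrow> 0"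
      unfolding eps_def using LIMSEQ_Suc[OF lim_1_over_n] by (auto simp: divide_simps)
    obtain s where s: "strict_mono s" "AE x in \<T>. (\<lambda>j. convol m (mollifier (eps (s j))) x) \<longlonglongrightarrow> m x"
      using mollified_AE_subseq[OF measurable_m periodic_m integrable_m eps] by blast
    let ?u = "\<lambda>j x. ennreal (\<bar>convol m (mollifier (eps (s j))) x\<bar> powr \<beta>)"
    have [measurable]: "convol m (mollifier (eps j)) \<in> borel_measurable borel" for j
      using test_convol[OF integrable_m test_mollifier[OF eps(1,2)]] by measurable
    \<comment> \<open>Writing the limit as a lower limit lets Fatou's lemma deliver the finiteness
      of the integral together with its bound.\<close>
    have "(\<integral>\<^sup>+x. ennreal (\<bar>m x\<bar> powr \<beta>) \<partial>\<T>) = (\<integral>\<^sup>+x. liminf (\<lambda>j. ?u j x) \<partial>\<T>)"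
    proof (rule nn_integral_cong_AE)
      show "AE x in \<T>. ennreal (\<bar>m x\<bar> powr \<beta>) = liminf (\<lambda>j. ?u j x)"
        using s(2)
      proof eventually_elim
        case (elim x)
        then have "(\<lambda>j. ?u j x) \<longlonglongrightarrow> ennreal (\<bar>m x\<bar> powr \<beta>)"
          using \<beta>0 by (intro tendsto_ennrealI tendsto_powr' tendsto_rabs tendsto_const) auto
        then show ?case by (intro lim_imp_Liminf[symmetric]) auto
      qed
    qed
    also have "\<dots> \<le> liminf (\<lambda>j. \<integral>\<^sup>+x. ?u j x \<partial>\<T>)"
      by (rule nn_integral_liminf) measurable
    also have "\<dots> \<le> liminf (\<lambda>j. ennreal B)"
      by (intro Liminf_mono always_eventually allI bound eps)
    also have "\<dots> = ennreal B" by (simp add: Liminf_const)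
    finally have le: "(\<integral>\<^sup>+x. ennreal (\<bar>m x\<bar> powr \<beta>) \<partial>\<T>) \<le> ennreal B" .
    have int: "integrable \<T> (\<lambda>x. \<bar>m x\<bar> powr \<beta>)"
      using le by (intro integrableI_bounded) (auto intro: le_less_trans)
    then have "ennreal (\<oint>x. \<bar>m x\<bar> powr \<beta>) \<le> ennreal B"
      using le by (subst (asm) nn_integral_eq_integral) auto
    then show ?thesis using int B0 by (simp add: B_def)
  qed
  then show ?thesis using C0 by blast
qed

context bounded_drift_solution
begin

text \<open>The reciprocal exponent descends from 1 to \<open>1 / p\<close> in n equal steps of
  length \<open>\<sigma>\<close>, each of them one application of the gain.\<close>

lemma integrable_powr:
  assumes p: "p \<ge> 1"
  shows "integrable \<T> (\<lambda>x. \<bar>m x\<bar> powr p)"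
proof (cases "p = 1")
  case True
  then show ?thesis using integrable_m by simp
next
  case False
  let ?N = "real CARD('n)"
  have N1: "?N \<ge> 1" by (simp add: Suc_leI)
  \<comment> \<open>One step more than the dimension keeps the step length strictly below
    \<open>1 / N\<close>.\<close>
  define n where "n = Suc CARD('n)"
  have n0: "real n > 0" by (simp add: n_def)
  define \<sigma> where "\<sigma> = (1 - 1 / p) / real n"
  have n\<sigma>: "real n * \<sigma> = 1 - 1 / p" using n0 by (simp add: \<sigma>_def)
  have \<sigma>0: "\<sigma> > 0" using p False n0 by (simp add: \<sigma>_def)
  have "\<sigma> \<le> 1 / real n" unfolding \<sigma>_def using p by (intro divide_right_mono) auto
  also have "\<dots> < 1 / ?N" unfolding n_def using N1 by (intro divide_strict_left_mono) auto
  finally have \<sigma>N: "\<sigma> < 1 / ?N" .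
  have "integrable \<T> (\<lambda>x. \<bar>m x\<bar> powr (1 / (1 - real j * \<sigma>)))" if "j \<le> n" for j
    using that
  proof (induction j)
    case 0
    then show ?case using integrable_m by simp
  next
    case (Suc j)
    define q where "q = 1 / (1 - real j * \<sigma>)"
    have "real (Suc j) * \<sigma> \<le> real n * \<sigma>" using Suc.prems \<sigma>0 by (intro mult_right_mono) auto
    then have le: "real j * \<sigma> + \<sigma> \<le> 1 - 1 / p" by (simp add: n\<sigma> distrib_right)
    have p0: "1 / p > 0" using p by simp
    have iq: "1 / q = 1 - real j * \<sigma>" by (simp add: q_def)
    have "real j * \<sigma> < 1" using le p0 \<sigma>0 by linarith
    then have q1: "q \<ge> 1" unfolding q_def using \<sigma>0 by (subst le_divide_eq_1_pos) auto
    have \<sigma>q: "\<sigma> < 1 / q" using le p0 iq by linarith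
    have "integrable \<T> (\<lambda>x. \<bar>m x\<bar> powr q)" using Suc by (simp add: q_def)
    then have "integrable \<T> (\<lambda>x. \<bar>m x\<bar> powr (1 / (1 / q - \<sigma>)))"
      using integrability_gain[OF q1 \<sigma>0 \<sigma>q \<sigma>N refl] bounded_drift_solution_axioms by blast
    moreover have "1 / q - \<sigma> = 1 - real (Suc j) * \<sigma>" by (simp add: iq algebra_simps)
    ultimately show ?case by simp
  qed
  from this[of n] show ?thesis using p by (simp add: n\<sigma>)
qed

end

section \<open>Positivity\<close>

text \<open>Jensen's inequality for the probability density \<open>f (x - y)\<close>, obtained from
  the nonnegativity of the variance of u under it.\<close>

lemma convol_squared_le:
  fixes u f :: "real ^ 'n \<Rightarrow> real"
  assumes u: "integrable \<T> u" "integrable \<T> (\<lambda>x. (u x)\<^sup>2)"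
    and f: "test_function f" "\<And>x. f x \<ge> 0" "\<And>x. f (- x) = f x" "(\<oint>x. f x) = 1"
  shows "(convol u f x)\<^sup>2 \<le> convol (\<lambda>y. (u y)\<^sup>2) f x"
proof -
  define c where "c = convol u f x"
  have f1: "(\<oint>y. f (x - y)) = 1"
    using integral_reflect_test_function[OF f(1,3)] f(4) by simp
  note i1 = integrable_convol[OF u(1) f(1), of x] and i2 = integrable_convol[OF u(2) f(1), of x]
    and i3 = test_integrable[OF test_reflect[OF f(1), of x]]
  have "0 \<le> (\<oint>y. (u y - c)\<^sup>2 * f (x - y))"
    by (intro Bochner_Integration.integral_nonneg mult_nonneg_nonneg f(2)) auto
  also have "\<dots> = (\<oint>y. (u y)\<^sup>2 * f (x - y) - 2 * c * (u y * f (x - y)) + c\<^sup>2 * f (x - y))"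
    by (intro Bochner_Integration.integral_cong) (auto simp: power2_diff algebra_simps)
  also have "\<dots> = convol (\<lambda>y. (u y)\<^sup>2) f x - 2 * c * c + c\<^sup>2 * 1"
    using i1 i2 i3 f1 by (simp add: convol_def c_def)
  finally show ?thesis by (simp add: c_def power2_eq_square)
qed

text \<open>The three-factor inequality with weights 1/2, 1/2 and 0; total mass one makes the idle
  constant factor integrable with integral 1.\<close>

lemma cauchy_schwarz_integral:
  fixes f g :: "'a \<Rightarrow> real"
  assumes "prob_space M" and int: "integrable M (\<lambda>x. (f x)\<^sup>2)" "integrable M (\<lambda>x. (g x)\<^sup>2)"
  shows "(\<integral>x. f x * g x \<partial>M)\<^sup>2 \<le> (\<integral>x. (f x)\<^sup>2 \<partial>M) * (\<integral>x. (g x)\<^sup>2 \<partial>M)"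
proof -
  interpret prob_space M by fact
  have "\<bar>\<integral>x. f x * g x \<partial>M\<bar> \<le> (\<integral>x. \<bar>f x * g x\<bar> \<partial>M)" by (rule integral_abs_bound)
  also have "\<dots> = (\<integral>x. (f x)\<^sup>2 powr (1/2) * (g x)\<^sup>2 powr (1/2) * 1 powr 0 \<partial>M)"
    by (simp add: powr_half_sqrt abs_mult)
  also have "\<dots> \<le> (\<integral>x. (f x)\<^sup>2 \<partial>M) powr (1/2) * (\<integral>x. (g x)\<^sup>2 \<partial>M) powr (1/2) * (\<integral>x. 1 \<partial>M) powr 0"
    using int by (intro holder3) auto
  also have "\<dots> = sqrt ((\<integral>x. (f x)\<^sup>2 \<partial>M) * (\<integral>x. (g x)\<^sup>2 \<partial>M))"
    by (simp add: powr_half_sqrt real_sqrt_mult prob_space)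
  finally have "\<bar>\<integral>x. f x * g x \<partial>M\<bar>\<^sup>2 \<le> (sqrt ((\<integral>x. (f x)\<^sup>2 \<partial>M) * (\<integral>x. (g x)\<^sup>2 \<partial>M)))\<^sup>2"
    by (intro power_mono) auto
  then show ?thesis by simp
qed

lemma square_add_pos: "e > 0 \<Longrightarrow> e\<^sup>2 + (t :: real)\<^sup>2 > 0" for e :: real
  by (simp add: add_pos_nonneg)

lemma smooth_power2_add: "smooth f \<Longrightarrow> smooth (\<lambda>x. c + (f x)\<^sup>2)"
  unfolding power2_eq_square by (intro smooth_add smooth_const smooth_mult)

context
  fixes e :: real and f :: "real ^ 'n \<Rightarrow> real"
  assumes e: "e > 0" and f: "test_function f"
begin

lemma DERIV_arctan_scaled:
  "((\<lambda>t. arctan (t / e)) has_real_derivative e / (e\<^sup>2 + t\<^sup>2)) (at t)"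
proof -
  have "((\<lambda>t. arctan (t / e)) has_real_derivative (1 / e) / (1 + (t / e)\<^sup>2)) (at t)"
    using e by (auto intro!: derivative_eq_intros simp: field_simps)
  moreover have "(1 / e) / (1 + (t / e)\<^sup>2) = e / (e\<^sup>2 + t\<^sup>2)"
    using e square_add_pos[OF e, of t] by (simp add: field_simps power2_eq_square)
  ultimately show ?thesis by simp
qed

text \<open>The elementary primitive of \<open>e\<^sup>2 / (e\<^sup>2 + t\<^sup>2)\<^sup>2\<close>;
  having it in closed form makes its composite with a test function again a test function.\<close>

lemma DERIV_test_nonlinearity:
  "((\<lambda>t. arctan (t / e) / (2 * e) + t / (2 * (e\<^sup>2 + t\<^sup>2))) has_real_derivative e\<^sup>2 / (e\<^sup>2 + t\<^sup>2)\<^sup>2) (at t)"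
proof -
  have "((\<lambda>t. t / (2 * (e\<^sup>2 + t\<^sup>2))) has_real_derivative
      (1 * (2 * (e\<^sup>2 + t\<^sup>2)) - t * (2 * (2 * t))) / (2 * (e\<^sup>2 + t\<^sup>2))\<^sup>2) (at t)"
    using square_add_pos[OF e, of t] by (auto intro!: derivative_eq_intros simp: power2_eq_square)
  from DERIV_add[OF DERIV_cdivide[OF DERIV_arctan_scaled, of "2 * e"] this]
  have "((\<lambda>t. arctan (t / e) / (2 * e) + t / (2 * (e\<^sup>2 + t\<^sup>2))) has_real_derivative
      e / (e\<^sup>2 + t\<^sup>2) / (2 * e) + (1 * (2 * (e\<^sup>2 + t\<^sup>2)) - t * (2 * (2 * t))) / (2 * (e\<^sup>2 + t\<^sup>2))\<^sup>2) (at t)" .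
  moreover have "e / (e\<^sup>2 + t\<^sup>2) / (2 * e) + (1 * (2 * (e\<^sup>2 + t\<^sup>2)) - t * (2 * (2 * t))) / (2 * (e\<^sup>2 + t\<^sup>2))\<^sup>2
      = e\<^sup>2 / (e\<^sup>2 + t\<^sup>2)\<^sup>2"
  proof -
    \<comment> \<open>Replacing \<open>t * t\<close> by \<open>y - e\<^sup>2\<close> cancels the
      terms of order \<open>1 / y\<close> and leaves \<open>e\<^sup>2 / y\<^sup>2\<close>.\<close>
    define y where "y = e\<^sup>2 + t\<^sup>2"
    have y: "y > 0" "t * t = y - e\<^sup>2" using square_add_pos[OF e, of t] by (auto simp: y_def power2_eq_square)
    have "e / y / (2 * e) + (1 * (2 * y) - t * (2 * (2 * t))) / (2 * y)\<^sup>2 = 1 / (2 * y) + (2 * y - 4 * (t * t)) / (4 * y\<^sup>2)"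
      using e by (simp add: power_mult_distrib mult_ac)
    also have "\<dots> = e\<^sup>2 / y\<^sup>2"
      unfolding y(2) using y(1) by (simp add: field_simps power2_eq_square)
    finally show ?thesis by (simp add: y_def)
  qed
  ultimately show ?thesis by simp
qed

lemma test_arctan: "test_function (\<lambda>x. arctan (f x / e))"
proof (rule test_compose[OF f DERIV_arctan_scaled])
  have "smooth (\<lambda>x. e * (e\<^sup>2 + (f x)\<^sup>2) powr (- 1))"
    using f by (intro smooth_mult smooth_const smooth_powr smooth_power2_add square_add_pos[OF e]) (simp add: test_function_def)
  then show "smooth (\<lambda>x. e / (e\<^sup>2 + (f x)\<^sup>2))"
    using square_add_pos[OF e] by (simp add: powr_minus divide_inverse)
qed

lemma test_nonlinearity:
  "test_function (\<lambda>x. arctan (f x / e) / (2 * e) + f x / (2 * (e\<^sup>2 + (f x)\<^sup>2)))"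
proof (rule test_compose[OF f DERIV_test_nonlinearity])
  have "smooth (\<lambda>x. e\<^sup>2 * (e\<^sup>2 + (f x)\<^sup>2) powr (- 2))"
    using f by (intro smooth_mult smooth_const smooth_powr smooth_power2_add square_add_pos[OF e]) (simp add: test_function_def)
  then show "smooth (\<lambda>x. e\<^sup>2 / (e\<^sup>2 + (f x)\<^sup>2)\<^sup>2)"
    using square_add_pos[OF e] by (simp add: powr_minus divide_inverse)
qed

lemma partial_arctan: "partial i (\<lambda>x. arctan (f x / e)) = (\<lambda>x. e / (e\<^sup>2 + (f x)\<^sup>2) * partial i f x)"
  by (rule partial_compose[OF test_differentiable[OF f] DERIV_arctan_scaled])

lemma partial_nonlinearity:
  "partial i (\<lambda>x. arctan (f x / e) / (2 * e) + f x / (2 * (e\<^sup>2 + (f x)\<^sup>2))) =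
    (\<lambda>x. e\<^sup>2 / (e\<^sup>2 + (f x)\<^sup>2)\<^sup>2 * partial i f x)"
  by (rule partial_compose[OF test_differentiable[OF f] DERIV_test_nonlinearity])

end

context bounded_drift_solution
begin

lemma integrable_m_squared: "integrable \<T> (\<lambda>x. (m x)\<^sup>2)"
  using integrable_powr[of 2] by simp

text \<open>Testing with the reflected mollifier makes the equation hold pointwise between smooth
  functions. The right side is the divergence of the mollified product of m and A, not of a product
  of mollified functions.\<close>

lemma mollified_equation:
  assumes \<eta>: "test_function \<eta>"
  shows "(\<Sum>i\<in>UNIV. partial i (partial i (convol m \<eta>)) x) =
    (\<Sum>i\<in>UNIV. partial i (convol (\<lambda>y. m y * A y $ i) \<eta>) x)"
proof -
  define \<phi> where "\<phi> y = \<eta> (x - y)" for y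
  have \<phi>: "test_function \<phi>" unfolding \<phi>_def[abs_def] by (rule test_reflect[OF \<eta>])
  have p\<phi>: "partial i \<phi> y = - partial i \<eta> (x - y)" for i y
    unfolding \<phi>_def[abs_def] by (simp add: partial_reflect[OF test_differentiable[OF \<eta>]])
  have pp\<phi>: "partial i (partial i \<phi>) y = partial i (partial i \<eta>) (x - y)" for i y
    unfolding \<phi>_def[abs_def] by (simp add: partial_partial_reflect[OF \<eta>])
  have i1: "integrable \<T> (\<lambda>y. m y * partial i (partial i \<eta>) (x - y))" for i
    by (intro integrable_convol integrable_m test_partial \<eta>)
  have i2: "integrable \<T> (\<lambda>y. m y * A y $ i * partial i \<eta> (x - y))" for i
    by (intro integrable_convol integrable_drift_component test_partial \<eta>)
  have "0 = (\<oint>y. m y * ((\<Sum>i\<in>UNIV. partial i (partial i \<phi>) y) + A y \<bullet> grad \<phi> y))"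
    using distributional_equation[OF \<phi>] by simp
  also have "\<dots> = (\<oint>y. (\<Sum>i\<in>UNIV. m y * partial i (partial i \<eta>) (x - y)) - (\<Sum>i\<in>UNIV. m y * A y $ i * partial i \<eta> (x - y)))"
    by (intro Bochner_Integration.integral_cong refl)
       (simp add: pp\<phi> p\<phi> inner_grad distrib_left right_diff_distrib sum_distrib_left sum_negf mult.assoc)
  also have "\<dots> = (\<Sum>i\<in>UNIV. convol m (partial i (partial i \<eta>)) x) - (\<Sum>i\<in>UNIV. convol (\<lambda>y. m y * A y $ i) (partial i \<eta>) x)"
    using i1 i2 by (simp add: convol_def)
  finally show ?thesis
    by (simp add: partial_convol integrable_m integrable_drift_component \<eta> test_partial)
qed

text \<open>The derivative \<open>e\<^sup>2 / (e\<^sup>2 + t\<^sup>2)\<^sup>2\<close> of the nonlinearity used for testing is the square of that of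
  \<open>arctan (t / e)\<close>.\<close>

lemma energy_estimate:
  assumes e: "e > 0" and \<eta>: "test_function \<eta>" "\<And>x. \<eta> x \<ge> 0" "\<And>x. \<eta> (- x) = \<eta> x" "(\<oint>x. \<eta> x) = 1"
  shows "(\<oint>x. (partial i (\<lambda>x. arctan (convol m \<eta> x / e)) x)\<^sup>2) \<le>
    real CARD('n) * K\<^sup>2 * (\<oint>x. e\<^sup>2 / (e\<^sup>2 + (convol m \<eta> x)\<^sup>2)\<^sup>2 * convol (\<lambda>y. (m y)\<^sup>2) \<eta> x)"
proof -
  let ?m = "convol m \<eta>"
  define h' where "h' x = e\<^sup>2 / (e\<^sup>2 + (?m x)\<^sup>2)\<^sup>2" for x
  define h where "h x = arctan (?m x / e) / (2 * e) + ?m x / (2 * (e\<^sup>2 + (?m x)\<^sup>2))" for x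
  define F where "F i = convol (\<lambda>y. m y * A y $ i) \<eta>" for i
  have m: "test_function ?m" by (intro test_convol integrable_m \<eta>)
  have F: "test_function (F i)" for i unfolding F_def by (intro test_convol integrable_drift_component \<eta>)
  have pm: "test_function (partial i ?m)" for i by (rule test_partial[OF m])
  have h: "test_function h" unfolding h_def[abs_def] by (rule test_nonlinearity[OF e m])
  have ph: "partial i h = (\<lambda>x. h' x * partial i ?m x)" for i
    unfolding h_def[abs_def] h'_def by (rule partial_nonlinearity[OF e m])
  have h'0: "h' x \<ge> 0" for x by (simp add: h'_def)
  have th': "test_function h'"
  proof -
    have "smooth (\<lambda>x. e\<^sup>2 * (e\<^sup>2 + (?m x)\<^sup>2) powr (- 2))"
      using m by (intro smooth_mult smooth_const smooth_powr smooth_power2_add square_add_pos[OF e]) (auto simp: test_function_def m)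
    then have "smooth h'" using square_add_pos[OF e] by (simp add: powr_minus divide_inverse h'_def[abs_def])
    moreover have "periodic h'" using m by (auto simp: periodic_def test_function_def h'_def)
    ultimately show ?thesis by (simp add: test_function_def)
  qed
  have iaa: "integrable \<T> (\<lambda>x. h' x * (partial i ?m x)\<^sup>2)" for i
    unfolding power2_eq_square by (intro test_integrable test_mult th' pm)
  have iab: "integrable \<T> (\<lambda>x. h' x * (partial i ?m x * F i x))" for i
    by (intro test_integrable test_mult th' pm F)
  have ibb: "integrable \<T> (\<lambda>x. h' x * (F i x)\<^sup>2)" for i
    unfolding power2_eq_square by (intro test_integrable test_mult th' F)
  \<comment> \<open>The field formed by the gradient of the mollified m minus the mollified drift is
    divergence free, hence orthogonal to the gradient of h.\<close>
  have "(\<Sum>i\<in>UNIV. (\<oint>x. h' x * (partial i ?m x)\<^sup>2 - h' x * (partial i ?m x * F i x))) = 0"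
  proof -
    let ?D = "\<lambda>i x. partial i ?m x - F i x"
    have D: "test_function (?D i)" for i by (intro test_diff pm F)
    have pD: "partial i (?D i) x = partial i (partial i ?m) x - partial i (F i) x" for i x
    proof -
      have "partial i (\<lambda>x. partial i ?m x + (- 1) * F i x) = (\<lambda>x. partial i (partial i ?m) x + partial i (\<lambda>x. (- 1) * F i x) x)"
        by (intro partial_add test_differentiable pm test_cmult F)
      moreover have "partial i (\<lambda>x. (- 1) * F i x) = (\<lambda>x. - partial i (F i) x)"
        using partial_mult[of "\<lambda>x. - 1" "F i" i] by (simp add: test_differentiable F partial_const)
      ultimately show ?thesis by simp
    qed
    have "(\<oint>x. h' x * (partial i ?m x)\<^sup>2 - h' x * (partial i ?m x * F i x)) = - (\<oint>x. h x * partial i (?D i) x)" for i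
    proof -
      have "(\<oint>x. partial i h x * ?D i x) = - (\<oint>x. h x * partial i (?D i) x)"
        using integral_by_parts[OF h D[of i], of i] by simp
      moreover have "partial i h x * ?D i x = h' x * (partial i ?m x)\<^sup>2 - h' x * (partial i ?m x * F i x)" for x
        by (simp add: ph power2_eq_square algebra_simps)
      ultimately show ?thesis by simp
    qed
    then have "(\<Sum>i\<in>UNIV. (\<oint>x. h' x * (partial i ?m x)\<^sup>2 - h' x * (partial i ?m x * F i x)))
        = - (\<Sum>i\<in>UNIV. (\<oint>x. h x * partial i (?D i) x))" by (simp add: sum_negf)
    also have "(\<Sum>i\<in>UNIV. (\<oint>x. h x * partial i (?D i) x)) = (\<oint>x. (\<Sum>i\<in>UNIV. h x * partial i (?D i) x))"
      by (intro Bochner_Integration.integral_sum[symmetric] test_integrable test_mult h test_partial D)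
    also have "\<dots> = 0"
    proof -
      have "(\<Sum>i\<in>UNIV. partial i (partial i ?m) x) = (\<Sum>i\<in>UNIV. partial i (F i) x)" for x
        unfolding F_def by (rule mollified_equation[OF \<eta>(1)])
      then show ?thesis by (simp add: pD sum_subtractf flip: sum_distrib_left)
    qed
    finally show ?thesis by simp
  qed
  then have "(\<Sum>i\<in>UNIV. (\<oint>x. h' x * (partial i ?m x)\<^sup>2)) = (\<Sum>i\<in>UNIV. (\<oint>x. h' x * (partial i ?m x * F i x)))"
    using iaa iab by (simp add: sum_subtractf)
  also have "\<dots> \<le> (\<Sum>i\<in>UNIV. ((\<oint>x. h' x * (partial i ?m x)\<^sup>2) + (\<oint>x. h' x * (F i x)\<^sup>2)) / 2)"
  proof (rule sum_mono)
    fix i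
    have "(\<oint>x. h' x * (partial i ?m x * F i x)) \<le> (\<oint>x. (h' x * (partial i ?m x)\<^sup>2 + h' x * (F i x)\<^sup>2) / 2)"
    proof (rule integral_mono)
      fix x
      \<comment> \<open>The product is split so that half of the gradient term can be absorbed on
        the left.\<close>
      have "partial i ?m x * F i x \<le> ((partial i ?m x)\<^sup>2 + (F i x)\<^sup>2) / 2"
        using sum_squares_bound[of "partial i ?m x" "F i x"] by simp
      then have "h' x * (partial i ?m x * F i x) \<le> h' x * (((partial i ?m x)\<^sup>2 + (F i x)\<^sup>2) / 2)"
        using h'0 by (intro mult_left_mono)
      then show "h' x * (partial i ?m x * F i x) \<le> (h' x * (partial i ?m x)\<^sup>2 + h' x * (F i x)\<^sup>2) / 2"
        by (simp add: distrib_left)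
    qed (use iaa iab ibb in auto)
    then show "(\<oint>x. h' x * (partial i ?m x * F i x)) \<le>
        ((\<oint>x. h' x * (partial i ?m x)\<^sup>2) + (\<oint>x. h' x * (F i x)\<^sup>2)) / 2"
      using iaa ibb by simp
  qed
  finally have le: "(\<Sum>i\<in>UNIV. (\<oint>x. h' x * (partial i ?m x)\<^sup>2)) \<le> (\<Sum>i\<in>UNIV. (\<oint>x. h' x * (F i x)\<^sup>2))"
    by (simp add: sum.distrib flip: sum_divide_distrib)
  have i2m: "test_function (convol (\<lambda>y. (m y)\<^sup>2) \<eta>)" by (intro test_convol integrable_m_squared \<eta>)
  \<comment> \<open>Jensen's inequality compares the mollified drift with the mollified square of m,
    at the price of the bound K on A.\<close>
  have F2: "(F i x)\<^sup>2 \<le> K\<^sup>2 * convol (\<lambda>y. (m y)\<^sup>2) \<eta> x" for i x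
  proof -
    have A2: "(A y $ i)\<^sup>2 \<le> K\<^sup>2" for y
      using component_le_norm_cart[of "A y" i] norm_A_le[of y] K_nonneg abs_le_square_iff[of "A y $ i" K] by auto
    have int: "integrable \<T> (\<lambda>y. (m y * A y $ i)\<^sup>2)"
      unfolding power_mult_distrib using A2
      by (intro integrable_mult_bounded[OF integrable_m_squared, where C = "K\<^sup>2"]) auto
    have "(F i x)\<^sup>2 \<le> convol (\<lambda>y. (m y * A y $ i)\<^sup>2) \<eta> x"
      unfolding F_def by (rule convol_squared_le[OF integrable_drift_component int \<eta>])
    also have "\<dots> \<le> (\<oint>y. K\<^sup>2 * ((m y)\<^sup>2 * \<eta> (x - y)))"
      unfolding convol_def
    proof (rule integral_mono)
      fix y
      have "(A y $ i)\<^sup>2 * ((m y)\<^sup>2 * \<eta> (x - y)) \<le> K\<^sup>2 * ((m y)\<^sup>2 * \<eta> (x - y))"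
        using A2 \<eta>(2) by (intro mult_right_mono) auto
      then show "(m y * A y $ i)\<^sup>2 * \<eta> (x - y) \<le> K\<^sup>2 * ((m y)\<^sup>2 * \<eta> (x - y))"
        by (simp add: power_mult_distrib mult_ac)
    qed (use integrable_convol[OF int \<eta>(1)] integrable_convol[OF integrable_m_squared \<eta>(1)] in auto)
    finally show ?thesis by (simp add: convol_def)
  qed
  have "(\<oint>x. (partial i (\<lambda>x. arctan (?m x / e)) x)\<^sup>2) = (\<oint>x. h' x * (partial i ?m x)\<^sup>2)"
    unfolding partial_arctan[OF e m] by (simp add: h'_def power_mult_distrib power_divide)
  also have "\<dots> \<le> (\<Sum>i\<in>UNIV. (\<oint>x. h' x * (partial i ?m x)\<^sup>2))"
    using h'0 by (intro member_le_sum) (auto intro!: integral_nonneg)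
  also note le
  also have "(\<Sum>i\<in>UNIV. (\<oint>x. h' x * (F i x)\<^sup>2)) \<le> (\<Sum>i\<in>(UNIV :: 'n set). K\<^sup>2 * (\<oint>x. h' x * convol (\<lambda>y. (m y)\<^sup>2) \<eta> x))"
  proof (rule sum_mono)
    fix i
    have "(\<oint>x. h' x * (F i x)\<^sup>2) \<le> (\<oint>x. K\<^sup>2 * (h' x * convol (\<lambda>y. (m y)\<^sup>2) \<eta> x))"
    proof (rule integral_mono)
      fix x
      have "h' x * (F i x)\<^sup>2 \<le> h' x * (K\<^sup>2 * convol (\<lambda>y. (m y)\<^sup>2) \<eta> x)"
        using F2 h'0 by (intro mult_left_mono) auto
      then show "h' x * (F i x)\<^sup>2 \<le> K\<^sup>2 * (h' x * convol (\<lambda>y. (m y)\<^sup>2) \<eta> x)" by (simp add: mult_ac)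
      show "integrable \<T> (\<lambda>x. K\<^sup>2 * (h' x * convol (\<lambda>y. (m y)\<^sup>2) \<eta> x))"
        by (intro integrable_mult_right test_integrable test_mult th' i2m)
    qed (rule ibb)
    then show "(\<oint>x. h' x * (F i x)\<^sup>2) \<le> K\<^sup>2 * (\<oint>x. h' x * convol (\<lambda>y. (m y)\<^sup>2) \<eta> x)"
      by simp
  qed
  finally show ?thesis by (simp add: h'_def mult.assoc)
qed

text \<open>For mollified m this is integration by parts, the Cauchy-Schwarz inequality and the
  energy estimate. The mollifier is then removed; the limit uses that the square of m is integrable,
  which the gain of integrability supplies.\<close>

lemma arctan_gradient_estimate:
  assumes e: "e > 0" and \<phi>: "test_function \<phi>"
  shows "(\<oint>x. arctan (m x / e) * partial i \<phi> x)\<^sup>2 \<le>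
    (real CARD('n) * K\<^sup>2 * (\<oint>x. e\<^sup>2 / (e\<^sup>2 + (m x)\<^sup>2)\<^sup>2 * (m x)\<^sup>2)) * (\<oint>x. (\<phi> x)\<^sup>2)"
proof -
  define eps where "eps j = 1 / real (Suc j)" for j
  have eps: "\<And>j. 0 < eps j" "\<And>j. eps j \<le> 1" "eps \<longlonglongrightarrow> 0"
    unfolding eps_def using LIMSEQ_Suc[OF lim_1_over_n] by (auto simp: divide_simps)
  obtain s where s: "strict_mono s" "AE x in \<T>. (\<lambda>j. convol m (mollifier (eps (s j))) x) \<longlonglongrightarrow> m x"
    using mollified_AE_subseq[OF measurable_m periodic_m integrable_m eps] by blast
  define \<eta> where "\<eta> j = (mollifier (eps (s j)) :: real ^ 'n \<Rightarrow> real)" for j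
  have \<eta>: "test_function (\<eta> j)" "\<eta> j x \<ge> 0" "\<eta> j (- x) = \<eta> j x" "(\<oint>x. \<eta> j x) = 1" for j x
    unfolding \<eta>_def
    by (rule test_mollifier[OF eps(1,2)] mollifier_nonneg[OF eps(1,2)]
        mollifier_even[OF eps(1,2)] integral_mollifier[OF eps(1,2)])+
  define u where "u j = convol m (\<eta> j)" for j
  define v where "v j = convol (\<lambda>y. (m y)\<^sup>2) (\<eta> j)" for j
  define h' where "h' t = e\<^sup>2 / (e\<^sup>2 + t\<^sup>2)\<^sup>2" for t
  have tu: "test_function (u j)" for j unfolding u_def by (intro test_convol integrable_m \<eta>)
  have tv: "test_function (v j)" for j unfolding v_def by (intro test_convol integrable_m_squared \<eta>)
  have [measurable]: "u j \<in> borel_measurable borel" "v j \<in> borel_measurable borel" "\<phi> \<in> borel_measurable borel"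
      "partial i \<phi> \<in> borel_measurable borel" for j i
    by (intro test_measurable tu tv \<phi> test_partial)+
  have [measurable]: "h' \<in> borel_measurable borel" unfolding h'_def[abs_def] by measurable
  have s2: "AE x in \<T>. (\<lambda>j. u j x) \<longlonglongrightarrow> m x" using s(2) by (simp add: u_def \<eta>_def)
  have h'0: "h' t \<ge> 0" for t by (simp add: h'_def)
  have h'1: "h' t \<le> 1 / e\<^sup>2" for t
  proof -
    have "(e\<^sup>2)\<^sup>2 \<le> (e\<^sup>2 + t\<^sup>2)\<^sup>2" by (intro power_mono) auto
    then have "e\<^sup>2 / (e\<^sup>2 + t\<^sup>2)\<^sup>2 \<le> e\<^sup>2 / (e\<^sup>2)\<^sup>2" using e square_add_pos[OF e, of t] by (intro divide_left_mono) auto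
    then show ?thesis using e by (simp add: h'_def power2_eq_square)
  qed
  have h'cont: "isCont h' t" for t
    unfolding h'_def using square_add_pos[OF e, of t] by (intro continuous_intros) auto
  have lim1: "(\<lambda>j. (\<oint>x. arctan (u j x / e) * partial i \<phi> x)) \<longlonglongrightarrow> (\<oint>x. arctan (m x / e) * partial i \<phi> x)"
  proof (rule integral_dominated_convergence[where w = "\<lambda>x. pi * \<bar>partial i \<phi> x\<bar>"])
    show "integrable \<T> (\<lambda>x. pi * \<bar>partial i \<phi> x\<bar>)"
      using test_integrable[OF test_partial[OF \<phi>]] by simp
    show "AE x in \<T>. (\<lambda>j. arctan (u j x / e) * partial i \<phi> x) \<longlonglongrightarrow> arctan (m x / e) * partial i \<phi> x"
      using s2 by eventually_elim (use e in \<open>intro tendsto_intros, auto\<close>)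
    show "AE x in \<T>. norm (arctan (u j x / e) * partial i \<phi> x) \<le> pi * \<bar>partial i \<phi> x\<bar>" for j
    proof (intro AE_I2)
      fix x
      have "\<bar>arctan (u j x / e)\<bar> \<le> pi"
        using arctan_bounded[of "u j x / e"] pi_gt_zero by linarith
      then show "norm (arctan (u j x / e) * partial i \<phi> x) \<le> pi * \<bar>partial i \<phi> x\<bar>"
        by (simp add: abs_mult mult_right_mono)
    qed
  qed measurable
  have int_hm: "integrable \<T> (\<lambda>x. h' (w x) * (m x)\<^sup>2)" if [measurable]: "w \<in> borel_measurable borel" for w
    using integrable_mult_bounded[OF integrable_m_squared, of "\<lambda>x. h' (w x)" "1 / e\<^sup>2"] h'0 h'1
    by (simp add: mult.commute)
  \<comment> \<open>One factor converges almost everywhere and stays below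
    \<open>1 / e\<^sup>2\<close>, the other converges in the mean. So \<open>v j\<close> is first
    replaced by the square of m, with dominated convergence for the main term.\<close>
  have lim2: "(\<lambda>j. (\<oint>x. h' (u j x) * v j x)) \<longlonglongrightarrow> (\<oint>x. h' (m x) * (m x)\<^sup>2)"
  proof -
    have a: "(\<lambda>j. (\<oint>x. h' (u j x) * (m x)\<^sup>2)) \<longlonglongrightarrow> (\<oint>x. h' (m x) * (m x)\<^sup>2)"
    proof (rule integral_dominated_convergence[where w = "\<lambda>x. 1 / e\<^sup>2 * (m x)\<^sup>2"])
      show "integrable \<T> (\<lambda>x. 1 / e\<^sup>2 * (m x)\<^sup>2)" using integrable_m_squared by simp
      show "AE x in \<T>. (\<lambda>j. h' (u j x) * (m x)\<^sup>2) \<longlonglongrightarrow> h' (m x) * (m x)\<^sup>2"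
        using s2 by eventually_elim (intro tendsto_intros isCont_tendsto_compose[OF h'cont])
      show "AE x in \<T>. norm (h' (u j x) * (m x)\<^sup>2) \<le> 1 / e\<^sup>2 * (m x)\<^sup>2" for j
      proof (intro AE_I2)
        fix x
        have "h' (u j x) * (m x)\<^sup>2 \<le> 1 / e\<^sup>2 * (m x)\<^sup>2" using h'1 by (intro mult_right_mono) auto
        then show "norm (h' (u j x) * (m x)\<^sup>2) \<le> 1 / e\<^sup>2 * (m x)\<^sup>2" using h'0[of "u j x"] by simp
      qed
    qed measurable
    have per2: "periodic (\<lambda>x. (m x)\<^sup>2)" using periodic_m by (simp add: periodic_def)
    have b: "(\<lambda>j. (\<oint>x. \<bar>v j x - (m x)\<^sup>2\<bar>)) \<longlonglongrightarrow> 0"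
      using LIMSEQ_subseq_LIMSEQ[OF mollifier_L1_convergence[OF _ per2 integrable_m_squared eps] s(1)]
      by (simp add: v_def \<eta>_def comp_def)
    have iv: "integrable \<T> (v j)" for j by (rule test_integrable[OF tv])
    have ihv: "integrable \<T> (\<lambda>x. h' (u j x) * v j x)" for j
      using integrable_mult_bounded[OF iv, of "\<lambda>x. h' (u j x)" "1 / e\<^sup>2"] h'0 h'1 by (simp add: mult.commute)
    have c: "(\<lambda>j. (\<oint>x. h' (u j x) * v j x) - (\<oint>x. h' (u j x) * (m x)\<^sup>2)) \<longlonglongrightarrow> 0"
    proof (rule Lim_null_comparison)
      show "(\<lambda>j. 1 / e\<^sup>2 * (\<oint>x. \<bar>v j x - (m x)\<^sup>2\<bar>)) \<longlonglongrightarrow> 0"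
        by (rule tendsto_mult_right_zero[OF b])
      show "\<forall>\<^sub>F j in sequentially. norm ((\<oint>x. h' (u j x) * v j x) - (\<oint>x. h' (u j x) * (m x)\<^sup>2))
          \<le> 1 / e\<^sup>2 * (\<oint>x. \<bar>v j x - (m x)\<^sup>2\<bar>)"
      proof (intro always_eventually allI)
        fix j
        have "norm ((\<oint>x. h' (u j x) * v j x) - (\<oint>x. h' (u j x) * (m x)\<^sup>2))
            = \<bar>\<oint>x. h' (u j x) * v j x - h' (u j x) * (m x)\<^sup>2\<bar>"
          using ihv int_hm[of "u j"] by simp
        also have "\<dots> \<le> (\<oint>x. \<bar>h' (u j x) * v j x - h' (u j x) * (m x)\<^sup>2\<bar>)"
          by (rule integral_abs_bound)
        also have "\<dots> \<le> (\<oint>x. 1 / e\<^sup>2 * \<bar>v j x - (m x)\<^sup>2\<bar>)"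
        proof (rule integral_mono)
          fix x
          have "h' (u j x) * \<bar>v j x - (m x)\<^sup>2\<bar> \<le> 1 / e\<^sup>2 * \<bar>v j x - (m x)\<^sup>2\<bar>"
            using h'1 by (intro mult_right_mono) auto
          then show "\<bar>h' (u j x) * v j x - h' (u j x) * (m x)\<^sup>2\<bar> \<le> 1 / e\<^sup>2 * \<bar>v j x - (m x)\<^sup>2\<bar>"
            using h'0[of "u j x"] by (simp add: abs_mult flip: right_diff_distrib)
        qed (use ihv int_hm[of "u j"] iv integrable_m_squared in auto)
        finally show "norm ((\<oint>x. h' (u j x) * v j x) - (\<oint>x. h' (u j x) * (m x)\<^sup>2))
          \<le> 1 / e\<^sup>2 * (\<oint>x. \<bar>v j x - (m x)\<^sup>2\<bar>)" by simp
      qed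
    qed
    from tendsto_add[OF c a] show ?thesis by simp
  qed
  have le: "(\<oint>x. arctan (u j x / e) * partial i \<phi> x)\<^sup>2 \<le>
    (real CARD('n) * K\<^sup>2 * (\<oint>x. h' (u j x) * v j x)) * (\<oint>x. (\<phi> x)\<^sup>2)" for j
  proof -
    let ?w = "\<lambda>x. arctan (u j x / e)"
    have w: "test_function ?w" by (rule test_arctan[OF e tu])
    have "(\<oint>x. ?w x * partial i \<phi> x)\<^sup>2 = (\<oint>x. partial i ?w x * \<phi> x)\<^sup>2"
      using integral_by_parts[OF w \<phi>, of i] by simp
    also have "\<dots> \<le> (\<oint>x. (partial i ?w x)\<^sup>2) * (\<oint>x. (\<phi> x)\<^sup>2)"
    proof (rule cauchy_schwarz_integral[OF prob_space_unit_torus])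
      show "integrable \<T> (\<lambda>x. (partial i ?w x)\<^sup>2)" "integrable \<T> (\<lambda>x. (\<phi> x)\<^sup>2)"
        unfolding power2_eq_square
        by (intro test_integrable test_mult test_partial w \<phi>)+
    qed
    also have "\<dots> \<le> (real CARD('n) * K\<^sup>2 * (\<oint>x. h' (u j x) * v j x)) * (\<oint>x. (\<phi> x)\<^sup>2)"
      using energy_estimate[OF e \<eta>, where i = i] by (intro mult_right_mono) (auto simp: u_def v_def h'_def)
    finally show ?thesis .
  qed
  have "(\<oint>x. arctan (m x / e) * partial i \<phi> x)\<^sup>2 \<le>
    (real CARD('n) * K\<^sup>2 * (\<oint>x. h' (m x) * (m x)\<^sup>2)) * (\<oint>x. (\<phi> x)\<^sup>2)"
    by (rule LIMSEQ_le[OF tendsto_power[OF lim1] tendsto_mult[OF tendsto_mult[OF tendsto_const lim2] tendsto_const]])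
       (use le in auto)
  then show ?thesis by (simp add: h'_def)
qed

text \<open>As e tends to 0, \<open>arctan (m / e)\<close> tends boundedly to \<open>pi / 2\<close>
  times the sign of m, while the right side of the gradient estimate tends to zero by dominated
  convergence.\<close>

lemma sgn_weakly_constant:
  assumes \<phi>: "test_function \<phi>"
  shows "(\<oint>x. sgn (m x) * partial i \<phi> x) = 0"
proof -
  define e where "e n = 1 / real (Suc n)" for n
  have e: "\<And>n. e n > 0" "e \<longlonglongrightarrow> 0"
    unfolding e_def using LIMSEQ_Suc[OF lim_1_over_n] by auto
  have [measurable]: "partial i \<phi> \<in> borel_measurable borel"
    using test_partial[OF \<phi>, of i] by measurable
  have lim1: "(\<lambda>n. (\<oint>x. arctan (m x / e n) * partial i \<phi> x)) \<longlonglongrightarrow> (\<oint>x. pi / 2 * sgn (m x) * partial i \<phi> x)"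
  proof (rule integral_dominated_convergence[where w = "\<lambda>x. pi * \<bar>partial i \<phi> x\<bar>"])
    show "integrable \<T> (\<lambda>x. pi * \<bar>partial i \<phi> x\<bar>)"
      using test_integrable[OF test_partial[OF \<phi>]] by simp
    show "AE x in \<T>. (\<lambda>n. arctan (m x / e n) * partial i \<phi> x) \<longlonglongrightarrow> pi / 2 * sgn (m x) * partial i \<phi> x"
    proof (intro AE_I2 tendsto_mult tendsto_const)
      fix x
      have pos: "(\<lambda>n. arctan (t / e n)) \<longlonglongrightarrow> pi / 2" if "t > 0" for t
      proof -
        have "filterlim (\<lambda>n. t * real (Suc n)) at_top sequentially"
          using that by (intro filterlim_tendsto_pos_mult_at_top[OF tendsto_const] filterlim_compose[OF filterlim_real_sequentially filterlim_Suc])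
        then show ?thesis unfolding e_def by (simp add: filterlim_compose[OF tendsto_arctan_at_top])
      qed
      consider "m x > 0" | "m x = 0" | "m x < 0" by linarith
      then show "(\<lambda>n. arctan (m x / e n)) \<longlonglongrightarrow> pi / 2 * sgn (m x)"
      proof cases
        case 3
        then have "(\<lambda>n. - arctan (- m x / e n)) \<longlonglongrightarrow> - (pi / 2)" by (intro tendsto_minus pos) auto
        then show ?thesis using 3 by (simp add: arctan_minus)
      qed (auto simp: pos)
    qed
    show "AE x in \<T>. norm (arctan (m x / e n) * partial i \<phi> x) \<le> pi * \<bar>partial i \<phi> x\<bar>" for n
    proof (intro AE_I2)
      fix x
      have "\<bar>arctan (m x / e n)\<bar> \<le> pi"
        using arctan_bounded[of "m x / e n"] pi_gt_zero by linarith
      then show "norm (arctan (m x / e n) * partial i \<phi> x) \<le> pi * \<bar>partial i \<phi> x\<bar>"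
        by (simp add: abs_mult mult_right_mono)
    qed
  qed measurable
  have lim2: "(\<lambda>n. (\<oint>x. (e n)\<^sup>2 / ((e n)\<^sup>2 + (m x)\<^sup>2)\<^sup>2 * (m x)\<^sup>2)) \<longlonglongrightarrow> (\<oint>x :: real ^ 'n. 0)"
  proof (rule integral_dominated_convergence[where w = "\<lambda>x. 1"])
    show "AE x in \<T>. (\<lambda>n. (e n)\<^sup>2 / ((e n)\<^sup>2 + (m x)\<^sup>2)\<^sup>2 * (m x)\<^sup>2) \<longlonglongrightarrow> 0"
    proof (intro AE_I2)
      fix x
      show "(\<lambda>n. (e n)\<^sup>2 / ((e n)\<^sup>2 + (m x)\<^sup>2)\<^sup>2 * (m x)\<^sup>2) \<longlonglongrightarrow> 0"
      \<comment> \<open>Where m vanishes the quotient grows like \<open>1 / e\<^sup>2\<close>, but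
        its factor \<open>(m x)\<^sup>2\<close> is zero; elsewhere the numerator tends to 0.\<close>
      proof (cases "m x = 0")
        case False
        then have "(\<lambda>n. (e n)\<^sup>2 / ((e n)\<^sup>2 + (m x)\<^sup>2)\<^sup>2 * (m x)\<^sup>2) \<longlonglongrightarrow> 0\<^sup>2 / (0\<^sup>2 + (m x)\<^sup>2)\<^sup>2 * (m x)\<^sup>2"
          by (intro tendsto_intros e) auto
        then show ?thesis by simp
      qed simp
    qed
    show "AE x in \<T>. norm ((e n)\<^sup>2 / ((e n)\<^sup>2 + (m x)\<^sup>2)\<^sup>2 * (m x)\<^sup>2) \<le> 1" for n
    proof (intro AE_I2)
      fix x
      have "(e n)\<^sup>2 * (m x)\<^sup>2 \<le> ((e n)\<^sup>2 + (m x)\<^sup>2) * ((e n)\<^sup>2 + (m x)\<^sup>2)" by (intro mult_mono) auto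
      then show "norm ((e n)\<^sup>2 / ((e n)\<^sup>2 + (m x)\<^sup>2)\<^sup>2 * (m x)\<^sup>2) \<le> 1"
        using square_add_pos[OF e(1)[of n], where t = "m x"] by (simp add: power2_eq_square[of "_ + _"] divide_le_eq_1)
    qed
  qed auto
  have "(\<oint>x. pi / 2 * sgn (m x) * partial i \<phi> x)\<^sup>2 \<le> real CARD('n) * K\<^sup>2 * (\<oint>x :: real ^ 'n. 0) * (\<oint>x. (\<phi> x)\<^sup>2)"
    by (rule LIMSEQ_le[OF tendsto_power[OF lim1] tendsto_mult[OF tendsto_mult[OF tendsto_const lim2] tendsto_const]])
       (use arctan_gradient_estimate[OF e(1) \<phi>] in auto)
  then have "(\<oint>x. pi / 2 * (sgn (m x) * partial i \<phi> x)) = 0" by (simp add: mult.assoc)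
  then show ?thesis by simp
qed

text \<open>The gradient of \<open>sgn m\<close> vanishes weakly, so \<open>m\<close> cannot change sign.\<close>

lemma AE_pos:
  assumes one: "(\<oint>x. m x) = 1"
  shows "AE x in \<T>. m x > 0"
proof -
  define S where "S x = sgn (m x)" for x
  have [measurable]: "S \<in> borel_measurable borel" unfolding S_def[abs_def] by measurable
  have iS: "integrable \<T> S"
    by (rule unit_torus.integrable_const_bound[where B = 1]) (auto simp: S_def sgn_real_def)
  have pS: "periodic S" using periodic_m by (simp add: periodic_def S_def)
  \<comment> \<open>Reflecting the test function turns the vanishing weak gradient of the sign into
    a vanishing gradient of its mollifications, which are therefore constant on the whole
    space.\<close>
  have const: "\<exists>c. \<forall>x. convol S \<eta> x = c" if \<eta>: "test_function \<eta>" for \<eta>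
  proof -
    have "convol S (partial i \<eta>) x = 0" for i x
    proof -
      have "convol S (partial i \<eta>) x = - (\<oint>y. S y * partial i (\<lambda>y. \<eta> (x - y)) y)"
        by (simp add: convol_def partial_reflect[OF test_differentiable[OF \<eta>]])
      then show ?thesis
        using sgn_weakly_constant[OF test_reflect[OF \<eta>]] by (simp add: S_def)
    qed
    then have "(convol S \<eta> has_derivative (\<lambda>h. 0)) (at x)" for x
      using convol_has_derivative[OF iS \<eta>, of x] by simp
    then show ?thesis
      using has_derivative_zero_constant[of UNIV "convol S \<eta>"] by auto
  qed
  define eps where "eps j = 1 / real (Suc j)" for j
  have eps: "\<And>j. 0 < eps j" "\<And>j. eps j \<le> 1" "eps \<longlonglongrightarrow> 0"
    unfolding eps_def using LIMSEQ_Suc[OF lim_1_over_n] by (auto simp: divide_simps)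
  obtain s where s: "AE x in \<T>. (\<lambda>j. convol S (mollifier (eps (s j))) x) \<longlonglongrightarrow> S x"
    using mollified_AE_subseq[OF _ pS iS eps] by auto
  have "\<forall>j. \<exists>c. \<forall>x. convol S (mollifier (eps (s j))) x = c"
    using const test_mollifier[OF eps(1,2)] by blast
  then obtain c where c: "\<And>j x. convol S (mollifier (eps (s j))) x = c j" by metis
  have lim: "AE x in \<T>. c \<longlonglongrightarrow> S x" using s by (simp add: c)
  have "\<exists>x. c \<longlonglongrightarrow> S x"
  proof (rule ccontr)
    assume "\<not> ?thesis"
    with lim have "AE x :: real ^ 'n in \<T>. False" by simp
    then show False by simp
  qed
  then obtain x0 where x0: "c \<longlonglongrightarrow> S x0" by blast
  \<comment> \<open>The mollifications form one sequence of numbers, and a sequence has at most one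
    limit; so the sign is almost everywhere the same.\<close>
  have AE_eq: "AE x in \<T>. S x = S x0"
    using lim by eventually_elim (rule LIMSEQ_unique[OF _ x0])
  show ?thesis
  proof (cases "S x0 = 1")
    case True
    from AE_eq show ?thesis
      unfolding True by eventually_elim (simp add: S_def sgn_1_pos)
  next
    case False
    \<comment> \<open>A constant sign 0 or -1 would make the integral of m nonpositive, against its
      value 1.\<close>
    then have "S x0 \<le> 0" by (auto simp: S_def sgn_real_def split: if_splits)
    from AE_eq have "AE x in \<T>. 0 \<le> - m x"
    proof eventually_elim
      case (elim x)
      with \<open>S x0 \<le> 0\<close> have "sgn (m x) \<le> 0" by (simp add: S_def)
      then show ?case by (simp only: sgn_le_0_iff neg_0_le_iff_le)
    qed
    then have "0 \<le> (\<oint>x. - m x)" by (rule integral_nonneg_AE)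
    then show ?thesis using one by simp
  qed
qed

end

section \<open>The a priori estimate\<close>

lemma one_add_powr_le:
  fixes t g :: real
  assumes "t \<ge> 0" "g > 0"
  shows "(1 + t) powr g \<le> 2 powr g * (1 + t powr g)"
proof (cases "t \<le> 1")
  case True
  have "(1 + t) powr g \<le> 2 powr g" using assms True by (intro powr_mono2) auto
  also have "\<dots> \<le> 2 powr g * (1 + t powr g)" by (simp add: distrib_left)
  finally show ?thesis .
next
  case False
  have "(1 + t) powr g \<le> (2 * t) powr g" using assms False by (intro powr_mono2) auto
  also have "\<dots> = 2 powr g * t powr g" using assms by (simp add: powr_mult)
  also have "\<dots> \<le> 2 powr g * (1 + t powr g)" by simp
  finally show ?thesis .
qed

text \<open>Here \<open>X\<close> is the integral of \<open>m powr \<beta>\<close> and \<open>M\<close> that of \<open>(1 + norm A) powr \<gamma>' * m\<close>.\<close>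

lemma absorb_power:
  fixes X M C1 \<tau> \<sigma> \<gamma>' \<beta> q :: real
  assumes X: "X > 0" and M: "M \<ge> 0" and C1: "C1 > 0" and \<tau>: "0 < \<tau>" "\<tau> < 1" and \<sigma>: "0 < \<sigma>" "\<sigma> \<le> \<tau>" and \<gamma>': "\<gamma>' > 0"
    and \<beta>: "\<beta> = 1 / (1 - \<tau>)" and q: "q = 1 / (1 - \<tau> + \<sigma>)"
    and le: "X \<le> C1 * (M powr (q / \<gamma>') * X powr ((q - 1) / (\<beta> - 1))) powr (\<beta> / q)"
  shows "X powr (\<sigma> * \<gamma>' / (\<beta> - 1)) \<le> C1 powr (\<gamma>' / \<beta>) * M"
proof -
  let ?d = "1 - \<tau> + \<sigma>"
  have d: "?d > 0" using \<tau> \<sigma> by simp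
  have \<beta>0: "\<beta> > 0" and q0: "q > 0" using \<tau> d by (auto simp: \<beta> q)
  have \<beta>1: "\<beta> - 1 = \<tau> / (1 - \<tau>)" using \<tau> by (simp add: \<beta> field_simps)
  have \<beta>10: "\<beta> - 1 > 0" using \<tau> by (simp add: \<beta>1)
  have q1: "q - 1 = (\<tau> - \<sigma>) / ?d" using d by (simp add: q field_simps)
  define b where "b = (q - 1) / (\<beta> - 1)"
  have bq: "b / q = (\<tau> - \<sigma>) * (1 - \<tau>) / \<tau>"
    unfolding b_def \<beta>1 q1 using d \<tau> by (simp add: q)
  have ex: "\<gamma>' / \<beta> - \<gamma>' * (b / q) = \<sigma> * \<gamma>' / (\<beta> - 1)"
    unfolding bq \<beta>1 using \<tau> by (simp add: \<beta> field_simps)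
  \<comment> \<open>Raising to the power \<open>\<gamma>' / \<beta>\<close> makes M appear to the
    first power. The power of X on the right is then divided out; the difference of exponents is
    \<open>\<sigma> * \<gamma>' / (\<beta> - 1)\<close>.\<close>
  have "X powr (\<gamma>' / \<beta>) \<le> (C1 * (M powr (q / \<gamma>') * X powr b) powr (\<beta> / q)) powr (\<gamma>' / \<beta>)"
    using le X \<gamma>' \<beta>0 unfolding b_def by (intro powr_mono2) auto
  also have "\<dots> = C1 powr (\<gamma>' / \<beta>) * (M powr (q / \<gamma>') * X powr b) powr (\<gamma>' / q)"
    using \<beta>0 by (simp add: powr_mult powr_powr)
  also have "(M powr (q / \<gamma>') * X powr b) powr (\<gamma>' / q) = M * X powr (\<gamma>' * (b / q))"
    using M \<gamma>' q0 by (simp add: powr_mult powr_powr mult.commute)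
  finally have "X powr (\<gamma>' / \<beta>) \<le> C1 powr (\<gamma>' / \<beta>) * M * X powr (\<gamma>' * (b / q))" by (simp add: mult.assoc)
  then have "X powr (\<gamma>' / \<beta>) / X powr (\<gamma>' * (b / q)) \<le> C1 powr (\<gamma>' / \<beta>) * M"
    using X by (simp add: divide_le_eq)
  then show ?thesis unfolding ex[symmetric] by (simp add: powr_diff)
qed

text \<open>The estimate is first obtained for a larger exponent \<open>\<beta> = 1 / (1 - \<tau>)\<close> and then interpolated with \<open>L\<^sup>1\<close>:
  \<open>\<sigma> \<le> \<tau>\<close> makes \<open>q \<ge> 1\<close>, and \<open>\<tau> \<le> \<gamma>' \<sigma>\<close> makes the Hoelder exponents nonnegative.\<close>

lemma a_priori_estimate:
  fixes \<gamma>' \<beta>\<^sub>0 \<sigma> :: real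
  assumes \<gamma>': "\<gamma>' > 1" and \<beta>\<^sub>0: "\<beta>\<^sub>0 > 1" and \<sigma>: "0 < \<sigma>" "\<sigma> < 1 / real CARD('n::finite)"
    and crit: "1 - 1 / \<beta>\<^sub>0 \<le> \<gamma>' * \<sigma>"
  shows "\<exists>C>0. \<forall>A (m :: real ^ 'n \<Rightarrow> real) K. bounded_drift_solution A m K \<longrightarrow> (\<oint>x. m x) = 1 \<longrightarrow>
    (\<oint>x. \<bar>m x\<bar> powr \<beta>\<^sub>0) powr (\<sigma> * \<gamma>' / (\<beta>\<^sub>0 - 1)) \<le>
      C * ((\<oint>x. norm (A x) powr \<gamma>' * m x) + 1)"
proof -
  let ?N = "real CARD('n)"
  define \<tau> where "\<tau> = max \<sigma> (1 - 1 / \<beta>\<^sub>0)"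
  define \<beta> where "\<beta> = 1 / (1 - \<tau>)"
  define q where "q = 1 / (1 - \<tau> + \<sigma>)"
  have N1: "?N \<ge> 1" by (simp add: Suc_leI)
  then have "1 / ?N \<le> 1" by (subst divide_le_eq_1_pos) auto
  then have \<sigma>1: "\<sigma> < 1" using \<sigma>(2) by linarith
  have \<tau>: "0 < \<tau>" "\<tau> < 1" "\<sigma> \<le> \<tau>" "1 - 1 / \<beta>\<^sub>0 \<le> \<tau>"
    using \<sigma> \<sigma>1 \<beta>\<^sub>0 by (auto simp: \<tau>_def)
  have "1 * \<sigma> \<le> \<gamma>' * \<sigma>" using \<gamma>' \<sigma> by (intro mult_right_mono) auto
  then have \<tau>\<gamma>: "\<tau> \<le> \<gamma>' * \<sigma>" using crit by (simp add: \<tau>_def)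
  have d: "1 - \<tau> + \<sigma> > 0" using \<tau> \<sigma> by simp
  have iq: "1 / q = 1 - \<tau> + \<sigma>" by (simp add: q_def)
  have q1: "q \<ge> 1" unfolding q_def using d \<tau> by (subst le_divide_eq_1_pos) auto
  have \<sigma>q: "\<sigma> < 1 / q" using \<tau> by (simp add: iq)
  have \<beta>q: "\<beta> = 1 / (1 / q - \<sigma>)" by (simp add: \<beta>_def iq)
  have \<beta>1: "\<beta> - 1 = \<tau> / (1 - \<tau>)" using \<tau> by (simp add: \<beta>_def field_simps)
  have \<beta>10: "\<beta> > 1" using \<tau> \<beta>1 by (smt (verit) divide_pos_pos)
  have \<beta>\<beta>\<^sub>0: "\<beta>\<^sub>0 \<le> \<beta>"
  proof -
    have "1 - \<tau> \<le> 1 / \<beta>\<^sub>0" using \<tau>(4) by linarith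
    then have "(1 - \<tau>) * \<beta>\<^sub>0 \<le> 1" using \<beta>\<^sub>0 by (simp add: field_simps)
    then show ?thesis using \<tau> by (simp add: \<beta>_def field_simps)
  qed
  define a b c where "a = q / \<gamma>'" and "b = (q - 1) / (\<beta> - 1)" and "c = 1 - a - b"
  have abc: "a \<ge> 0" "b \<ge> 0" "c \<ge> 0" "a + b + c = 1"
  proof -
    show "a \<ge> 0" using q1 \<gamma>' by (simp add: a_def)
    show "b \<ge> 0" using q1 \<beta>10 by (simp add: b_def)
    have "q - 1 = (\<tau> - \<sigma>) / (1 - \<tau> + \<sigma>)" using d by (simp add: q_def field_simps)
    then have b: "b = q * ((\<tau> - \<sigma>) * (1 - \<tau>) / \<tau>)" by (simp add: b_def \<beta>1 q_def)
    \<comment> \<open>Here \<open>\<tau> \<le> \<gamma>' * \<sigma>\<close> enters: after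
      multiplication by q, the inequality derived from it says that
      \<open>a + b \<le> 1\<close>.\<close>
    have "1 / \<gamma>' \<le> \<sigma> / \<tau>" using \<tau>\<gamma> \<gamma>' \<tau> by (simp add: field_simps)
    also have "\<sigma> / \<tau> = (1 - \<tau> + \<sigma>) - (\<tau> - \<sigma>) * (1 - \<tau>) / \<tau>" using \<tau> by (simp add: field_simps)
    finally have "1 / \<gamma>' + (\<tau> - \<sigma>) * (1 - \<tau>) / \<tau> \<le> 1 / q" by (simp add: iq)
    then have "q * (1 / \<gamma>' + (\<tau> - \<sigma>) * (1 - \<tau>) / \<tau>) \<le> q * (1 / q)"
      using q1 by (intro mult_left_mono) auto
    then show "c \<ge> 0" using q1 by (simp add: c_def a_def b distrib_left)
  qed (simp add: c_def)
  obtain C1 where C1: "C1 > 0"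
    "\<And>A (m :: real ^ 'n \<Rightarrow> real) K. bounded_drift_solution A m K \<Longrightarrow>
      integrable \<T> (\<lambda>x. \<bar>m x\<bar> powr q) \<Longrightarrow>
      (\<oint>x. \<bar>m x\<bar> powr \<beta>) \<le> C1 * (\<oint>x. bounded_drift_solution.flux A m x powr q) powr (\<beta> / q)"
    using integrability_gain[OF q1 \<sigma>(1) \<sigma>q \<sigma>(2) \<beta>q] by blast
  define C where "C = C1 powr (\<gamma>' / \<beta>) * 2 powr \<gamma>'"
  have C0: "C > 0" using C1 by (simp add: C_def)
  have main: "(\<oint>x. \<bar>m x\<bar> powr \<beta>\<^sub>0) powr (\<sigma> * \<gamma>' / (\<beta>\<^sub>0 - 1)) \<le>
      C * ((\<oint>x. norm (A x) powr \<gamma>' * m x) + 1)"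
    if sol: "bounded_drift_solution A m K" and one: "(\<oint>x. m x) = 1"
    for A and m :: "real ^ 'n \<Rightarrow> real" and K
  proof -
    interpret bounded_drift_solution A m K by (rule sol)
    note pos = AE_pos[OF one]
    have abs_eq: "AE x in \<T>. \<bar>m x\<bar> = m x" using pos by eventually_elim simp
    have one': "(\<oint>x. \<bar>m x\<bar>) = 1"
      using one integral_cong_AE[OF _ _ abs_eq] by simp
    have im: "integrable \<T> (\<lambda>x. \<bar>m x\<bar>)" using integrable_m by simp
    have i\<beta>: "integrable \<T> (\<lambda>x. \<bar>m x\<bar> powr \<beta>)" using \<beta>10 by (intro integrable_powr) simp
    have iA: "integrable \<T> (\<lambda>x. \<bar>m x\<bar> * norm (A x) powr \<gamma>')"
      using norm_A_le \<gamma>' by (intro integrable_mult_bounded[OF im, where C = "K powr \<gamma>'"]) (auto intro!: powr_mono2)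
    have iB: "integrable \<T> (\<lambda>x. (1 + norm (A x)) powr \<gamma>' * \<bar>m x\<bar>)"
      using integrable_mult_bounded[OF im, of "\<lambda>x. (1 + norm (A x)) powr \<gamma>'" "(1 + K) powr \<gamma>'"] norm_A_le \<gamma>'
      by (simp add: powr_mono2 mult.commute)
    define X M where "X = (\<oint>x. \<bar>m x\<bar> powr \<beta>)"
      and "M = (\<oint>x. (1 + norm (A x)) powr \<gamma>' * \<bar>m x\<bar>)"
    have M0: "M \<ge> 0" by (simp add: M_def)
    \<comment> \<open>The absorption divides by a power of X, so X must not vanish; this follows
      from the positivity of m.\<close>
    have X0: "X > 0"
    proof (rule ccontr)
      assume "\<not> X > 0"
      moreover have "X \<ge> 0" by (simp add: X_def)
      ultimately have "X = 0" by simp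
      then have "AE x in \<T>. \<bar>m x\<bar> powr \<beta> = 0"
        using i\<beta> by (simp add: X_def integral_nonneg_eq_0_iff_AE)
      with pos have "AE x :: real ^ 'n in \<T>. False" by eventually_elim simp
      then show False by simp
    qed
    have M_le: "M \<le> 2 powr \<gamma>' * ((\<oint>x. norm (A x) powr \<gamma>' * m x) + 1)"
    proof -
      have "M \<le> (\<oint>x. 2 powr \<gamma>' * (\<bar>m x\<bar> + \<bar>m x\<bar> * norm (A x) powr \<gamma>'))"
        unfolding M_def
      proof (rule integral_mono)
        fix x
        show "(1 + norm (A x)) powr \<gamma>' * \<bar>m x\<bar> \<le> 2 powr \<gamma>' * (\<bar>m x\<bar> + \<bar>m x\<bar> * norm (A x) powr \<gamma>')"
          using mult_right_mono[OF one_add_powr_le[of "norm (A x)" \<gamma>'], of "\<bar>m x\<bar>"] \<gamma>' by (simp add: algebra_simps)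
      qed (use iB im iA in auto)
      also have "\<dots> = 2 powr \<gamma>' * (1 + (\<oint>x. \<bar>m x\<bar> * norm (A x) powr \<gamma>'))"
        using im iA one' by simp
      also have "(\<oint>x. \<bar>m x\<bar> * norm (A x) powr \<gamma>') = (\<oint>x. norm (A x) powr \<gamma>' * m x)"
        using abs_eq by (intro integral_cong_AE) (auto elim!: eventually_mono)
      finally show ?thesis by (simp add: add.commute)
    qed
    have flux_le_holder: "(\<oint>x. flux x powr q) \<le> M powr a * X powr b"
    proof -
      \<comment> \<open>The weight a is chosen so that \<open>1 + norm (A x)\<close> receives
        exponent q. The weight b gives \<open>\<bar>m x\<bar>\<close> the total exponent
        \<open>a + \<beta> * b + c = 1 + (\<beta> - 1) * b = q\<close>, and c goes to the mass,
        which is 1.\<close>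
      have eq: "flux x powr q = ((1 + norm (A x)) powr \<gamma>' * \<bar>m x\<bar>) powr a * (\<bar>m x\<bar> powr \<beta>) powr b * \<bar>m x\<bar> powr c" for x
      proof (cases "m x = 0")
        case False
        have "a + \<beta> * b + c = 1 + (\<beta> - 1) * b" by (simp add: c_def algebra_simps)
        also have "\<dots> = q" using \<beta>10 by (simp add: b_def)
        finally have e1: "a + (\<beta> * b + c) = q" by simp
        have e2: "\<gamma>' * a = q" using \<gamma>' by (simp add: a_def)
        have "((1 + norm (A x)) powr \<gamma>' * \<bar>m x\<bar>) powr a * (\<bar>m x\<bar> powr \<beta>) powr b * \<bar>m x\<bar> powr c
          = (1 + norm (A x)) powr (\<gamma>' * a) * \<bar>m x\<bar> powr (a + (\<beta> * b + c))"
          by (simp add: powr_mult powr_powr powr_add)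
        then show ?thesis by (simp add: e1 e2 flux_def powr_mult)
      qed (simp add: flux_def)
      have "(\<oint>x. flux x powr q) \<le> M powr a * X powr b * (\<oint>x. \<bar>m x\<bar>) powr c"
        unfolding eq M_def X_def using iB i\<beta> im by (intro holder3 abc) auto
      then show ?thesis by (simp add: one')
    qed
    have "X \<le> C1 * (\<oint>x. flux x powr q) powr (\<beta> / q)"
      unfolding X_def using q1 by (intro C1(2)[OF sol] integrable_powr)
    also have "\<dots> \<le> C1 * (M powr a * X powr b) powr (\<beta> / q)"
      using flux_le_holder C1(1) \<beta>10 q1 by (intro mult_left_mono powr_mono2) (auto intro!: integral_nonneg)
    finally have "X powr (\<sigma> * \<gamma>' / (\<beta> - 1)) \<le> C1 powr (\<gamma>' / \<beta>) * M"
      unfolding a_def b_def using \<gamma>'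
      by (intro absorb_power[OF X0 M0 C1(1) \<tau>(1,2) \<sigma>(1) \<tau>(3) _ \<beta>_def q_def]) auto
    also have "\<dots> \<le> C * ((\<oint>x. norm (A x) powr \<gamma>' * m x) + 1)"
      unfolding C_def mult.assoc by (intro mult_left_mono M_le) auto
    finally have big: "X powr (\<sigma> * \<gamma>' / (\<beta> - 1)) \<le> C * ((\<oint>x. norm (A x) powr \<gamma>' * m x) + 1)" .
    \<comment> \<open>The interpolation parameter satisfies
      \<open>\<beta>\<^sub>0 = \<theta> * \<beta> + (1 - \<theta>)\<close>. Dividing
      \<open>\<theta>\<close> by \<open>\<beta>\<^sub>0 - 1\<close> gives
      \<open>1 / (\<beta> - 1)\<close>, so the exponent of the large estimate turns into the wanted
      one.\<close>
    define \<theta> where "\<theta> = (\<beta>\<^sub>0 - 1) / (\<beta> - 1)"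
    have \<theta>: "0 \<le> \<theta>" "0 \<le> 1 - \<theta>" using \<beta>\<^sub>0 \<beta>10 \<beta>\<beta>\<^sub>0 by (auto simp: \<theta>_def)
    have "(\<oint>x. \<bar>m x\<bar> powr \<beta>\<^sub>0) \<le> X powr \<theta>"
    proof -
      have "\<bar>m x\<bar> powr \<beta>\<^sub>0 = (\<bar>m x\<bar> powr \<beta>) powr \<theta> * \<bar>m x\<bar> powr (1 - \<theta>) * 1 powr 0" for x
      proof -
        have "\<beta> * \<theta> + (1 - \<theta>) = 1 + (\<beta> - 1) * \<theta>" by (simp add: algebra_simps)
        also have "\<dots> = \<beta>\<^sub>0" using \<beta>10 by (simp add: \<theta>_def)
        finally show ?thesis by (simp add: powr_powr flip: powr_add)
      qed
      then have "(\<oint>x. \<bar>m x\<bar> powr \<beta>\<^sub>0) =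
        (\<oint>x. (\<bar>m x\<bar> powr \<beta>) powr \<theta> * \<bar>m x\<bar> powr (1 - \<theta>) * 1 powr 0)"
        by (intro Bochner_Integration.integral_cong refl)
      also have "\<dots> \<le> X powr \<theta> * (\<oint>x. \<bar>m x\<bar>) powr (1 - \<theta>) * (\<oint>x :: real ^ 'n. 1) powr 0"
        unfolding X_def using \<theta> i\<beta> im by (intro holder3) auto
      finally show ?thesis by (simp add: one')
    qed
    then have "(\<oint>x. \<bar>m x\<bar> powr \<beta>\<^sub>0) powr (\<sigma> * \<gamma>' / (\<beta>\<^sub>0 - 1)) \<le> (X powr \<theta>) powr (\<sigma> * \<gamma>' / (\<beta>\<^sub>0 - 1))"
      using \<sigma> \<gamma>' \<beta>\<^sub>0 by (intro powr_mono2) (auto intro!: integral_nonneg)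
    also have "\<dots> = X powr (\<sigma> * \<gamma>' / (\<beta> - 1))"
      using \<beta>\<^sub>0 by (simp add: powr_powr \<theta>_def)
    also note big
    finally show ?thesis .
  qed
  then show ?thesis using C0 by blast
qed

section \<open>From Lebesgue measurable weak solutions to the Borel setting\<close>

lemma AE_torus_measure_iff: "(AE x in torus_measure. P x) \<longleftrightarrow> (AE x in \<T>. P x)"
proof -
  have "(AE x in torus_measure. P x) \<longleftrightarrow> (AE x in lebesgue. x \<in> cbox 0 1 \<longrightarrow> P x)"
    unfolding torus_measure_def by (subst AE_restrict_space_iff) auto
  also have "\<dots> \<longleftrightarrow> (AE x in lborel. x \<in> cbox 0 1 \<longrightarrow> P x)" by (rule AE_completion_iff)
  also have "\<dots> \<longleftrightarrow> (AE x in \<T>. P x)"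
    unfolding unit_torus_def by (subst AE_density) (auto simp: indicator_def)
  finally show ?thesis .
qed

lemma measurable_torus_measure: "f \<in> borel_measurable borel \<Longrightarrow> f \<in> borel_measurable torus_measure"
  unfolding torus_measure_def by (intro measurable_restrict_space1 measurable_completion) simp

lemma
  fixes g :: "real ^ 'n \<Rightarrow> real"
  assumes [measurable]: "g \<in> borel_measurable borel"
  shows integral_torus_measure_borel: "(\<integral>x. g x \<partial>torus_measure) = (\<oint>x. g x)"
    and integrable_torus_measure_borel: "integrable torus_measure g \<longleftrightarrow> integrable \<T> g"
proof -
  let ?g = "\<lambda>x. indicator (cbox 0 1) x *\<^sub>R g x"
  have m: "?g \<in> borel_measurable lborel" by measurable
  have d: "\<T> = density lborel (\<lambda>x. ennreal (indicator (cbox 0 1) x))"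
    by (simp add: unit_torus_def ennreal_indicator)
  have "(\<integral>x. g x \<partial>torus_measure) = (\<integral>x. ?g x \<partial>lebesgue)"
    unfolding torus_measure_def by (subst integral_restrict_space) auto
  also have "\<dots> = (\<integral>x. ?g x \<partial>lborel)" by (rule integral_completion[OF m])
  also have "\<dots> = (\<oint>x. g x)"
    unfolding d by (subst integral_density) auto
  finally show "(\<integral>x. g x \<partial>torus_measure) = (\<oint>x. g x)" .
  have "integrable torus_measure g \<longleftrightarrow> integrable lebesgue ?g"
    unfolding torus_measure_def by (subst integrable_restrict_space) auto
  also have "\<dots> \<longleftrightarrow> integrable lborel ?g" by (rule integrable_completion[OF m])
  also have "\<dots> \<longleftrightarrow> integrable \<T> g"
    unfolding d by (subst integrable_density) auto
  finally show "integrable torus_measure g \<longleftrightarrow> integrable \<T> g" .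
qed

lemma
  fixes f g :: "real ^ 'n \<Rightarrow> real"
  assumes "f \<in> borel_measurable torus_measure" "g \<in> borel_measurable borel" "AE x in torus_measure. f x = g x"
  shows integral_torus_measure: "(\<integral>x. f x \<partial>torus_measure) = (\<oint>x. g x)"
    and integrable_torus_measure: "integrable torus_measure f \<longleftrightarrow> integrable \<T> g"
  using integral_cong_AE[OF assms(1) measurable_torus_measure[OF assms(2)] assms(3)]
    integrable_cong_AE[OF assms(1) measurable_torus_measure[OF assms(2)] assms(3)]
    integral_torus_measure_borel[OF assms(2)] integrable_torus_measure_borel[OF assms(2)]
  by auto

text \<open>Extension by zero makes the function measurable for the completed Lebesgue measure on
  the whole space, where it agrees almost everywhere with a Borel function.\<close>

lemma borel_representative:
  fixes f :: "real ^ 'n \<Rightarrow> real"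
  assumes "f \<in> borel_measurable torus_measure"
  shows "\<exists>g\<in>borel_measurable borel. AE x in torus_measure. f x = g x"
proof -
  have "(\<lambda>x. indicator (cbox 0 1) x *\<^sub>R f x) \<in> borel_measurable lebesgue"
    using assms unfolding torus_measure_def by (subst (asm) borel_measurable_restrict_space_iff) auto
  from completion_ex_borel_measurable_real[OF this] obtain g where
    g: "g \<in> borel_measurable lborel" "AE x in lborel. indicator (cbox 0 1) x *\<^sub>R f x = g x" by blast
  have "AE x in torus_measure. f x = g x"
    unfolding torus_measure_def
    using AE_completion[OF g(2)] by (subst AE_restrict_space_iff) (auto elim!: eventually_mono)
  with g(1) show ?thesis by auto
qed

lemma AE_torus_measure_wrap: "AE x in torus_measure. wrap x = x"
  unfolding AE_torus_measure_iff using AE_unit_torus_half_open_cube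
  by eventually_elim (rule wrap_idem)

lemma measurable_vec_nth_compose:
  fixes f :: "'a \<Rightarrow> real ^ 'n"
  shows "f \<in> borel_measurable M \<Longrightarrow> (\<lambda>x. f x $ i) \<in> borel_measurable M"
  by (rule measurable_compose[OF _ measurable_vec_nth'])

lemma in_L2_integrable:
  fixes u :: "real ^ 'n \<Rightarrow> 'b::euclidean_space"
  assumes "in_Lp 2 u"
  shows "integrable torus_measure u"
proof (rule Bochner_Integration.integrable_bound)
  have "integrable torus_measure (\<lambda>x :: real ^ 'n. 1 :: real)"
    using integrable_torus_measure_borel[of "\<lambda>_. 1"] by simp
  then show "integrable torus_measure (\<lambda>x. 1 + norm (u x) powr 2)"
    using assms by (simp add: in_Lp_def)
  show "u \<in> borel_measurable torus_measure" using assms by (simp add: in_Lp_def)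
  have "norm (u x) \<le> 1 + norm (u x) powr 2" for x
  proof -
    have "norm (u x) \<le> 1 + (norm (u x))\<^sup>2"
      using sum_squares_bound[of "norm (u x)" 1] norm_ge_zero[of "u x"]
      unfolding power_one mult_1_right by linarith
    then show ?thesis by simp
  qed
  then show "AE x in torus_measure. norm (u x) \<le> norm (1 + norm (u x) powr 2)" by simp
qed

text \<open>The weak gradient is eliminated by applying its defining identity to the partial
  derivatives of the test function, which moves the Laplacian onto it. The data are altered on null
  sets so that measurability, periodicity of m and the bound on A hold in the strict sense.\<close>

lemma bounded_drift_solution_exists:
  fixes m :: "real ^ 'n \<Rightarrow> real" and A :: "real ^ 'n \<Rightarrow> real ^ 'n"
  assumes A: "in_Linf A" and sol: "weak_solution A m"
  obtains m' A' K where "bounded_drift_solution A' m' K"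
    "AE x in torus_measure. m x = m' x" "AE x in torus_measure. A x = A' x"
proof -
  obtain g where g: "has_W12_gradient m g"
    "\<And>\<phi>. test_function \<phi> \<Longrightarrow> (\<integral>x. g x \<bullet> grad \<phi> x - m x * (A x \<bullet> grad \<phi> x) \<partial>torus_measure) = 0"
    using sol unfolding weak_solution_def by blast
  have m2: "in_Lp 2 m" and g2: "in_Lp 2 g"
    and wg: "\<And>\<phi> i. test_function \<phi> \<Longrightarrow>
        (\<integral>x. m x * partial i \<phi> x \<partial>torus_measure) = - (\<integral>x. g x $ i * \<phi> x \<partial>torus_measure)"
    using g(1) unfolding has_W12_gradient_def by auto
  have im: "integrable torus_measure m" and ig: "integrable torus_measure g"
    using m2 g2 in_L2_integrable by auto
  have mm [measurable]: "m \<in> borel_measurable torus_measure" and mA [measurable]: "A \<in> borel_measurable torus_measure"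
    using m2 A by (auto simp: in_Lp_def in_Linf_def)
  obtain K where K: "AE x in torus_measure. norm (A x) \<le> K" using A by (auto simp: in_Linf_def)
  \<comment> \<open>Nonnegative, so that the bound also holds where the drift is set to
    zero.\<close>
  define K' where "K' = max K 0"
  obtain m0 where m0 [measurable]: "m0 \<in> borel_measurable borel" and m0_eq: "AE x in torus_measure. m x = m0 x"
    using borel_representative[OF mm] by blast
  have "\<forall>i. \<exists>a\<in>borel_measurable borel. AE x in torus_measure. A x $ i = a x"
    using borel_representative[OF measurable_vec_nth_compose[OF mA]] by blast
  then obtain a where a [measurable]: "\<And>i. a i \<in> borel_measurable borel"
    and a_eq: "\<And>i. AE x in torus_measure. A x $ i = a i x" by metis
  define A0 where "A0 x = (\<chi> i. a i x)" for x
  have [measurable]: "A0 \<in> borel_measurable borel" unfolding A0_def[abs_def] by (rule measurable_vec_lambda) measurable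
  have "AE x in torus_measure. \<forall>i. A x $ i = a i x" using a_eq by (simp add: AE_all_countable)
  then have A0_eq: "AE x in torus_measure. A x = A0 x"
    by eventually_elim (simp add: A0_def vec_eq_iff)
  \<comment> \<open>A Borel representative need not be periodic; reading it off in the half-open
    cube restores periodicity and changes it only on a null set of the torus.\<close>
  define m' where "m' x = m0 (wrap x)" for x
  define A' where "A' x = (if norm (A0 x) \<le> K' then A0 x else 0)" for x
  have m'_meas [measurable]: "m' \<in> borel_measurable borel" unfolding m'_def[abs_def] by measurable
  have A'_meas [measurable]: "A' \<in> borel_measurable borel" unfolding A'_def[abs_def] by measurable
  have m'_eq: "AE x in torus_measure. m x = m' x"
    using m0_eq AE_torus_measure_wrap by eventually_elim (simp add: m'_def)
  have A'_eq: "AE x in torus_measure. A x = A' x"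
    using A0_eq K by eventually_elim (auto simp: A'_def K'_def)
  have "bounded_drift_solution A' m' K'"
  proof
    show "periodic m'" unfolding m'_def[abs_def] by (rule periodic_wrap_compose)
    show "integrable \<T> m'" using integrable_torus_measure[OF mm m'_meas m'_eq] im by simp
    show "norm (A' x) \<le> K'" for x by (simp add: A'_def K'_def)
    fix \<phi> :: "real ^ 'n \<Rightarrow> real" assume \<phi>: "test_function \<phi>"
    have [measurable]: "f \<in> borel_measurable torus_measure" if "test_function f" for f :: "real ^ 'n \<Rightarrow> real"
      using that by (intro measurable_torus_measure test_measurable)
    have mult_int: "integrable torus_measure (\<lambda>x. u x * f x)"
      if "integrable torus_measure u" "test_function f" for u f :: "real ^ 'n \<Rightarrow> real"
      using that test_bounded[OF that(2)]
      by (auto intro!: integrable_mult_bounded measurable_torus_measure test_measurable)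
    note p = test_partial[OF \<phi>] and pp = test_partial[OF test_partial[OF \<phi>]]
    have i1: "integrable torus_measure (\<lambda>x. m x * partial i (partial i \<phi>) x)" for i by (intro mult_int im pp)
    have gi: "integrable torus_measure (\<lambda>x. g x $ i)" for i
    proof (rule Bochner_Integration.integrable_bound[OF integrable_norm[OF ig]])
      show "(\<lambda>x. g x $ i) \<in> borel_measurable torus_measure"
        using ig by (intro measurable_vec_nth_compose) auto
    qed (simp add: component_le_norm_cart)
    have i2: "integrable torus_measure (\<lambda>x. g x $ i * partial i \<phi> x)" for i by (intro mult_int gi p)
    have mAi: "integrable torus_measure (\<lambda>x. m x * A x $ i)" for i
    proof (rule Bochner_Integration.integrable_bound)
      show "integrable torus_measure (\<lambda>x. K' * m x)" using im by simp
      show "(\<lambda>x. m x * A x $ i) \<in> borel_measurable torus_measure"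
        by (intro borel_measurable_times mm measurable_vec_nth_compose mA)
      show "AE x in torus_measure. norm (m x * A x $ i) \<le> norm (K' * m x)"
        using K
      proof eventually_elim
        case (elim x)
        then have "\<bar>A x $ i\<bar> \<le> \<bar>K'\<bar>" using component_le_norm_cart[of "A x" i] by (simp add: K'_def)
        then have "\<bar>A x $ i\<bar> * \<bar>m x\<bar> \<le> \<bar>K'\<bar> * \<bar>m x\<bar>" by (rule mult_right_mono) simp
        then show ?case by (simp add: abs_mult mult.commute)
      qed
    qed
    have i3: "integrable torus_measure (\<lambda>x. m x * A x $ i * partial i \<phi> x)" for i by (intro mult_int mAi p)
    have inner_eq: "v \<bullet> grad \<phi> x = (\<Sum>i\<in>UNIV. v $ i * partial i \<phi> x)" for v x
      by (simp add: inner_vec_def grad_def)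
    have "(\<integral>x. g x \<bullet> grad \<phi> x - m x * (A x \<bullet> grad \<phi> x) \<partial>torus_measure) =
        (\<integral>x. (\<Sum>i\<in>UNIV. g x $ i * partial i \<phi> x) - (\<Sum>i\<in>UNIV. m x * A x $ i * partial i \<phi> x) \<partial>torus_measure)"
      by (simp add: inner_eq sum_distrib_left mult.assoc)
    also have "\<dots> = (\<Sum>i\<in>UNIV. \<integral>x. g x $ i * partial i \<phi> x \<partial>torus_measure)
        - (\<Sum>i\<in>UNIV. \<integral>x. m x * A x $ i * partial i \<phi> x \<partial>torus_measure)"
      using i2 i3 by simp
    also have "(\<Sum>i\<in>UNIV. \<integral>x. g x $ i * partial i \<phi> x \<partial>torus_measure)
        = - (\<Sum>i\<in>UNIV. \<integral>x. m x * partial i (partial i \<phi>) x \<partial>torus_measure)"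
      using wg[OF p] by (simp add: sum_negf)
    finally have "(\<Sum>i\<in>UNIV. \<integral>x. m x * partial i (partial i \<phi>) x \<partial>torus_measure)
        + (\<Sum>i\<in>UNIV. \<integral>x. m x * A x $ i * partial i \<phi> x \<partial>torus_measure) = 0"
      using g(2)[OF \<phi>] by simp
    then have "(\<integral>x. (\<Sum>i\<in>UNIV. m x * partial i (partial i \<phi>) x) + (\<Sum>i\<in>UNIV. m x * A x $ i * partial i \<phi> x) \<partial>torus_measure) = 0"
      using i1 i3 by simp
    moreover have "(\<integral>x. (\<Sum>i\<in>UNIV. m x * partial i (partial i \<phi>) x) + (\<Sum>i\<in>UNIV. m x * A x $ i * partial i \<phi> x) \<partial>torus_measure)
      = (\<oint>x. m' x * ((\<Sum>i\<in>UNIV. partial i (partial i \<phi>) x) + A' x \<bullet> grad \<phi> x))"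
    proof (rule integral_torus_measure)
      show "(\<lambda>x. (\<Sum>i\<in>UNIV. m x * partial i (partial i \<phi>) x) + (\<Sum>i\<in>UNIV. m x * A x $ i * partial i \<phi> x))
          \<in> borel_measurable torus_measure"
        using i1 i3 by (intro borel_measurable_add borel_measurable_sum) auto
      show "(\<lambda>x. m' x * ((\<Sum>i\<in>UNIV. partial i (partial i \<phi>) x) + A' x \<bullet> grad \<phi> x)) \<in> borel_measurable borel"
        unfolding inner_eq
        by (intro borel_measurable_times borel_measurable_add borel_measurable_sum m'_meas A'_meas
            measurable_vec_nth_compose test_measurable p pp)
      show "AE x in torus_measure. (\<Sum>i\<in>UNIV. m x * partial i (partial i \<phi>) x) + (\<Sum>i\<in>UNIV. m x * A x $ i * partial i \<phi> x)
          = m' x * ((\<Sum>i\<in>UNIV. partial i (partial i \<phi>) x) + A' x \<bullet> grad \<phi> x)"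
        using m'_eq A'_eq by eventually_elim (simp add: inner_eq distrib_left sum_distrib_left mult.assoc)
    qed
    ultimately show "(\<oint>x. m' x * ((\<Sum>i\<in>UNIV. partial i (partial i \<phi>) x) + A' x \<bullet> grad \<phi> x)) = 0"
      by simp
  qed measurable
  then show ?thesis using that m'_eq A'_eq by blast
qed

text \<open>The exponent on the norm is \<open>\<beta>\<close> times the one on the integral,
  because \<open>Lp_norm\<close> contains the power \<open>1 / \<beta>\<close>. Membership in the
  space is asserted together with the bound, since the norm of a function whose power is not
  integrable would be 0 and the bound void.\<close>

lemma weak_solution_estimate:
  fixes \<gamma>' \<beta> \<sigma> :: real
  assumes \<gamma>': "\<gamma>' > 1" and \<beta>: "\<beta> > 1" and \<sigma>: "0 < \<sigma>" "\<sigma> < 1 / real CARD('n::finite)"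
    and crit: "1 - 1 / \<beta> \<le> \<gamma>' * \<sigma>"
  shows "\<exists>C>0. \<forall>(m :: real ^ 'n \<Rightarrow> real) (A :: real ^ 'n \<Rightarrow> real ^ 'n).
    in_W12 m \<and> in_Linf A \<and> weak_solution A m \<and> (LINT x|torus_measure. m x) = 1 \<longrightarrow>
    in_Lp \<beta> m \<and>
    Lp_norm \<beta> m powr (\<sigma> * \<gamma>' * \<beta> / (\<beta> - 1)) \<le> C * ((LINT x|torus_measure. norm (A x) powr \<gamma>' * m x) + 1)"
proof -
  obtain C where C: "C > 0" "\<And>A (m :: real ^ 'n \<Rightarrow> real) K. bounded_drift_solution A m K \<Longrightarrow> (\<oint>x. m x) = 1 \<Longrightarrow>
    (\<oint>x. \<bar>m x\<bar> powr \<beta>) powr (\<sigma> * \<gamma>' / (\<beta> - 1)) \<le>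
      C * ((\<oint>x. norm (A x) powr \<gamma>' * m x) + 1)"
    using a_priori_estimate[OF assms] by blast
  have "in_Lp \<beta> m \<and> Lp_norm \<beta> m powr (\<sigma> * \<gamma>' * \<beta> / (\<beta> - 1)) \<le> C * ((LINT x|torus_measure. norm (A x) powr \<gamma>' * m x) + 1)"
    if m: "in_W12 m" and A: "in_Linf A" and sol: "weak_solution A m" and one: "(LINT x|torus_measure. m x) = 1"
    for m :: "real ^ 'n \<Rightarrow> real" and A :: "real ^ 'n \<Rightarrow> real ^ 'n"
  proof -
    obtain m' A' K where sol': "bounded_drift_solution A' m' K"
      and m': "AE x in torus_measure. m x = m' x" and A': "AE x in torus_measure. A x = A' x"
      using bounded_drift_solution_exists[OF A sol] by blast
    interpret bounded_drift_solution A' m' K by (rule sol')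
    have [measurable]: "m \<in> borel_measurable torus_measure" "A \<in> borel_measurable torus_measure" and per: "periodic m"
      using m A by (auto simp: in_W12_def has_W12_gradient_def in_Lp_def in_Linf_def)
    have one': "(\<oint>x. m' x) = 1" using one integral_torus_measure[OF _ _ m'] by simp
    have m\<beta>: "AE x in torus_measure. norm (m x) powr \<beta> = \<bar>m' x\<bar> powr \<beta>" using m' by eventually_elim simp
    have Am: "AE x in torus_measure. norm (A x) powr \<gamma>' * m x = norm (A' x) powr \<gamma>' * m' x"
      using m' A' by eventually_elim simp
    have "integrable torus_measure (\<lambda>x. norm (m x) powr \<beta>)"
      using integrable_torus_measure[OF _ _ m\<beta>] integrable_powr[of \<beta>] \<beta> by simp
    then have L: "in_Lp \<beta> m" using per by (simp add: in_Lp_def)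
    have "Lp_norm \<beta> m powr (\<sigma> * \<gamma>' * \<beta> / (\<beta> - 1)) = (\<oint>x. \<bar>m' x\<bar> powr \<beta>) powr (\<sigma> * \<gamma>' / (\<beta> - 1))"
      unfolding Lp_norm_def using integral_torus_measure[OF _ _ m\<beta>] \<beta> by (simp add: powr_powr)
    also have "\<dots> \<le> C * ((\<oint>x. norm (A' x) powr \<gamma>' * m' x) + 1)" by (rule C(2)[OF sol' one'])
    also have "(\<oint>x. norm (A' x) powr \<gamma>' * m' x) = (LINT x|torus_measure. norm (A x) powr \<gamma>' * m x)"
      using integral_torus_measure[OF _ _ Am] by simp
    finally show ?thesis using L by simp
  qed
  then show ?thesis using C(1) by blast
qed

theorem proposition2p3:
  fixes \<gamma>' \<beta> :: real
  assumes "\<gamma>' > 1" and "\<beta> > 1"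
    and "\<gamma>' < real CARD('n::finite) \<Longrightarrow> \<beta> < 1 + \<gamma>' / (real CARD('n) - \<gamma>')"
  shows
    "(\<exists>C>0. \<exists>\<delta>>1. \<forall>(m :: real ^ 'n \<Rightarrow> real) (A :: real ^ 'n \<Rightarrow> real ^ 'n).
        in_W12 m \<and> in_Linf A \<and> weak_solution A m \<and> (LINT x|torus_measure. m x) = 1 \<longrightarrow>
        in_Lp \<beta> m \<and>
        Lp_norm \<beta> m powr \<delta> \<le> C * ((LINT x|torus_measure. norm (A x) powr \<gamma>' * m x) + 1))
   \<and> (\<beta> < 1 + \<gamma>' / real CARD('n) \<longrightarrow>
      (\<exists>C>0. \<exists>\<delta>>1. \<forall>(m :: real ^ 'n \<Rightarrow> real) (A :: real ^ 'n \<Rightarrow> real ^ 'n).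
        in_W12 m \<and> in_Linf A \<and> weak_solution A m \<and> (LINT x|torus_measure. m x) = 1 \<longrightarrow>
        in_Lp \<beta> m \<and>
        Lp_norm \<beta> m powr (\<delta> * \<beta>) \<le> C * ((LINT x|torus_measure. norm (A x) powr \<gamma>' * m x) + 1)))"
proof (intro conjI impI, goal_cases)
  case 1
  let ?N = "real CARD('n)"
  have N0: "?N > 0" by simp
  \<comment> \<open>The smallest \<open>\<sigma>\<close> for which the Hoelder exponents are
    admissible. The range of \<open>\<beta>\<close> says precisely that it lies below
    \<open>1 / N\<close>; choosing \<open>\<sigma>\<close> strictly above it makes
    \<open>\<delta> = \<sigma> * \<gamma>' * \<beta> / (\<beta> - 1)\<close> larger than 1.\<close>
  define \<alpha> where "\<alpha> = (1 - 1 / \<beta>) / \<gamma>'"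
  have \<alpha>0: "\<alpha> > 0" using assms(1,2) by (simp add: \<alpha>_def)
  have "\<alpha> < 1 / ?N"
  proof (cases "\<gamma>' < ?N")
    case True
    have "\<beta> < ?N / (?N - \<gamma>')" using assms(3)[OF True] True by (simp add: field_simps)
    then have "\<beta> * (?N - \<gamma>') < ?N" using True by (simp add: field_simps)
    then have "?N * (1 - 1 / \<beta>) < \<gamma>'" using assms(2) by (simp add: field_simps)
    then show ?thesis using N0 assms(1) by (simp add: \<alpha>_def field_simps)
  next
    case False
    have "\<alpha> < 1 / \<gamma>'" unfolding \<alpha>_def using assms(1,2) by (intro divide_strict_right_mono) auto
    also have "\<dots> \<le> 1 / ?N" using False N0 assms(1) by (intro divide_left_mono mult_pos_pos) auto
    finally show ?thesis .
  qed
  then obtain \<sigma> where \<sigma>: "\<alpha> < \<sigma>" "\<sigma> < 1 / ?N" using dense by blast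
  have crit: "1 - 1 / \<beta> < \<gamma>' * \<sigma>" using \<sigma>(1) assms(1) by (simp add: \<alpha>_def divide_less_eq mult.commute)
  have \<delta>: "\<sigma> * \<gamma>' * \<beta> / (\<beta> - 1) > 1" using crit assms(2) by (simp add: field_simps)
  show ?case
    using weak_solution_estimate[OF assms(1,2) _ \<sigma>(2)] \<alpha>0 \<sigma>(1) crit \<delta> by (meson less_imp_le less_trans)
next
  case sub: 2
  let ?N = "real CARD('n)"
  have N0: "?N > 0" by simp
  \<comment> \<open>Now \<open>\<delta> = \<sigma> * \<gamma>' / (\<beta> - 1)\<close> must exceed
    1, that is, \<open>\<sigma> > (\<beta> - 1) / \<gamma>'\<close>. Such a \<open>\<sigma>\<close>
    below \<open>1 / N\<close> exists exactly when \<open>\<beta> < 1 + \<gamma>' / N\<close>, and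
    it meets the former condition because \<open>1 - 1 / \<beta> \<le> \<beta> - 1\<close>.\<close>
  have "(\<beta> - 1) / \<gamma>' < 1 / ?N" using sub assms(1) N0 by (simp add: field_simps)
  then obtain \<sigma> where \<sigma>: "(\<beta> - 1) / \<gamma>' < \<sigma>" "\<sigma> < 1 / ?N" using dense by blast
  have \<sigma>0: "\<sigma> > 0" using \<sigma>(1) assms(1,2) by (smt (verit) divide_pos_pos)
  have crit': "\<beta> - 1 < \<gamma>' * \<sigma>" using \<sigma>(1) assms(1) by (simp add: divide_less_eq mult.commute)
  have "1 - 1 / \<beta> \<le> \<beta> - 1"
  proof -
    have "1 - 1 / \<beta> = (\<beta> - 1) / \<beta>" using assms(2) by (simp add: field_simps)
    also have "\<dots> \<le> (\<beta> - 1) / 1" using assms(2) by (intro divide_left_mono) auto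
    finally show ?thesis by simp
  qed
  then have crit: "1 - 1 / \<beta> \<le> \<gamma>' * \<sigma>" using crit' by linarith
  have \<delta>: "\<sigma> * \<gamma>' / (\<beta> - 1) > 1" using crit' assms(2) by (simp add: mult.commute)
  have eq: "\<sigma> * \<gamma>' * \<beta> / (\<beta> - 1) = \<sigma> * \<gamma>' / (\<beta> - 1) * \<beta>" by simp
  show ?case
    using weak_solution_estimate[OF assms(1,2) \<sigma>0 \<sigma>(2) crit] \<delta> unfolding eq by blast
qed

end
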